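(* Let $M$ be a connected $(d-1)$-dimensional homology manifold without boundary, $d\ge4$. Then there exists $\gamma(M)$ such that for every pair of integers $(a,b)$ with $\gamma(M)\le b\le\binom{a+1}{2}$ there exists a triangulation $\Delta$ of $M$ with $g_1(\Delta)=a$ and $g_2(\Delta)=b$.
   Context: Homology manifolds are simplicial complexes: over a field $k$, $M$ is a pure complex such that for every nonempty face $\rho$ the link $\{\tau:\tau\cap\rho=\emptyset,\tau\cup\rho\in M\}$ has the $k$-homology of $S^{d-|\rho|-1}$ (without boundary). A triangulation of $M$ is a simplicial complex whose geometric realization is homeomorphic to that of $M$. For a $(d-1)$-dimensional complex, $h_i=\sum_{j=0}^i(-1)^{i-j}\binom{d-j}{d-i}f_{j-1}$ ($f_j$ the number of $j$-faces, $f_{-1}=1$), $g_1=h_1-1$, $g_2=h_2-h_1$. *)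

theory Defs
  imports "HOL-Analysis.Analysis" "HOL-Library.Function_Algebras" "HOL-Library.Set_Algebras"
begin

text \<open>Finite abstract simplicial complexes, as the set of all their faces. The empty face is
  always included.\<close>

definition simplicial_complex :: "'a set set \<Rightarrow> bool" where
  "simplicial_complex K \<longleftrightarrow>
     finite K \<and> {} \<in> K \<and> (\<forall>\<sigma>\<in>K. finite \<sigma> \<and> (\<forall>\<tau>. \<tau> \<subseteq> \<sigma> \<longrightarrow> \<tau> \<in> K))"

text \<open>The largest size of a face: a complex of rank \<open>d\<close> is \<open>(d - 1)\<close>-dimensional.\<close>

definition complex_rank :: "'a set set \<Rightarrow> nat" where
  "complex_rank K = Max (card ` K)"

definition pure_complex :: "'a set set \<Rightarrow> bool" where
  "pure_complex K \<longleftrightarrow>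
     (\<forall>\<sigma>\<in>K. (\<forall>\<tau>\<in>K. \<sigma> \<subseteq> \<tau> \<longrightarrow> \<tau> = \<sigma>) \<longrightarrow> card \<sigma> = complex_rank K)"

definition link :: "'a set set \<Rightarrow> 'a set \<Rightarrow> 'a set set" where
  "link K \<rho> = {\<tau>. \<tau> \<inter> \<rho> = {} \<and> \<tau> \<union> \<rho> \<in> K}"

text \<open>Barycentric coordinates. The topology is the one that the type of functions carries in
  the library, the product topology; on a finite complex it is the usual topology of the
  realization.\<close>

definition realization :: "'a set set \<Rightarrow> ('a \<Rightarrow> real) set" where
  "realization K = {x. (\<forall>v. 0 \<le> x v) \<and> {v. x v \<noteq> 0} \<in> K \<and> (\<Sum>v | x v \<noteq> 0. x v) = 1}"

definition triangulation_of :: "'b set set \<Rightarrow> 'a set set \<Rightarrow> bool" where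
  "triangulation_of \<Delta> M \<longleftrightarrow>
     simplicial_complex \<Delta> \<and> realization \<Delta> homeomorphic realization M"


text \<open>Reduced simplicial homology with coefficients in a field. The grading is by the number
  of vertices of a face rather than by its dimension, so that index \<open>n\<close> stands for degree
  \<open>n - 1\<close>, and the augmentation is the boundary map from index 1 to index 0. Faces are
  oriented by the order of the vertex type.\<close>

definition chains :: "'a set set \<Rightarrow> nat \<Rightarrow> ('a set \<Rightarrow> 'k::field) set" where
  "chains K n = {c. \<forall>\<sigma>. c \<sigma> \<noteq> 0 \<longrightarrow> \<sigma> \<in> K \<and> card \<sigma> = n}"

text \<open>The coefficient of \<open>\<sigma>\<close> in the boundary of \<open>c\<close>. The exponent is the position of \<open>v\<close> in
  the face \<open>insert v \<sigma>\<close>, counted from 0.\<close>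

definition boundary_map ::
  "'a::linorder set set \<Rightarrow> ('a set \<Rightarrow> 'k::field) \<Rightarrow> 'a set \<Rightarrow> 'k" where
  "boundary_map K c =
     (\<lambda>\<sigma>. \<Sum>v | v \<notin> \<sigma> \<and> insert v \<sigma> \<in> K. (- 1) ^ card {u \<in> \<sigma>. u < v} * c (insert v \<sigma>))"

definition cycles :: "'a::linorder set set \<Rightarrow> nat \<Rightarrow> ('a set \<Rightarrow> 'k::field) set" where
  "cycles K n = {c \<in> chains K n. boundary_map K c = 0}"

definition boundaries :: "'a::linorder set set \<Rightarrow> nat \<Rightarrow> ('a set \<Rightarrow> 'k::field) set" where
  "boundaries K n = boundary_map K ` chains K (Suc n)"

definition homology_class ::
  "'a::linorder set set \<Rightarrow> nat \<Rightarrow> ('a set \<Rightarrow> 'k::field) \<Rightarrow> ('a set \<Rightarrow> 'k) set" where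
  "homology_class K n z = z +o boundaries K n"

definition reduced_homology ::
  "'a::linorder set set \<Rightarrow> nat \<Rightarrow> ('a set \<Rightarrow> 'k::field) set set" where
  "reduced_homology K n = homology_class K n ` cycles K n"

text \<open>\<open>K\<close> has the \<open>k\<close>-homology of the sphere of dimension \<open>m - 1\<close>: the reduced homology is
  linearly isomorphic to \<open>k\<close> in degree \<open>m - 1\<close> and zero in all other degrees. The case
  \<open>m = 0\<close> is the empty sphere of dimension \<open>- 1\<close>, realized by \<open>{{}}\<close>.\<close>

definition has_sphere_homology ::
  "'k::field itself \<Rightarrow> 'a::linorder set set \<Rightarrow> nat \<Rightarrow> bool" where
  "has_sphere_homology k K m \<longleftrightarrow>
     (\<exists>\<phi> :: ('a set \<Rightarrow> 'k) set \<Rightarrow> 'k.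
        bij_betw \<phi> (reduced_homology K m) UNIV \<and>
        (\<forall>y\<in>cycles K m. \<forall>z\<in>cycles K m.
           \<phi> (homology_class K m (y + z)) = \<phi> (homology_class K m y) + \<phi> (homology_class K m z)) \<and>
        (\<forall>a. \<forall>z\<in>cycles K m.
           \<phi> (homology_class K m (\<lambda>\<sigma>. a * z \<sigma>)) = a * \<phi> (homology_class K m z))) \<and>
     (\<forall>n. n \<noteq> m \<longrightarrow>
        (reduced_homology K n :: ('a set \<Rightarrow> 'k) set set) = {homology_class K n 0})"

definition homology_manifold :: "'k::field itself \<Rightarrow> 'a::linorder set set \<Rightarrow> bool" where
  "homology_manifold k M \<longleftrightarrow>
     simplicial_complex M \<and> pure_complex M \<and>
     (\<forall>\<rho>\<in>M. \<rho> \<noteq> {} \<longrightarrow> has_sphere_homology k (link M \<rho>) (complex_rank M - card \<rho>))"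


text \<open>\<open>face_count K j\<close> is the number of faces with \<open>j\<close> vertices, that is, the entry of the
  f-vector with index \<open>j - 1\<close>.\<close>

definition face_count :: "'a set set \<Rightarrow> nat \<Rightarrow> nat" where
  "face_count K j = card {\<sigma> \<in> K. card \<sigma> = j}"

definition h_number :: "'a set set \<Rightarrow> nat \<Rightarrow> int" where
  "h_number K i =
     (let d = complex_rank K in
      \<Sum>j=0..i. (- 1) ^ (i - j) * int ((d - j) choose (d - i)) * int (face_count K j))"

definition g1 :: "'a set set \<Rightarrow> int" where
  "g1 K = h_number K 1 - 1"

definition g2 :: "'a set set \<Rightarrow> int" where
  "g2 K = h_number K 2 - h_number K 1"

end

theory Submission imports Defs begin

text \<open>A connected homology manifold is a normal pseudomanifold: every ridge lies in two facets and the
  links of the faces of codimension at least two are connected. Only this property is used. It is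
  preserved by stellar subdivisions and by flips, which replace a ridge whose link is a non-adjacent
  pair \<open>u\<close>, \<open>w\<close> by the edge \<open>u w\<close>; a flip does not change the realization, since the stellar
  subdivisions of the ridge and of the new edge coincide. A sequence of flips replaces a stacked ball
  by the cone over its boundary, which adds one vertex, joined to the vertices of the ball, and loses
  no edge as \<open>d \<ge> 4\<close>.

  Call a face of size \<open>d - 2\<close> a hub if its link, a cycle, contains all other vertices. Stellar
  subdivisions produce stacked balls through all vertices, and repeated cones over these produce a
  hub. Around a hub the vertices can be routed so that any non-adjacent pair is joined by a flip,
  while every new vertex is joined to all others and a hub remains; in the end all pairs are joined,
  that is, \<open>g\<^sub>2 = (g\<^sub>1 + 1 choose 2)\<close>. From such a complex with \<open>g\<^sub>1 = a - 1\<close>, the cones over the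
  stacked balls with \<open>d + k\<close> vertices, \<open>k \<le> a\<close>, have \<open>g\<^sub>1 = a\<close> and \<open>g\<^sub>2 = (a choose 2) + k\<close>, and
  subdividing facets increases \<open>g\<^sub>1\<close> while it preserves \<open>g\<^sub>2\<close>.\<close>

section \<open>Stellar subdivisions\<close>

text \<open>In a general normal pseudomanifold a spanning stacked ball is reached by stellar
  subdivisions, and these create new non-adjacent pairs. A hub avoids this: its link is a cycle
  through all other vertices, and the fan along the cycle without one edge is a spanning stacked
  ball of the unchanged complex. The cone over a spanning ball loses no edge and joins its apex to
  everything, so the set of non-adjacent pairs stays as it is. This set is the measure of the main
  induction: once a full hub exists, each move is a cone over a spanning ball or a flip that creates
  a missing edge, until no pair is left. The obstacle is that a cone destroys the hub whose fan it
  uses, so the construction that joins one pair must also return a new hub.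

  The bound \<gamma> is \<open>(n + 1 choose 2) + 1\<close>, where complete triangulations exist for
  all vertex numbers from \<open>n\<close> on. It ensures that the complete triangulation from which
  \<open>b\<close> is reached is among these.\<close>

lemma simplicial_complexD:
  assumes "simplicial_complex K"
  shows "finite K" "{} \<in> K" "\<And>\<sigma>. \<sigma> \<in> K \<Longrightarrow> finite \<sigma>" "\<And>\<sigma> \<tau>. \<sigma> \<in> K \<Longrightarrow> \<tau> \<subseteq> \<sigma> \<Longrightarrow> \<tau> \<in> K"
  using assms unfolding simplicial_complex_def by auto

definition verts :: "'a set set \<Rightarrow> 'a set" where
  "verts K = {v. {v} \<in> K}"

lemma face_subset_verts: "simplicial_complex K \<Longrightarrow> \<sigma> \<in> K \<Longrightarrow> \<sigma> \<subseteq> verts K"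
  unfolding verts_def using simplicial_complexD(4)[of K \<sigma>] by auto

lemma finite_verts: "simplicial_complex K \<Longrightarrow> finite (verts K)"
proof -
  assume K: "simplicial_complex K"
  have "verts K \<subseteq> \<Union> K" by (auto simp: verts_def)
  moreover have "finite (\<Union> K)" using simplicial_complexD(1,3)[OF K] by blast
  ultimately show ?thesis by (rule finite_subset)
qed

text \<open>The support varies with the point; a sum over one fixed finite set can be split linearly
  when image points are computed.\<close>

lemma in_realization_iff:
  assumes "simplicial_complex K" "finite V" "verts K \<subseteq> V"
  shows "x \<in> realization K \<longleftrightarrow>
    (\<forall>v. 0 \<le> x v) \<and> {v. x v \<noteq> 0} \<in> K \<and> (\<forall>v. v \<notin> V \<longrightarrow> x v = 0) \<and> sum x V = 1"
proof -
  have *: "{v. x v \<noteq> 0} \<subseteq> V" if "{v. x v \<noteq> 0} \<in> K"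
    using face_subset_verts[OF assms(1) that] assms(3) by blast
  have eq: "(\<Sum>v | x v \<noteq> 0. x v) = sum x V" if "{v. x v \<noteq> 0} \<in> K"
    using *[OF that] assms(2) by (intro sum.mono_neutral_left) auto
  show ?thesis
  proof (cases "{v. x v \<noteq> 0} \<in> K")
    case True
    have "\<forall>v. v \<notin> V \<longrightarrow> x v = 0" using *[OF True] by blast
    then show ?thesis using True by (simp add: realization_def eq[OF True])
  next
    case False
    then show ?thesis by (simp add: realization_def)
  qed
qed

text \<open>The second part is the cone from \<open>m\<close> over the join of the boundary of
  \<phi> with the link of \<phi>. The condition \<open>\<tau> \<union> \<phi> \<in> K\<close> spares
  the splitting of \<tau> into its parts inside and outside \<phi>.\<close>

definition stellar :: "'a set set \<Rightarrow> 'a set \<Rightarrow> 'a \<Rightarrow> 'a set set" where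
  "stellar K \<phi> m = {\<sigma> \<in> K. \<not> \<phi> \<subseteq> \<sigma>} \<union> insert m ` {\<tau>. \<tau> \<union> \<phi> \<in> K \<and> \<not> \<phi> \<subseteq> \<tau>}"

lemma stellar_iff:
  assumes "simplicial_complex K" "m \<notin> verts K"
  shows "\<sigma> \<in> stellar K \<phi> m \<longleftrightarrow>
    (if m \<in> \<sigma> then (\<sigma> - {m}) \<union> \<phi> \<in> K \<and> \<not> \<phi> \<subseteq> \<sigma> - {m} else \<sigma> \<in> K \<and> \<not> \<phi> \<subseteq> \<sigma>)"
proof -
  have m: "m \<notin> \<sigma>" if "\<sigma> \<in> K" for \<sigma>
    using face_subset_verts[OF assms(1) that] assms(2) by blast
  show ?thesis
  proof (cases "m \<in> \<sigma>")
    case True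
    have "\<sigma> \<in> stellar K \<phi> m \<longleftrightarrow> (\<exists>\<tau>. \<tau> \<union> \<phi> \<in> K \<and> \<not> \<phi> \<subseteq> \<tau> \<and> \<sigma> = insert m \<tau>)"
      using m True by (auto simp: stellar_def)
    also have "\<dots> \<longleftrightarrow> (\<sigma> - {m}) \<union> \<phi> \<in> K \<and> \<not> \<phi> \<subseteq> \<sigma> - {m}"
    proof
      assume "\<exists>\<tau>. \<tau> \<union> \<phi> \<in> K \<and> \<not> \<phi> \<subseteq> \<tau> \<and> \<sigma> = insert m \<tau>"
      then obtain \<tau> where t: "\<tau> \<union> \<phi> \<in> K" "\<not> \<phi> \<subseteq> \<tau>" "\<sigma> = insert m \<tau>" by blast
      then have "\<sigma> - {m} = \<tau>" using m[OF t(1)] by auto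
      then show "(\<sigma> - {m}) \<union> \<phi> \<in> K \<and> \<not> \<phi> \<subseteq> \<sigma> - {m}" using t by simp
    next
      assume "(\<sigma> - {m}) \<union> \<phi> \<in> K \<and> \<not> \<phi> \<subseteq> \<sigma> - {m}"
      then show "\<exists>\<tau>. \<tau> \<union> \<phi> \<in> K \<and> \<not> \<phi> \<subseteq> \<tau> \<and> \<sigma> = insert m \<tau>"
        using True by (intro exI[of _ "\<sigma> - {m}"]) auto
    qed
    finally show ?thesis using True by simp
  next
    case False then show ?thesis by (auto simp: stellar_def)
  qed
qed

lemma simplicial_complex_stellar:
  assumes K: "simplicial_complex K" and p: "\<phi> \<noteq> {}" and m: "m \<notin> verts K"
  shows "simplicial_complex (stellar K \<phi> m)"
proof -
  note st = stellar_iff[OF K m] and s = simplicial_complexD[OF K]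
  have "{\<tau>. \<tau> \<union> \<phi> \<in> K \<and> \<not> \<phi> \<subseteq> \<tau>} \<subseteq> K" using s(4) by auto
  then have "finite {\<tau>. \<tau> \<union> \<phi> \<in> K \<and> \<not> \<phi> \<subseteq> \<tau>}" using s(1) finite_subset by blast
  then have fin: "finite (stellar K \<phi> m)" unfolding stellar_def using s(1) by auto
  moreover have "{} \<in> stellar K \<phi> m" using s(2) p by (simp add: st)
  moreover have "finite \<sigma>" if "\<sigma> \<in> stellar K \<phi> m" for \<sigma>
  proof (cases "m \<in> \<sigma>")
    case True
    then have "(\<sigma> - {m}) \<union> \<phi> \<in> K" using that by (simp add: st)
    from s(3)[OF this] show ?thesis by simp
  next
    case False then show ?thesis using that s(3) by (simp add: st)
  qed
  moreover have "\<tau> \<in> stellar K \<phi> m" if a: "\<sigma> \<in> stellar K \<phi> m" "\<tau> \<subseteq> \<sigma>" for \<sigma> \<tau>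
  proof (cases "m \<in> \<sigma>")
    case True
    then have 1: "(\<sigma> - {m}) \<union> \<phi> \<in> K" "\<not> \<phi> \<subseteq> \<sigma> - {m}" using a by (auto simp: st)
    have "(\<tau> - {m}) \<union> \<phi> \<in> K" by (rule s(4)[OF 1(1)]) (use a(2) in auto)
    moreover have "\<tau> - {m} \<in> K" by (rule s(4)[OF 1(1)]) (use a(2) in auto)
    moreover have "\<not> \<phi> \<subseteq> \<tau> - {m}" using 1(2) a(2) by blast
    ultimately show ?thesis by (auto simp: st)
  next
    case False
    then show ?thesis using a s(4)[of \<sigma> \<tau>] by (auto simp: st)
  qed
  ultimately show ?thesis unfolding simplicial_complex_def by blast
qed

lemma continuous_on_eval: "continuous_on S (\<lambda>x :: 'a \<Rightarrow> real. x v)"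
  by (rule continuous_on_subset[OF continuous_on_product_coordinates]) simp

lemma continuous_on_Min_eval:
  assumes "finite \<phi>" "\<phi> \<noteq> {}"
  shows "continuous_on S (\<lambda>x :: 'a \<Rightarrow> real. Min (x ` \<phi>))"
  using assms
proof (induction \<phi> rule: finite_ne_induct)
  case (singleton v)
  show ?case by (simp add: continuous_on_eval)
next
  case (insert v \<phi>)
  have "(\<lambda>x :: 'a \<Rightarrow> real. Min (x ` insert v \<phi>)) = (\<lambda>x. min (x v) (Min (x ` \<phi>)))"
    using insert.hyps by (intro ext) simp
  then show ?case
    by (simp only:) (intro continuous_on_min insert.IH continuous_on_eval)
qed

text \<open>The vertex \<open>m\<close> is placed at the barycenter of \<phi>: \<open>h\<close>
  spreads the weight of \<open>m\<close> evenly over \<phi>, and \<open>g\<close> takes the common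
  minimum off the coordinates in \<phi> and collects it at \<open>m\<close>.\<close>

lemma realization_stellar_homeomorphic:
  assumes K: "simplicial_complex K" and p: "\<phi> \<in> K" "\<phi> \<noteq> {}" and m: "m \<notin> verts K"
  shows "realization (stellar K \<phi> m) homeomorphic realization K"
proof -
  define V where "V = verts K"
  define h :: "('a \<Rightarrow> real) \<Rightarrow> 'a \<Rightarrow> real"
    where "h x = (\<lambda>v. if v = m then 0 else if v \<in> \<phi> then x v + x m / card \<phi> else x v)" for x
  define g :: "('a \<Rightarrow> real) \<Rightarrow> 'a \<Rightarrow> real"
    where "g (y :: 'a \<Rightarrow> real) = (\<lambda>v. if v = m then card \<phi> * Min (y ` \<phi>)
                   else if v \<in> \<phi> then y v - Min (y ` \<phi>) else y v)" for y :: "'a \<Rightarrow> real"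
  note s = simplicial_complexD[OF K] and st = stellar_iff[OF K m]
  have finV: "finite V" using finite_verts[OF K] V_def by simp
  have finp: "finite \<phi>" using s(3) p by simp
  then have cp: "0 < card \<phi>" using p(2) by (simp add: card_gt_0_iff)
  have pV: "\<phi> \<subseteq> V" using face_subset_verts[OF K p(1)] V_def by simp
  have mV: "m \<notin> V" using m V_def by simp
  then have mp: "m \<notin> \<phi>" using pV by blast
  have S: "simplicial_complex (stellar K \<phi> m)" by (rule simplicial_complex_stellar[OF K p(2) m])
  have VS: "verts (stellar K \<phi> m) \<subseteq> insert m V"
    by (auto simp: verts_def V_def st split: if_splits)
  note rK = in_realization_iff[OF K finV, unfolded V_def[symmetric], OF subset_refl]
  have rS: "x \<in> realization (stellar K \<phi> m) \<longleftrightarrow>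
    (\<forall>v. 0 \<le> x v) \<and> {v. x v \<noteq> 0} \<in> stellar K \<phi> m \<and> (\<forall>v. v \<notin> insert m V \<longrightarrow> x v = 0)
      \<and> x m + sum x V = 1" for x :: "'a \<Rightarrow> real"
    using in_realization_iff[OF S _ VS] finV mV by simp
  have min0: "Min (x ` \<phi>) = 0" if "\<And>v. 0 \<le> x v" "\<not> \<phi> \<subseteq> {v. x v \<noteq> 0}" for x :: "'a \<Rightarrow> real"
  proof -
    obtain v where "v \<in> \<phi>" "x v = 0" using \<open>\<not> \<phi> \<subseteq> {v. x v \<noteq> 0}\<close> by blast
    then show ?thesis using finp that(1) by (intro Min_eqI) (auto simp: image_iff intro: bexI[of _ v])
  qed
  have hK: "h x \<in> realization K" if x: "x \<in> realization (stellar K \<phi> m)" for x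
  proof -
    have nn: "0 \<le> x v" for v using x rS by simp
    have nh: "0 \<le> h x v" for v using nn by (simp add: h_def)
    have sum: "sum (h x) V = 1"
    proof -
      have "sum (h x) V = (\<Sum>v\<in>V. x v + (if v \<in> \<phi> then x m / card \<phi> else 0))"
        using mV by (intro sum.cong) (auto simp: h_def)
      also have "\<dots> = sum x V + (\<Sum>v\<in>\<phi>. x m / card \<phi>)"
        using finV pV by (simp add: sum.distrib sum.If_cases Int_absorb1)
      also have "\<dots> = 1" using x rS cp by simp
      finally show ?thesis .
    qed
    have supp: "{v. h x v \<noteq> 0} \<in> K"
    proof (cases "x m = 0")
      case True
      then have "{v. h x v \<noteq> 0} = {v. x v \<noteq> 0}" by (auto simp: h_def)
      then show ?thesis using x rS True st by auto
    next
      case False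
      then have xm: "0 < x m" using nn[of m] by simp
      have pos: "x v + x m / card \<phi> \<noteq> 0" for v
        using nn[of v] xm cp by (smt (verit) divide_pos_pos of_nat_0_less_iff)
      have "{v. h x v \<noteq> 0} = ({v. x v \<noteq> 0} - {m}) \<union> \<phi>"
        using mp pos by (auto simp: h_def)
      then show ?thesis using x rS False st[of "{v. x v \<noteq> 0}" \<phi>] by auto
    qed
    have "h x v = 0" if "v \<notin> V" for v using that x rS pV by (auto simp: h_def)
    then show ?thesis unfolding rK using nh sum supp by blast
  qed
  have gS: "g y \<in> realization (stellar K \<phi> m)" if y: "y \<in> realization K" for y
  proof -
    let ?mu = "Min (y ` \<phi>)"
    have nn: "0 \<le> y v" for v using y rK by simp
    have mu0: "0 \<le> ?mu" using finp p(2) nn by (intro Min.boundedI) auto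
    have mule: "?mu \<le> y v" if "v \<in> \<phi>" for v using finp that by simp
    have nh: "0 \<le> g y v" for v using nn mu0 mule by (simp add: g_def)
    have gm: "g y m = card \<phi> * ?mu" by (simp add: g_def)
    have sum: "g y m + sum (g y) V = 1"
    proof -
      have "sum (g y) V = (\<Sum>v\<in>V. y v - (if v \<in> \<phi> then ?mu else 0))"
        using mV by (intro sum.cong) (auto simp: g_def)
      also have "\<dots> = sum y V - card \<phi> * ?mu"
        using finV pV by (simp add: sum_subtractf sum.If_cases Int_absorb1)
      finally show ?thesis using y rK gm by simp
    qed
    have out: "g y v = 0" if "v \<notin> insert m V" for v
      using that y rK pV by (auto simp: g_def)
    have ym: "y m = 0" using y rK mV by simp
    have supp: "{v. g y v \<noteq> 0} \<in> stellar K \<phi> m"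
    proof (cases "?mu = 0")
      case True
      then have g: "g y = y" using ym by (auto simp: g_def)
      have "?mu \<in> y ` \<phi>" using finp p(2) by (intro Min_in) auto
      then have "\<not> \<phi> \<subseteq> {v. y v \<noteq> 0}" using True by auto
      then show ?thesis using y rK g ym st by auto
    next
      case False
      then have mp0: "0 < ?mu" using mu0 by simp
      have sub: "\<phi> \<subseteq> {v. y v \<noteq> 0}" using mule mp0 by fastforce
      have min: "m \<in> {v. g y v \<noteq> 0}" using gm cp mp0 by simp
      have "({v. g y v \<noteq> 0} - {m}) \<union> \<phi> = {v. y v \<noteq> 0}"
        using sub ym mp by (auto simp: g_def split: if_splits)
      moreover have "\<not> \<phi> \<subseteq> {v. g y v \<noteq> 0} - {m}"
      proof -
        have "?mu \<in> y ` \<phi>" using finp p(2) by (intro Min_in) auto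
        then obtain v where "v \<in> \<phi>" "y v = ?mu" by auto
        then have "g y v = 0" using mp by (auto simp: g_def)
        then show ?thesis using \<open>v \<in> \<phi>\<close> by auto
      qed
      ultimately show ?thesis using min st y rK by auto
    qed
    then show ?thesis unfolding rS using nh sum out by blast
  qed
  have gh: "g (h x) = x" if x: "x \<in> realization (stellar K \<phi> m)" for x
  proof -
    have nn: "0 \<le> x v" for v using x rS by simp
    \<comment> \<open>No face of the subdivision contains all of \<phi>, so some coordinate on
      \<phi> vanishes and the minimum that \<open>g\<close> finds in \<open>h x\<close> is exactly
      the share added by \<open>h\<close>.\<close>
    have "\<not> \<phi> \<subseteq> {v. x v \<noteq> 0}"
      using x rS st[of "{v. x v \<noteq> 0}" \<phi>] mp by (auto split: if_splits)
    then have m0: "Min (x ` \<phi>) = 0" using min0 nn by blast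
    have "h x ` \<phi> = (\<lambda>t. t + x m / card \<phi>) ` (x ` \<phi>)"
      using mp by (auto simp: h_def image_iff)
    then have "Min (h x ` \<phi>) = Min (x ` \<phi>) + x m / card \<phi>"
      using Min_add_commute[of \<phi> x "x m / card \<phi>"] finp p(2) by (simp add: image_image)
    then have mh: "Min (h x ` \<phi>) = x m / card \<phi>" using m0 by simp
    show ?thesis
    proof
      fix v show "g (h x) v = x v" unfolding g_def mh using cp mp by (auto simp: h_def)
    qed
  qed
  have hg: "h (g y) = y" if y: "y \<in> realization K" for y
  proof
    fix v
    have "y m = 0" using y rK mV by simp
    then show "h (g y) v = y v" using cp mp by (auto simp: h_def g_def)
  qed
  have ch: "continuous_on S h" for S
  proof (intro continuous_on_coordinatewise_then_product)
    fix v
    consider "v = m" | "v \<noteq> m" "v \<in> \<phi>" | "v \<noteq> m" "v \<notin> \<phi>" by blast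
    then show "continuous_on S (\<lambda>y. h y v)"
      by cases (auto simp: h_def divide_inverse intro!: continuous_on_eval continuous_on_add continuous_on_mult)
  qed
  have cg: "continuous_on S g" for S
  proof (intro continuous_on_coordinatewise_then_product)
    fix v
    consider "v = m" | "v \<noteq> m" "v \<in> \<phi>" | "v \<noteq> m" "v \<notin> \<phi>" by blast
    then show "continuous_on S (\<lambda>y. g y v)"
      by cases (auto simp: g_def intro!: continuous_on_eval continuous_on_diff continuous_on_mult
                  continuous_on_Min_eval finp p(2))
  qed
  have "h ` realization (stellar K \<phi> m) = realization K"
    using hK gS hg by (metis (no_types, lifting) image_subsetI subsetI antisym image_eqI)
  moreover have "g ` realization K = realization (stellar K \<phi> m)"
    using hK gS gh by (metis (no_types, lifting) image_subsetI subsetI antisym image_eqI)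
  ultimately have "homeomorphism (realization (stellar K \<phi> m)) (realization K) h g"
    unfolding homeomorphism_def using gh hg ch cg by blast
  then show ?thesis unfolding homeomorphic_def by blast
qed

section \<open>Normal pseudomanifolds\<close>

text \<open>For \<open>a = b\<close> this says that \<open>a\<close> is a vertex of the link, so one
  predicate serves for the vertices and the edges of the link graph.\<close>

definition link_adj :: "'a set set \<Rightarrow> 'a set \<Rightarrow> 'a \<Rightarrow> 'a \<Rightarrow> bool" where
  "link_adj K \<alpha> a b \<longleftrightarrow> a \<notin> \<alpha> \<and> b \<notin> \<alpha> \<and> insert a (insert b \<alpha>) \<in> K"

text \<open>The parameter \<open>d\<close> is the size of the facets. For \<open>d \<ge> 2\<close>
  the last clause includes \<alpha> = {}, which is the connectedness of \<open>K\<close>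
  itself.\<close>

definition normal_pm :: "nat \<Rightarrow> 'a set set \<Rightarrow> bool" where
  "normal_pm d K \<longleftrightarrow> simplicial_complex K \<and>
     (\<forall>\<sigma>\<in>K. \<exists>\<tau>\<in>K. \<sigma> \<subseteq> \<tau> \<and> card \<tau> = d) \<and>
     (\<forall>\<sigma>\<in>K. card \<sigma> \<le> d) \<and>
     (\<forall>\<rho>\<in>K. card \<rho> + 1 = d \<longrightarrow> card {v. v \<notin> \<rho> \<and> insert v \<rho> \<in> K} = 2) \<and>
     (\<forall>\<alpha>\<in>K. card \<alpha> + 2 \<le> d \<longrightarrow>
        (\<forall>x y. link_adj K \<alpha> x x \<longrightarrow> link_adj K \<alpha> y y \<longrightarrow> (link_adj K \<alpha>)\<^sup>*\<^sup>* x y))"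

lemma link_adj_commute: "link_adj K \<alpha> a b \<longleftrightarrow> link_adj K \<alpha> b a"
  unfolding link_adj_def by (auto simp: insert_commute)

lemma link_adj_rtranclp_sym: "(link_adj K \<alpha>)\<^sup>*\<^sup>* a b \<Longrightarrow> (link_adj K \<alpha>)\<^sup>*\<^sup>* b a"
  by (induction rule: rtranclp_induct)
     (auto dest: link_adj_commute[THEN iffD1] intro: converse_rtranclp_into_rtranclp)

lemma link_adj_refl: "simplicial_complex K \<Longrightarrow> link_adj K \<alpha> a b \<Longrightarrow> link_adj K \<alpha> a a"
  unfolding link_adj_def using simplicial_complexD(4)[of K "insert a (insert b \<alpha>)" "insert a \<alpha>"]
  by auto

lemma normal_pmD:
  assumes "normal_pm d K"
  shows "simplicial_complex K" "\<And>\<sigma>. \<sigma> \<in> K \<Longrightarrow> \<exists>\<tau>\<in>K. \<sigma> \<subseteq> \<tau> \<and> card \<tau> = d"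
    "\<And>\<sigma>. \<sigma> \<in> K \<Longrightarrow> card \<sigma> \<le> d"
    "\<And>\<rho>. \<rho> \<in> K \<Longrightarrow> card \<rho> + 1 = d \<Longrightarrow> card {v. v \<notin> \<rho> \<and> insert v \<rho> \<in> K} = 2"
    "\<And>\<alpha> x y. \<alpha> \<in> K \<Longrightarrow> card \<alpha> + 2 \<le> d \<Longrightarrow> link_adj K \<alpha> x x \<Longrightarrow> link_adj K \<alpha> y y \<Longrightarrow>
        (link_adj K \<alpha>)\<^sup>*\<^sup>* x y"
  using assms unfolding normal_pm_def by blast+

text \<open>Moves connectedness from an old link graph \<open>P\<close> to a new one
  \<open>R\<close>. Subdivisions and flips both use it with an \<open>f\<close> that redirects the
  vertices which disappear from the link.\<close>

lemma connected_via_map: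
  assumes start: "\<And>x. Q x \<Longrightarrow> \<exists>a. P a a \<and> R\<^sup>*\<^sup>* x (f a)"
    and step: "\<And>a b. P a b \<Longrightarrow> R\<^sup>*\<^sup>* (f a) (f b)"
    and conn: "\<And>a b. P a a \<Longrightarrow> P b b \<Longrightarrow> P\<^sup>*\<^sup>* a b"
    and sym: "\<And>a b. R\<^sup>*\<^sup>* a b \<Longrightarrow> R\<^sup>*\<^sup>* b a"
    and "Q x" "Q y"
  shows "R\<^sup>*\<^sup>* x y"
proof -
  obtain a b where ab: "P a a" "R\<^sup>*\<^sup>* x (f a)" "P b b" "R\<^sup>*\<^sup>* y (f b)"
    using start assms(5,6) by metis
  have "P\<^sup>*\<^sup>* a b" using conn ab by blast
  then have "R\<^sup>*\<^sup>* (f a) (f b)"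
    by (induction rule: rtranclp_induct) (auto intro: step rtranclp_trans)
  then show ?thesis using ab(2) sym[OF ab(4)] by (meson rtranclp_trans)
qed

lemma card_exchange: "finite N \<Longrightarrow> c \<in> N \<Longrightarrow> m \<notin> N \<Longrightarrow> card (insert m (N - {c})) = card N"
  using card.remove[of N c] by simp

lemma finite_card_two: "card N = 2 \<Longrightarrow> finite N"
  by (metis card.infinite zero_neq_numeral)

text \<open>A vertex or an edge of the old link is lost only if it completes \<alpha> to a face
  containing \<phi>. Then \<open>m\<close> belongs to the new link: it takes the place of the
  vertex, and it bypasses the edge.\<close>

lemma stellar_link_connected_old:
  assumes K: "normal_pm d K" and m: "m \<notin> verts K"
    and a: "\<alpha> \<in> stellar K \<phi> m" "m \<notin> \<alpha>" "card \<alpha> + 2 \<le> d"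
    and xy: "link_adj (stellar K \<phi> m) \<alpha> x x" "link_adj (stellar K \<phi> m) \<alpha> y y"
  shows "(link_adj (stellar K \<phi> m) \<alpha>)\<^sup>*\<^sup>* x y"
proof -
  note N = normal_pmD[OF K]
  note s = simplicial_complexD[OF N(1)]
  note st = stellar_iff[OF N(1) m]
  let ?L = "stellar K \<phi> m"
  have aK: "\<alpha> \<in> K" "\<not> \<phi> \<subseteq> \<alpha>" using a st by auto
  have mK: "m \<notin> \<sigma>" if "\<sigma> \<in> K" for \<sigma>
    using face_subset_verts[OF N(1) that] m by blast
  define f where "f x = (if \<phi> \<subseteq> insert x \<alpha> then m else x)" for x
  have adj_old: "link_adj ?L \<alpha> u v" if "link_adj K \<alpha> u v" "\<not> \<phi> \<subseteq> insert u (insert v \<alpha>)" for u v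
    using that mK[of "insert u (insert v \<alpha>)"] by (auto simp: link_adj_def st)
  have adj_new: "link_adj ?L \<alpha> u m" if "u \<notin> \<alpha>" "\<not> \<phi> \<subseteq> insert u \<alpha>" "insert u \<alpha> \<union> \<phi> \<in> K" for u
  proof -
    have "u \<noteq> m" using mK[OF that(3)] by blast
    then have "insert u (insert m \<alpha>) - {m} = insert u \<alpha>" using a(2) by auto
    then show ?thesis using that a(2) by (simp add: link_adj_def st)
  qed
  show ?thesis
  proof (rule connected_via_map[where f = f and P = "link_adj K \<alpha>" and Q = "\<lambda>x. link_adj ?L \<alpha> x x"])
    fix u assume u: "link_adj ?L \<alpha> u u"
    show "\<exists>a. link_adj K \<alpha> a a \<and> (link_adj ?L \<alpha>)\<^sup>*\<^sup>* u (f a)"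
    proof (cases "u = m")
      case True
      then have "insert m \<alpha> \<in> ?L" using u by (simp add: link_adj_def)
      then have k: "\<alpha> \<union> \<phi> \<in> K" using a(2) by (simp add: st)
      \<comment> \<open>To leave \<open>m\<close>: a vertex \<open>c\<close> of \<phi> outside
        \<alpha> is adjacent to \<open>m\<close> or has been replaced by it.\<close>
      obtain c where c: "c \<in> \<phi>" "c \<notin> \<alpha>" using aK(2) by blast
      have "insert c \<alpha> \<in> K" by (rule s(4)[OF k]) (use c in auto)
      then have cc: "link_adj K \<alpha> c c" using c by (simp add: link_adj_def)
      have "(link_adj ?L \<alpha>)\<^sup>*\<^sup>* m (f c)"
      proof (cases "\<phi> \<subseteq> insert c \<alpha>")
        case True then show ?thesis by (simp add: f_def)
      next
        case False
        have "insert c \<alpha> \<union> \<phi> = \<alpha> \<union> \<phi>" using c by auto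
        then have "link_adj ?L \<alpha> c m" using adj_new[OF c(2) False] k by simp
        then show ?thesis using False by (auto simp: f_def link_adj_commute)
      qed
      then show ?thesis using cc True by blast
    next
      case False
      then have "m \<notin> insert u \<alpha>" using a(2) by simp
      moreover have "insert u \<alpha> \<in> ?L" "u \<notin> \<alpha>" using u by (auto simp: link_adj_def)
      ultimately have "insert u \<alpha> \<in> K" "\<not> \<phi> \<subseteq> insert u \<alpha>" using st by auto
      then show ?thesis using \<open>u \<notin> \<alpha>\<close> by (intro exI[of _ u]) (auto simp: f_def link_adj_def)
    qed
  next
    fix u v assume uv: "link_adj K \<alpha> u v"
    then have o: "u \<notin> \<alpha>" "v \<notin> \<alpha>" and k: "insert u (insert v \<alpha>) \<in> K" by (auto simp: link_adj_def)
    have lm: "link_adj ?L \<alpha> u m" if "\<not> \<phi> \<subseteq> insert u \<alpha>" "\<phi> \<subseteq> insert u (insert v \<alpha>)"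
    proof (rule adj_new[OF o(1) that(1)])
      show "insert u \<alpha> \<union> \<phi> \<in> K" by (rule s(4)[OF k]) (use that in auto)
    qed
    have lm': "link_adj ?L \<alpha> v m" if "\<not> \<phi> \<subseteq> insert v \<alpha>" "\<phi> \<subseteq> insert u (insert v \<alpha>)"
    proof (rule adj_new[OF o(2) that(1)])
      show "insert v \<alpha> \<union> \<phi> \<in> K" by (rule s(4)[OF k]) (use that in auto)
    qed
    show "(link_adj ?L \<alpha>)\<^sup>*\<^sup>* (f u) (f v)"
    proof (cases "\<phi> \<subseteq> insert u (insert v \<alpha>)")
      case False
      then have "\<not> \<phi> \<subseteq> insert u \<alpha>" "\<not> \<phi> \<subseteq> insert v \<alpha>" by auto
      then show ?thesis using adj_old[OF uv False] by (auto simp: f_def)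
    next
      case True
      have u: "(link_adj ?L \<alpha>)\<^sup>*\<^sup>* (f u) m" using lm[OF _ True] by (auto simp: f_def)
      have v: "(link_adj ?L \<alpha>)\<^sup>*\<^sup>* (f v) m" using lm'[OF _ True] by (auto simp: f_def)
      show ?thesis using u link_adj_rtranclp_sym[OF v] by (meson rtranclp_trans)
    qed
  next
    show "\<And>a b. link_adj K \<alpha> a a \<Longrightarrow> link_adj K \<alpha> b b \<Longrightarrow> (link_adj K \<alpha>)\<^sup>*\<^sup>* a b"
      by (rule N(5)[OF aK(1) a(3)])
  qed (use xy link_adj_rtranclp_sym in auto)
qed

text \<open>The link of \<tau> \<union> {m} is the join of the boundary of the simplex \<phi> -
  \<tau> with the link of \<beta> = \<tau> \<union> \<phi> in \<open>K\<close>. If \<phi> - \<tau>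
  is a single vertex, the first factor is empty and the old link remains; otherwise each vertex of
  one factor is adjacent to all of the other.\<close>

lemma stellar_link_connected_new:
  assumes K: "normal_pm d K" and m: "m \<notin> verts K"
    and a: "\<alpha> \<in> stellar K \<phi> m" "m \<in> \<alpha>" "card \<alpha> + 2 \<le> d"
    and xy: "link_adj (stellar K \<phi> m) \<alpha> x x" "link_adj (stellar K \<phi> m) \<alpha> y y"
  shows "(link_adj (stellar K \<phi> m) \<alpha>)\<^sup>*\<^sup>* x y"
proof -
  note N = normal_pmD[OF K]
  note s = simplicial_complexD[OF N(1)]
  note st = stellar_iff[OF N(1) m]
  let ?L = "stellar K \<phi> m"
  define \<tau> where "\<tau> = \<alpha> - {m}"
  define \<beta> where "\<beta> = \<tau> \<union> \<phi>"
  have at: "\<alpha> = insert m \<tau>" "m \<notin> \<tau>" using a(2) \<tau>_def by auto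
  have bK: "\<beta> \<in> K" and np: "\<not> \<phi> \<subseteq> \<tau>" using a(1) st[of \<alpha>] a(2) \<tau>_def \<beta>_def by auto
  have mK: "m \<notin> \<sigma>" if "\<sigma> \<in> K" for \<sigma>
    using face_subset_verts[OF N(1) that] m by blast
  have fb: "finite \<beta>" using s(3)[OF bK] .
  then have ft: "finite \<tau>" "finite \<phi>" using \<beta>_def by auto
  have ca: "card \<alpha> = card \<tau> + 1" using at ft by simp
  have adj: "link_adj ?L \<alpha> u v \<longleftrightarrow> u \<noteq> m \<and> v \<noteq> m \<and> u \<notin> \<tau> \<and> v \<notin> \<tau> \<and>
      insert u (insert v \<beta>) \<in> K \<and> \<not> \<phi> \<subseteq> insert u (insert v \<tau>)" for u v
  proof (cases "u \<noteq> m \<and> v \<noteq> m")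
    case True
    then have e: "insert u (insert v \<alpha>) - {m} = insert u (insert v \<tau>)" "m \<in> insert u (insert v \<alpha>)"
      using at by auto
    then show ?thesis using True at(1) unfolding link_adj_def st e \<beta>_def by auto
  next
    case False then show ?thesis using at by (auto simp: link_adj_def)
  qed
  show ?thesis
  proof (cases "\<exists>c. \<phi> - \<tau> = {c}")
    case True
    then obtain c where c: "\<phi> - \<tau> = {c}" by blast
    have bt: "\<beta> = insert c \<tau>" "c \<notin> \<tau>" using c \<beta>_def by auto
    then have cb: "card \<beta> + 2 \<le> d" using ft ca a(3) by simp
    have vx: "link_adj K \<beta> u u" if "link_adj ?L \<alpha> u u" for u
    proof -
      have u: "u \<notin> \<tau>" "insert u \<beta> \<in> K" "\<not> \<phi> \<subseteq> insert u \<tau>" using that unfolding adj by auto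
      then have "u \<noteq> c" using c by blast
      then show ?thesis unfolding link_adj_def using u bt by simp
    qed
    have "link_adj ?L \<alpha> u v" if "link_adj K \<beta> u v" for u v
    proof -
      have uv: "u \<notin> \<beta>" "v \<notin> \<beta>" "insert u (insert v \<beta>) \<in> K" using that unfolding link_adj_def by auto
      then have "\<not> \<phi> \<subseteq> insert u (insert v \<tau>)" using c bt by blast
      then show ?thesis unfolding adj using uv bt mK[OF uv(3)] by auto
    qed
    then have "(link_adj K \<beta>)\<^sup>*\<^sup>* u v \<Longrightarrow> (link_adj ?L \<alpha>)\<^sup>*\<^sup>* u v" for u v
      using mono_rtranclp[rule_format, of "link_adj K \<beta>" "link_adj ?L \<alpha>" u v] by blast
    then show ?thesis using N(5)[OF bK cb vx[OF xy(1)] vx[OF xy(2)]] by blast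
  next
    case False
    obtain c where c: "c \<in> \<phi>" "c \<notin> \<tau>" using np by blast
    obtain c' where c': "c' \<in> \<phi>" "c' \<notin> \<tau>" "c' \<noteq> c" using False c by blast
    have AB: "link_adj ?L \<alpha> u v" if "u \<in> \<phi>" "u \<notin> \<tau>" "v \<notin> \<beta>" "insert v \<beta> \<in> K" for u v
    proof -
      have "\<not> \<phi> \<subseteq> insert u (insert v \<tau>)" using c c' that \<beta>_def by (cases "u = c") auto
      moreover have "insert u (insert v \<beta>) = insert v \<beta>" using that \<beta>_def by auto
      ultimately show ?thesis using that mK[OF that(4)] by (auto simp: adj \<beta>_def)
    qed
    have AA: "(link_adj ?L \<alpha>)\<^sup>*\<^sup>* u v" if "u \<in> \<phi>" "u \<notin> \<tau>" "v \<in> \<phi>" "v \<notin> \<tau>" for u v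
    proof (cases "\<phi> \<subseteq> insert u (insert v \<tau>)")
      case False
      have "insert u (insert v \<beta>) = \<beta>" using that \<beta>_def by auto
      then have "link_adj ?L \<alpha> u v" using False that bK mK[OF bK] by (auto simp: adj \<beta>_def)
      then show ?thesis by blast
    next
      case True
      \<comment> \<open>Here \<phi> - \<tau> consists of \<open>u\<close> and \<open>v\<close>,
        which are not adjacent in its boundary. By the size bound \<beta> is not a facet, so its
        link has a vertex, and this is adjacent to both.\<close>
      then have "\<beta> \<subseteq> insert u (insert v \<tau>)" using \<beta>_def by auto
      then have "card \<beta> \<le> card (insert u (insert v \<tau>))" using ft by (intro card_mono) auto
      also have "\<dots> \<le> card \<tau> + 2" by (metis add_2_eq_Suc' card_insert_le_m1 ft(1) card_insert_if finite_insert le_SucI le_refl Suc_le_mono)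
      finally have lt: "card \<beta> < d" using a(3) ca by simp
      obtain B where B: "B \<in> K" "\<beta> \<subseteq> B" "card B = d" using N(2)[OF bK] by blast
      then obtain v' where v': "v' \<in> B" "v' \<notin> \<beta>" using lt by (metis nat_neq_iff subsetI subset_antisym)
      have "insert v' \<beta> \<in> K" by (rule s(4)[OF B(1)]) (use B v' in auto)
      then have "link_adj ?L \<alpha> u v'" "link_adj ?L \<alpha> v v'" using AB that v' by auto
      then show ?thesis by (meson converse_rtranclp_into_rtranclp link_adj_commute r_into_rtranclp)
    qed
    have toc: "(link_adj ?L \<alpha>)\<^sup>*\<^sup>* u c" if "link_adj ?L \<alpha> u u" for u
    proof (cases "u \<in> \<phi>")
      case True then show ?thesis using AA c that by (auto simp: adj)
    next
      case False
      then have "link_adj ?L \<alpha> c u" using AB[OF c, of u] that by (auto simp: adj \<beta>_def)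
      then show ?thesis by (simp add: link_adj_commute r_into_rtranclp)
    qed
    show ?thesis using toc[OF xy(1)] link_adj_rtranclp_sym[OF toc[OF xy(2)]] by (meson rtranclp_trans)
  qed
qed

text \<open>If \<open>m\<close> is not in \<rho>, at most one neighbour changes: the vertex
  completing \<rho> to a facet over \<phi> is exchanged for \<open>m\<close>. If \<rho> = \<tau>
  \<union> {m}, either \<tau> \<union> \<phi> is a ridge of \<open>K\<close> with the same
  neighbours, or it is a facet and the neighbours are the two vertices of \<phi> - \<tau>.\<close>

lemma stellar_ridge:
  assumes K: "normal_pm d K" and m: "m \<notin> verts K"
    and r: "\<rho> \<in> stellar K \<phi> m" "card \<rho> + 1 = d"
  shows "card {v. v \<notin> \<rho> \<and> insert v \<rho> \<in> stellar K \<phi> m} = 2"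
proof -
  note N = normal_pmD[OF K]
  note s = simplicial_complexD[OF N(1)]
  note st = stellar_iff[OF N(1) m]
  let ?L = "stellar K \<phi> m"
  have mK: "m \<notin> \<sigma>" if "\<sigma> \<in> K" for \<sigma>
    using face_subset_verts[OF N(1) that] m by blast
  show ?thesis
  proof (cases "m \<in> \<rho>")
    case False
    then have rK: "\<rho> \<in> K" "\<not> \<phi> \<subseteq> \<rho>" using r st by auto
    have fr: "finite \<rho>" using s(3)[OF rK(1)] .
    let ?N = "{v. v \<notin> \<rho> \<and> insert v \<rho> \<in> K}"
    have c2: "card ?N = 2" using N(4)[OF rK(1) r(2)] .
    have old: "v \<notin> \<rho> \<and> insert v \<rho> \<in> ?L \<longleftrightarrow> v \<in> ?N \<and> \<not> \<phi> \<subseteq> insert v \<rho>" if "v \<noteq> m" for v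
      using that False by (auto simp: st)
    have new: "m \<notin> \<rho> \<and> insert m \<rho> \<in> ?L \<longleftrightarrow> \<rho> \<union> \<phi> \<in> K"
      using False rK by (simp add: st)
    show ?thesis
    proof (cases "\<rho> \<union> \<phi> \<in> K")
      case True
      obtain c where c: "c \<in> \<phi>" "c \<notin> \<rho>" using rK by blast
      have f: "finite (\<rho> \<union> \<phi>)" using s(3)[OF True] .
      have "card (insert c \<rho>) = d" using c fr r by simp
      moreover have "insert c \<rho> \<subseteq> \<rho> \<union> \<phi>" using c by auto
      ultimately have e: "insert c \<rho> = \<rho> \<union> \<phi>"
        using card_subset_eq[OF f] card_mono[OF f] N(3)[OF True] by (metis order_antisym)
      then have cN: "c \<in> ?N" using c True by simp
      have "\<phi> \<subseteq> insert v \<rho> \<longleftrightarrow> v = c" if "v \<notin> \<rho>" for v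
        using e c that by blast
      then have "v \<in> {v. v \<notin> \<rho> \<and> insert v \<rho> \<in> ?L} \<longleftrightarrow> v \<in> insert m (?N - {c})" for v
        using old[of v] new True by (cases "v = m") auto
      then have "{v. v \<notin> \<rho> \<and> insert v \<rho> \<in> ?L} = insert m (?N - {c})" by blast
      moreover have "m \<notin> ?N" using mK by blast
      ultimately show ?thesis using card_exchange[OF finite_card_two[OF c2] cN] c2 by (simp only:)
    next
      case F: False
      have "\<not> \<phi> \<subseteq> insert v \<rho>" if "v \<in> ?N" for v
      proof
        assume "\<phi> \<subseteq> insert v \<rho>"
        then have "\<rho> \<union> \<phi> \<in> K" using that s(4)[of "insert v \<rho>" "\<rho> \<union> \<phi>"] by auto
        then show False using F by simp
      qed
      then have "v \<in> {v. v \<notin> \<rho> \<and> insert v \<rho> \<in> ?L} \<longleftrightarrow> v \<in> ?N" for v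
        using old[of v] new F mK by (cases "v = m") auto
      then have "{v. v \<notin> \<rho> \<and> insert v \<rho> \<in> ?L} = ?N" by blast
      then show ?thesis using c2 by simp
    qed
  next
    case True
    define \<tau> where "\<tau> = \<rho> - {m}"
    define \<beta> where "\<beta> = \<tau> \<union> \<phi>"
    have rt: "\<rho> = insert m \<tau>" "m \<notin> \<tau>" using True \<tau>_def by auto
    have bK: "\<beta> \<in> K" and np: "\<not> \<phi> \<subseteq> \<tau>" using r(1) st[of \<rho>] True \<tau>_def \<beta>_def by auto
    have fb: "finite \<beta>" using s(3)[OF bK] .
    then have ft: "finite \<tau>" "finite \<phi>" using \<beta>_def by auto
    have ct: "card \<tau> + 2 = d" using rt ft r(2) by simp
    have mb: "m \<notin> \<beta>" using mK[OF bK] .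
    have nb: "v \<notin> \<rho> \<and> insert v \<rho> \<in> ?L \<longleftrightarrow>
        v \<notin> \<tau> \<and> insert v \<beta> \<in> K \<and> \<not> \<phi> \<subseteq> insert v \<tau>" for v
    proof (cases "v = m")
      case True then show ?thesis using mK rt by auto
    next
      case False
      then have "insert v \<rho> - {m} = insert v \<tau>" "m \<in> insert v \<rho>" using rt by auto
      then show ?thesis using False rt unfolding st \<beta>_def by auto
    qed
    obtain c where c: "c \<in> \<phi>" "c \<notin> \<tau>" using np by blast
    show ?thesis
    proof (cases "\<phi> - \<tau> = {c}")
      case True
      then have bt: "\<beta> = insert c \<tau>" using \<beta>_def by auto
      have "card \<beta> + 1 = d" using bt c ft ct by simp
      then have "card {v. v \<notin> \<beta> \<and> insert v \<beta> \<in> K} = 2" using N(4) bK by blast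
      moreover have "{v. v \<notin> \<rho> \<and> insert v \<rho> \<in> ?L} = {v. v \<notin> \<beta> \<and> insert v \<beta> \<in> K}"
        using bt True c by (auto simp: nb)
      ultimately show ?thesis by simp
    next
      case False
      then obtain c' where c': "c' \<in> \<phi>" "c' \<notin> \<tau>" "c' \<noteq> c" using c by blast
      have "card (insert c (insert c' \<tau>)) = d" using c c' ft ct by simp
      moreover have "insert c (insert c' \<tau>) \<subseteq> \<beta>" using c c' \<beta>_def by auto
      ultimately have e: "insert c (insert c' \<tau>) = \<beta>"
        using card_subset_eq[OF fb] card_mono[OF fb] N(3)[OF bK] by (metis order_antisym)
      have cb: "card \<beta> = d" using e \<open>card (insert c (insert c' \<tau>)) = d\<close> by simp
      have "v \<in> \<beta>" if "insert v \<beta> \<in> K" for v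
      proof (rule ccontr)
        assume "v \<notin> \<beta>"
        then have "card (insert v \<beta>) = d + 1" using cb fb by simp
        then show False using N(3)[OF that] by simp
      qed
      moreover have "insert c \<beta> = \<beta>" "insert c' \<beta> = \<beta>" using e by auto
      ultimately have "{v. v \<notin> \<rho> \<and> insert v \<rho> \<in> ?L} = {c, c'}"
        using e bK c c' unfolding nb by auto
      then show ?thesis using c'(3) by simp
    qed
  qed
qed

lemma normal_pm_stellar:
  assumes K: "normal_pm d K" and p: "\<phi> \<noteq> {}" and m: "m \<notin> verts K"
  shows "normal_pm d (stellar K \<phi> m)"
proof -
  note N = normal_pmD[OF K]
  note s = simplicial_complexD[OF N(1)]
  note st = stellar_iff[OF N(1) m]
  let ?L = "stellar K \<phi> m"
  have mK: "m \<notin> \<sigma>" if "\<sigma> \<in> K" for \<sigma>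
    using face_subset_verts[OF N(1) that] m by blast
  have S: "simplicial_complex ?L" by (rule simplicial_complex_stellar[OF N(1) p m])
  \<comment> \<open>The exchanged vertex \<open>c\<close> is chosen outside the face that is to be
    extended to a facet.\<close>
  have cone: "insert m (A - {c}) \<in> ?L \<and> card (insert m (A - {c})) = d"
    if "A \<in> K" "\<phi> \<subseteq> A" "c \<in> \<phi>" "card A = d" for A c
  proof -
    have "A - {c} - {m} = A - {c}" "A - {c} \<union> \<phi> = A" using mK[OF that(1)] that by auto
    moreover have "card (insert m (A - {c})) = d"
      using that mK[OF that(1)] s(3)[OF that(1)] card_Suc_Diff1[of A c] by auto
    ultimately show ?thesis using that by (auto simp: st)
  qed
  have pure: "\<exists>\<tau>\<in>?L. \<sigma> \<subseteq> \<tau> \<and> card \<tau> = d" if sg: "\<sigma> \<in> ?L" for \<sigma>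
  proof (cases "m \<in> \<sigma>")
    case True
    then have k: "(\<sigma> - {m}) \<union> \<phi> \<in> K" "\<not> \<phi> \<subseteq> \<sigma> - {m}" using sg st by auto
    obtain A where A: "A \<in> K" "(\<sigma> - {m}) \<union> \<phi> \<subseteq> A" "card A = d" using N(2)[OF k(1)] by blast
    obtain c where c: "c \<in> \<phi>" "c \<notin> \<sigma> - {m}" using k by blast
    have "\<sigma> \<subseteq> insert m (A - {c})" using A c by auto
    then show ?thesis using cone[of A c] A c by blast
  next
    case False
    then have k: "\<sigma> \<in> K" "\<not> \<phi> \<subseteq> \<sigma>" using sg st by auto
    obtain A where A: "A \<in> K" "\<sigma> \<subseteq> A" "card A = d" using N(2)[OF k(1)] by blast
    show ?thesis
    proof (cases "\<phi> \<subseteq> A")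
      case True
      obtain c where c: "c \<in> \<phi>" "c \<notin> \<sigma>" using k by blast
      have "\<sigma> \<subseteq> insert m (A - {c})" using A c by auto
      then show ?thesis using cone[of A c] A c True by blast
    next
      case False
      then have "A \<in> ?L" using A(1) mK[OF A(1)] st by simp
      then show ?thesis using A by blast
    qed
  qed
  have le: "card \<sigma> \<le> d" if sg: "\<sigma> \<in> ?L" for \<sigma>
  proof -
    obtain \<tau> where "\<tau> \<in> ?L" "\<sigma> \<subseteq> \<tau>" "card \<tau> = d" using pure[OF sg] by blast
    then show ?thesis using card_mono[of \<tau> \<sigma>] simplicial_complexD(3)[OF S] by auto
  qed
  show ?thesis unfolding normal_pm_def
    using S pure le stellar_ridge[OF K m] stellar_link_connected_old[OF K m]
      stellar_link_connected_new[OF K m] by meson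
qed

section \<open>Flips along ridges\<close>

lemma link_adj_two_steps:
  "link_adj K \<alpha> p x \<Longrightarrow> link_adj K \<alpha> q x \<Longrightarrow> (link_adj K \<alpha>)\<^sup>*\<^sup>* p q"
  by (meson converse_rtranclp_into_rtranclp link_adj_commute r_into_rtranclp)

text \<open>The bistellar move that replaces the join of \<open>R\<close> with the two points
  \<open>u\<close>, \<open>w\<close> by the join of the edge \<open>u w\<close> with the boundary of
  \<open>R\<close>; \<tau> = {} gives the edge itself.\<close>

definition flip :: "'a set set \<Rightarrow> 'a set \<Rightarrow> 'a \<Rightarrow> 'a \<Rightarrow> 'a set set" where
  "flip K R u w = {\<sigma> \<in> K. \<not> R \<subseteq> \<sigma>} \<union> (\<lambda>\<tau>. insert u (insert w \<tau>)) ` {\<tau>. \<tau> \<subset> R}"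

locale flippable =
  fixes d :: nat and K :: "'a set set" and R :: "'a set" and u w :: 'a
  assumes K: "normal_pm d K" and d2: "2 \<le> d" and cR: "card R + 1 = d"
    and uw: "u \<noteq> w" "u \<notin> R" "w \<notin> R"
    and uR: "insert u R \<in> K" and wR: "insert w R \<in> K" and nonedge: "{u, w} \<notin> K"
begin

abbreviation "L \<equiv> flip K R u w"

lemmas N = normal_pmD[OF K]
lemmas s = simplicial_complexD[OF N(1)]

lemma sub: "\<sigma> \<in> K \<Longrightarrow> \<tau> \<subseteq> \<sigma> \<Longrightarrow> \<tau> \<in> K" by (rule s(4))

lemma RK: "R \<in> K" by (rule sub[OF uR]) auto

lemma finR: "finite R" using s(3)[OF RK] .

lemma no_uw: "\<sigma> \<in> K \<Longrightarrow> \<not> (u \<in> \<sigma> \<and> w \<in> \<sigma>)"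
  using sub[of \<sigma> "{u, w}"] nonedge by auto

lemma flip_iff: "\<sigma> \<in> L \<longleftrightarrow> (if u \<in> \<sigma> \<and> w \<in> \<sigma> then \<sigma> - {u, w} \<subset> R else \<sigma> \<in> K \<and> \<not> R \<subseteq> \<sigma>)"
proof (cases "u \<in> \<sigma> \<and> w \<in> \<sigma>")
  case True
  then have "\<sigma> \<in> L \<longleftrightarrow> (\<exists>\<tau>. \<tau> \<subset> R \<and> \<sigma> = insert u (insert w \<tau>))"
    using no_uw by (auto simp: flip_def)
  also have "\<dots> \<longleftrightarrow> \<sigma> - {u, w} \<subset> R"
  proof
    assume "\<exists>\<tau>. \<tau> \<subset> R \<and> \<sigma> = insert u (insert w \<tau>)"
    then obtain \<tau> where t: "\<tau> \<subset> R" "\<sigma> = insert u (insert w \<tau>)" by blast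
    then have "\<sigma> - {u, w} = \<tau>" using uw by auto
    then show "\<sigma> - {u, w} \<subset> R" using t by simp
  next
    assume "\<sigma> - {u, w} \<subset> R"
    then show "\<exists>\<tau>. \<tau> \<subset> R \<and> \<sigma> = insert u (insert w \<tau>)"
      using True by (intro exI[of _ "\<sigma> - {u, w}"]) auto
  qed
  finally show ?thesis using True by simp
next
  case False then show ?thesis by (auto simp: flip_def)
qed

lemma link_R: "{v. v \<notin> R \<and> insert v R \<in> K} = {u, w}"
proof -
  have "card {v. v \<notin> R \<and> insert v R \<in> K} = 2" using N(4)[OF RK cR] .
  moreover have "{u, w} \<subseteq> {v. v \<notin> R \<and> insert v R \<in> K}" using uw uR wR by auto
  ultimately show ?thesis using uw by (metis card_2_iff card_subset_eq finite_card_two)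
qed

lemma faces_over_R:
  assumes "\<sigma> \<in> K" "R \<subseteq> \<sigma>"
  shows "\<sigma> = R \<or> \<sigma> = insert u R \<or> \<sigma> = insert w R"
proof (cases "\<sigma> = R")
  case False
  then obtain v where v: "v \<in> \<sigma>" "v \<notin> R" using assms by blast
  have f: "finite \<sigma>" using s(3) assms by blast
  have "card (insert v R) = d" using v finR cR by simp
  then have "insert v R = \<sigma>" using card_seteq[OF f, of "insert v R"] N(3)[OF assms(1)] v assms by auto
  moreover have "v \<in> {v. v \<notin> R \<and> insert v R \<in> K}" using calculation v assms(1) by simp
  ultimately show ?thesis unfolding link_R by blast
qed simp

lemma simplicial_complex_flip: "simplicial_complex L"
proof -
  have "finite L" unfolding flip_def using s(1) finR
    by (auto intro: finite_subset[OF _ finite_Pow_iff[THEN iffD2, OF finR]])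
  moreover have "{} \<in> L" using s(2) cR d2 by (auto simp: flip_iff)
  moreover have "finite \<sigma>" if "\<sigma> \<in> L" for \<sigma>
  proof (cases "u \<in> \<sigma> \<and> w \<in> \<sigma>")
    case True
    then have "\<sigma> - {u, w} \<subseteq> R" using that by (auto simp: flip_iff)
    from finite_subset[OF this finR] show ?thesis by simp
  next
    case False
    then show ?thesis using that s(3) by (simp add: flip_iff)
  qed
  moreover have "\<tau> \<in> L" if a: "\<sigma> \<in> L" "\<tau> \<subseteq> \<sigma>" for \<sigma> \<tau>
  proof (cases "u \<in> \<sigma> \<and> w \<in> \<sigma>")
    case True
    then have t: "\<sigma> - {u, w} \<subset> R" using a by (simp add: flip_iff)
    show ?thesis
    proof (cases "u \<in> \<tau> \<and> w \<in> \<tau>")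
      case True then show ?thesis using t a(2) by (auto simp: flip_iff)
    next
      case F: False
      then have "\<tau> \<subseteq> insert u R \<or> \<tau> \<subseteq> insert w R" using a(2) t by blast
      then have "\<tau> \<in> K" using sub[OF uR] sub[OF wR] by blast
      moreover have "\<not> R \<subseteq> \<tau>" using t a(2) uw by blast
      ultimately show ?thesis using F unfolding flip_iff by auto
    qed
  next
    case False
    then have "\<sigma> \<in> K" "\<not> R \<subseteq> \<sigma>" using a by (simp_all add: flip_iff)
    then have "\<tau> \<in> K" "\<not> R \<subseteq> \<tau>" "\<not> (u \<in> \<tau> \<and> w \<in> \<tau>)" using a(2) False sub[of \<sigma> \<tau>] by auto
    then show ?thesis unfolding flip_iff by auto
  qed
  ultimately show ?thesis unfolding simplicial_complex_def by blast
qed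

lemma pure_flip:
  assumes "\<sigma> \<in> L"
  shows "\<exists>A\<in>L. \<sigma> \<subseteq> A \<and> card A = d"
proof -
  have new: "insert u (insert w (R - {c})) \<in> L \<and> card (insert u (insert w (R - {c}))) = d"
    if "c \<in> R" for c
  proof -
    have "insert u (insert w (R - {c})) - {u, w} = R - {c}" using uw by auto
    moreover have "card (insert u (insert w (R - {c}))) = d"
      using that uw finR cR card_Suc_Diff1[OF finR that] by simp
    ultimately show ?thesis using that by (auto simp: flip_iff)
  qed
  show ?thesis
  proof (cases "u \<in> \<sigma> \<and> w \<in> \<sigma>")
    case True
    then obtain c where "c \<in> R" "c \<notin> \<sigma>" "\<sigma> - {u, w} \<subseteq> R" using assms uw by (auto simp: flip_iff)
    then have "\<sigma> \<subseteq> insert u (insert w (R - {c}))" by auto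
    then show ?thesis using new \<open>c \<in> R\<close> by blast
  next
    case False
    then have k: "\<sigma> \<in> K" "\<not> R \<subseteq> \<sigma>" using assms by (simp_all add: flip_iff)
    obtain A where A: "A \<in> K" "\<sigma> \<subseteq> A" "card A = d" using N(2)[OF k(1)] by blast
    show ?thesis
    proof (cases "R \<subseteq> A")
      case True
      obtain c where c: "c \<in> R" "c \<notin> \<sigma>" using k by blast
      have "A \<subseteq> insert u (insert w R)" using faces_over_R[OF A(1) True] by auto
      then have "\<sigma> \<subseteq> insert u (insert w (R - {c}))" using A c by auto
      then show ?thesis using new c by blast
    next
      case False
      then have "A \<in> L" using A no_uw by (auto simp: flip_iff)
      then show ?thesis using A by blast
    qed
  qed
qed

lemma insert_in_flip_old:
  assumes "\<rho> \<in> L" "\<not> (u \<in> \<rho> \<and> w \<in> \<rho>)"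
  shows "insert v \<rho> \<in> L \<longleftrightarrow> (insert v \<rho> \<in> K \<and> \<not> R \<subseteq> insert v \<rho>) \<or>
     (v = w \<and> u \<in> \<rho> \<and> \<rho> - {u} \<subset> R) \<or> (v = u \<and> w \<in> \<rho> \<and> \<rho> - {w} \<subset> R)"
proof (cases "u \<in> insert v \<rho> \<and> w \<in> insert v \<rho>")
  case True
  then have "insert v \<rho> \<notin> K" using no_uw by blast
  moreover consider "v = w" "u \<in> \<rho>" "w \<notin> \<rho>" | "v = u" "w \<in> \<rho>" "u \<notin> \<rho>" using True assms(2) uw by auto
  then have "insert v \<rho> - {u, w} \<subset> R \<longleftrightarrow>
     (v = w \<and> u \<in> \<rho> \<and> \<rho> - {u} \<subset> R) \<or> (v = u \<and> w \<in> \<rho> \<and> \<rho> - {w} \<subset> R)"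
  proof cases
    case 1
    then have "insert v \<rho> - {u, w} = \<rho> - {u}" by auto
    then show ?thesis using 1 uw by auto
  next
    case 2
    then have "insert v \<rho> - {u, w} = \<rho> - {w}" by auto
    then show ?thesis using 2 uw by auto
  qed
  ultimately show ?thesis using True by (simp add: flip_iff)
next
  case False
  then show ?thesis by (auto simp: flip_iff)
qed

text \<open>Of \<open>u\<close> and \<open>w\<close>, \<open>t\<close> is the one in \<rho> and
  \<open>t'\<close> the other. If \<rho> lies in the facet \<open>R \<union> {t}\<close>, the vertex
  of \<open>R\<close> missing from \<rho> is exchanged for \<open>t'\<close>; otherwise no cofacet
  of \<rho> contains \<open>R\<close> and nothing changes.\<close>

lemma ridge_flip_one:
  assumes rK: "\<rho> \<in> K" "\<not> R \<subseteq> \<rho>" "card \<rho> + 1 = d" and a: "t \<in> \<rho>" "t' \<notin> \<rho>" "{t, t'} = {u, w}"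
  shows "card {v. v \<notin> \<rho> \<and> ((insert v \<rho> \<in> K \<and> \<not> R \<subseteq> insert v \<rho>) \<or> v = t' \<and> \<rho> - {t} \<subset> R)} = 2"
proof -
  let ?N = "{v. v \<notin> \<rho> \<and> insert v \<rho> \<in> K}"
  have c2: "card ?N = 2" using N(4)[OF rK(1,3)] .
  have fr: "finite \<rho>" using s(3)[OF rK(1)] .
  have tR: "insert t R \<in> K" "insert t' R \<in> K" "t \<notin> R" "t' \<notin> R" using a uR wR uw by (auto simp: doubleton_eq_iff)
  have t'N: "t' \<notin> ?N"
  proof
    assume "t' \<in> ?N"
    then have "insert t' \<rho> \<in> K" by simp
    from no_uw[OF this] show False using a by auto
  qed
  show ?thesis
  proof (cases "\<rho> - {t} \<subset> R")
    case True
    have "card (\<rho> - {t}) + 1 = card R" using card_Suc_Diff1[OF fr a(1)] rK(3) cR by linarith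
    moreover obtain c where c: "c \<in> R" "c \<notin> \<rho> - {t}" using True by blast
    ultimately have "card (insert c (\<rho> - {t})) = card R" using fr by simp
    then have Re: "insert c (\<rho> - {t}) = R" using True c by (intro card_subset_eq[OF finR]) auto
    have cN: "c \<in> ?N"
    proof -
      have "insert c \<rho> = insert t R" using Re a(1) by auto
      then show ?thesis using tR c by auto
    qed
    have "R \<subseteq> insert v \<rho> \<longleftrightarrow> v = c" if "v \<notin> \<rho>" for v
      using Re that tR c by blast
    then have "{v. v \<notin> \<rho> \<and> ((insert v \<rho> \<in> K \<and> \<not> R \<subseteq> insert v \<rho>) \<or> v = t' \<and> \<rho> - {t} \<subset> R)}
        = insert t' (?N - {c})" using True a(2) by auto
    then show ?thesis using card_exchange[OF finite_card_two[OF c2] cN t'N] c2 by (simp only:)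
  next
    case False
    have "\<not> R \<subseteq> insert v \<rho>" if v: "v \<in> ?N" for v
    proof
      assume R: "R \<subseteq> insert v \<rho>"
      then have vR: "v \<in> R" using rK(2) by blast
      have "insert v \<rho> \<noteq> R" using a(1) tR by blast
      then have "insert v \<rho> = insert u R \<or> insert v \<rho> = insert w R" using faces_over_R v R by blast
      then have "insert v \<rho> = insert t R"
      proof -
        have "t' \<notin> insert v \<rho>" using a(2) vR tR by auto
        then show ?thesis using \<open>insert v \<rho> = insert u R \<or> insert v \<rho> = insert w R\<close> a(3)
          by (auto simp: doubleton_eq_iff)
      qed
      then have "\<rho> - {t} \<subseteq> R" by blast
      moreover have "\<rho> - {t} \<noteq> R" using rK(2) by blast
      ultimately show False using False by blast
    qed
    then have "{v. v \<notin> \<rho> \<and> ((insert v \<rho> \<in> K \<and> \<not> R \<subseteq> insert v \<rho>) \<or> v = t' \<and> \<rho> - {t} \<subset> R)} = ?N"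
      using False by blast
    then show ?thesis using c2 by simp
  qed
qed

lemma ridge_flip:
  assumes r: "\<rho> \<in> L" "card \<rho> + 1 = d"
  shows "card {v. v \<notin> \<rho> \<and> insert v \<rho> \<in> L} = 2"
proof (cases "u \<in> \<rho> \<and> w \<in> \<rho>")
  case True
  define \<tau> where "\<tau> = \<rho> - {u, w}"
  have t: "\<tau> \<subset> R" using True r by (simp add: flip_iff \<tau>_def)
  have ft: "finite \<tau>" using t finR finite_subset by blast
  have rt: "\<rho> = insert u (insert w \<tau>)" "u \<notin> \<tau>" "w \<notin> \<tau>" using True \<tau>_def by auto
  then have ct: "card \<tau> + 2 = card R" using ft uw r(2) cR by simp
  \<comment> \<open>A ridge over the new edge lacks two vertices of \<open>R\<close>, and these are
    its neighbours.\<close>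
  then have "card (R - \<tau>) = 2" using card_Diff_subset[OF ft, of R] t by auto
  moreover have "v \<notin> \<rho> \<and> insert v \<rho> \<in> L \<longleftrightarrow> v \<in> R - \<tau>" for v
  proof
    assume v: "v \<notin> \<rho> \<and> insert v \<rho> \<in> L"
    then have "insert v \<rho> - {u, w} \<subset> R" using True by (simp add: flip_iff)
    then show "v \<in> R - \<tau>" using v rt by auto
  next
    assume v: "v \<in> R - \<tau>"
    have "insert v \<rho> - {u, w} = insert v \<tau>" using v uw rt by auto
    moreover have "card (insert v \<tau>) < card R" using ct ft by (simp add: card_insert_if)
    then have "insert v \<tau> \<subset> R" using v t by auto
    moreover have "v \<notin> \<rho>" using v rt uw by auto
    ultimately show "v \<notin> \<rho> \<and> insert v \<rho> \<in> L" using True by (simp add: flip_iff)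
  qed
  then have "{v. v \<notin> \<rho> \<and> insert v \<rho> \<in> L} = R - \<tau>" by blast
  ultimately show ?thesis by (simp only:)
next
  case False
  then have rK: "\<rho> \<in> K" "\<not> R \<subseteq> \<rho>" using r by (simp_all add: flip_iff)
  note ins = insert_in_flip_old[OF r(1) False]
  consider "u \<in> \<rho>" "w \<notin> \<rho>" | "w \<in> \<rho>" "u \<notin> \<rho>" | "u \<notin> \<rho>" "w \<notin> \<rho>" using False by blast
  then show ?thesis
  proof cases
    case 1
    then show ?thesis using ridge_flip_one[OF rK r(2), of u w] by (simp add: ins)
  next
    case 2
    then show ?thesis using ridge_flip_one[OF rK r(2), of w u] by (simp add: ins insert_commute)
  next
    case 3
    \<comment> \<open>A lost cofacet would contain \<open>R\<close> but neither \<open>u\<close> nor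
      \<open>w\<close>, hence equal \<open>R\<close>, which is too small for a facet.\<close>
    have "R \<subseteq> insert v \<rho> \<longleftrightarrow> False" if v: "v \<notin> \<rho>" "insert v \<rho> \<in> K" for v
    proof
      assume R: "R \<subseteq> insert v \<rho>"
      then have "v \<in> R" using rK by blast
      then have "u \<notin> insert v \<rho>" "w \<notin> insert v \<rho>" using 3 uw by auto
      then have "insert v \<rho> = R" using faces_over_R[OF v(2) R] by blast
      then have "card R = card \<rho> + 1" using v(1) s(3)[OF rK(1)] by auto
      then show False using r(2) cR by simp
    qed simp
    then have "{v. v \<notin> \<rho> \<and> insert v \<rho> \<in> L} = {v. v \<notin> \<rho> \<and> insert v \<rho> \<in> K}"
      using 3 by (auto simp: ins)
    then show ?thesis using N(4)[OF rK(1) r(2)] by simp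
  qed
qed

lemma link_adj_flip_old:
  assumes "link_adj K \<alpha> a b" "\<not> R \<subseteq> insert a (insert b \<alpha>)"
  shows "link_adj L \<alpha> a b"
  using assms no_uw[of "insert a (insert b \<alpha>)"] unfolding link_adj_def flip_iff by auto

lemma link_adj_flip_new:
  assumes "a \<notin> \<alpha>" "b \<notin> \<alpha>" "u \<in> insert a (insert b \<alpha>)" "w \<in> insert a (insert b \<alpha>)"
    "insert a (insert b \<alpha>) - {u, w} \<subset> R"
  shows "link_adj L \<alpha> a b"
  using assms unfolding link_adj_def flip_iff by simp

text \<open>The link of \<alpha> is the boundary of the simplex on \<open>R - \<alpha>\<close>. The
  bound on \<open>card \<alpha>\<close> leaves at least three vertices there, so any two are
  adjacent.\<close>

lemma link_connected_flip_new:
  assumes a: "card \<alpha> + 2 \<le> d" "u \<in> \<alpha>" "w \<in> \<alpha>" "finite \<alpha>"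
    and xy: "link_adj L \<alpha> x x" "link_adj L \<alpha> y y"
  shows "link_adj L \<alpha> x y"
proof (rule link_adj_flip_new)
  have xR: "z \<in> R \<and> z \<notin> \<alpha> \<and> insert z \<alpha> - {u, w} \<subset> R" if "link_adj L \<alpha> z z" for z
    using that a(2,3) by (auto simp: link_adj_def flip_iff)
  show "x \<notin> \<alpha>" "y \<notin> \<alpha>" "u \<in> insert x (insert y \<alpha>)" "w \<in> insert x (insert y \<alpha>)"
    using xR xy a by auto
  define T where "T = \<alpha> - {u, w}"
  have e: "insert x (insert y \<alpha>) - {u, w} = insert x (insert y T)"
    using xR[OF xy(1)] xR[OF xy(2)] uw T_def by auto
  have "\<alpha> = insert u (insert w T)" "u \<notin> T" "w \<notin> T" using a T_def by auto
  moreover have "card (insert u (insert w T)) = card T + 2" using a(4) uw T_def by simp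
  ultimately have "card \<alpha> = card T + 2" by metis
  moreover have "card (insert x (insert y T)) \<le> card T + 2"
    using a(4) T_def by (simp add: card_insert_if)
  ultimately have "card (insert x (insert y T)) < card R" using a(1) cR by simp
  moreover have "insert x (insert y T) \<subseteq> R" using xR[OF xy(1)] xR[OF xy(2)] T_def by auto
  ultimately show "insert x (insert y \<alpha>) - {u, w} \<subset> R" unfolding e by auto
qed

text \<open>A vertex \<open>z\<close> leaves the link only if
  \<open>R = \<alpha> \<union> {z}\<close>; its neighbours in the link were \<open>u\<close> and
  \<open>w\<close>, which the new edge joins, and \<open>f\<close> sends it to \<open>u\<close>. A
  lost edge whose ends both remain is bypassed through \<open>u\<close>, or through the one of
  \<open>u\<close>, \<open>w\<close> that is not in \<alpha>.\<close>

lemma link_connected_flip_old: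
  assumes a: "\<alpha> \<in> L" "card \<alpha> + 2 \<le> d" "\<not> (u \<in> \<alpha> \<and> w \<in> \<alpha>)"
    and xy: "link_adj L \<alpha> x x" "link_adj L \<alpha> y y"
  shows "(link_adj L \<alpha>)\<^sup>*\<^sup>* x y"
proof -
  have aK: "\<alpha> \<in> K" "\<not> R \<subseteq> \<alpha>" using a by (simp_all add: flip_iff)
  have fa: "finite \<alpha>" using s(3)[OF aK(1)] .
  have card_RD: "R = insert c \<alpha>" if "R \<subseteq> insert c \<alpha>" for c
    using card_seteq[of "insert c \<alpha>" R] that fa a(2) cR by (simp add: card_insert_if split: if_splits)
  define f where "f z = (if R \<subseteq> insert z \<alpha> then u else z)" for z
  have sym: "(link_adj L \<alpha>)\<^sup>*\<^sup>* p r" if "(link_adj L \<alpha>)\<^sup>*\<^sup>* r p" for p r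
    using link_adj_rtranclp_sym[OF that] .
  have lost: "(link_adj L \<alpha>)\<^sup>*\<^sup>* u (f q)"
    if pq: "link_adj K \<alpha> p q" "p \<noteq> q" "R \<subseteq> insert p \<alpha>" for p q
  proof -
    have R: "R = insert p \<alpha>" using card_RD pq(3) .
    have o: "p \<notin> \<alpha>" "q \<notin> \<alpha>" "insert p (insert q \<alpha>) \<in> K" using pq(1) by (auto simp: link_adj_def)
    have nq: "\<not> R \<subseteq> insert q \<alpha>" using R o pq(2) by auto
    have "insert p (insert q \<alpha>) = insert q R" "q \<notin> R" using R o pq(2) by auto
    then have "q \<in> {u, w}" using link_R o(3) by auto
    then consider "q = u" | "q = w" by blast
    then show ?thesis
    proof cases
      case 1 then show ?thesis using nq by (simp add: f_def)
    next
      case 2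
      have "link_adj L \<alpha> u w"
        by (rule link_adj_flip_new) (use R o uw 2 in auto)
      then show ?thesis using 2 nq by (auto simp: f_def)
    qed
  qed
  show ?thesis
  proof (rule connected_via_map[where f = f and P = "link_adj K \<alpha>" and Q = "\<lambda>x. link_adj L \<alpha> x x"])
    fix z assume z: "link_adj L \<alpha> z z"
    then have zL: "z \<notin> \<alpha>" "insert z \<alpha> \<in> L" by (auto simp: link_adj_def)
    from insert_in_flip_old[OF a(1,3), of z] zL
    consider (old) "insert z \<alpha> \<in> K" "\<not> R \<subseteq> insert z \<alpha>"
      | (new) t t' where "{t, t'} = {u, w}" "z = t'" "t \<in> \<alpha>" "\<alpha> - {t} \<subset> R"
      by (metis insert_commute)
    then show "\<exists>c. link_adj K \<alpha> c c \<and> (link_adj L \<alpha>)\<^sup>*\<^sup>* z (f c)"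
    proof cases
      case old
      then show ?thesis using zL by (intro exI[of _ z]) (auto simp: f_def link_adj_def)
    next
      case new
      have tR: "insert t R \<in> K" "t \<notin> R" "t' \<notin> R" using new uR wR uw by (auto simp: doubleton_eq_iff)
      \<comment> \<open>The vertex \<open>z\<close> enters the link only through the flip; it is
        adjacent to any vertex \<open>c\<close> of \<open>R\<close> outside \<alpha>, and such a
        vertex was there before.\<close>
      obtain c where c: "c \<in> R" "c \<notin> \<alpha> - {t}" using new by blast
      then have ca: "c \<notin> \<alpha>" using tR by auto
      have "insert c \<alpha> \<in> K" by (rule sub[OF tR(1)]) (use new c in auto)
      then have lc: "link_adj K \<alpha> c c" using ca by (simp add: link_adj_def)
      have "\<not> R \<subseteq> insert c \<alpha>" using card_RD[of c] tR new by auto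
      then have fc: "f c = c" by (simp add: f_def)
      have "link_adj L \<alpha> z c"
      proof (rule link_adj_flip_new)
        have "insert z (insert c \<alpha>) - {u, w} = insert c (\<alpha> - {t})" (is "?A = ?B")
          using new c tR uw zL by (auto simp: doubleton_eq_iff)
        moreover have "card ?B < card R"
          using card_Suc_Diff1[OF fa new(3)] a(2) cR c fa by simp
        then have "?B \<subset> R" using new c by auto
        ultimately show "?A \<subset> R" by (simp only:)
      qed (use new zL ca in \<open>auto simp: doubleton_eq_iff\<close>)
      then show ?thesis using lc fc by (metis r_into_rtranclp)
    qed
  next
    fix p q assume pq: "link_adj K \<alpha> p q"
    then have o: "p \<notin> \<alpha>" "q \<notin> \<alpha>" "insert p (insert q \<alpha>) \<in> K" by (auto simp: link_adj_def)
    show "(link_adj L \<alpha>)\<^sup>*\<^sup>* (f p) (f q)"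
    proof (cases "p = q")
      case True then show ?thesis by simp
    next
      case ne: False
      consider (keep) "\<not> R \<subseteq> insert p (insert q \<alpha>)" | (p) "R \<subseteq> insert p \<alpha>" | (q) "R \<subseteq> insert q \<alpha>"
        | (edge) "R \<subseteq> insert p (insert q \<alpha>)" "\<not> R \<subseteq> insert p \<alpha>" "\<not> R \<subseteq> insert q \<alpha>" by blast
      then show ?thesis
      proof cases
        case keep
        then have "f p = p" "f q = q" by (auto simp: f_def)
        then show ?thesis using link_adj_flip_old[OF pq keep] by simp
      next
        case p then show ?thesis using lost[OF pq ne] by (simp add: f_def)
      next
        case q
        then have "(link_adj L \<alpha>)\<^sup>*\<^sup>* u (f p)" using lost[of q p] pq ne link_adj_commute by metis
        then show ?thesis using sym q by (simp add: f_def)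
      next
        case edge
        have f: "f p = p" "f q = q" using edge by (auto simp: f_def)
        have pR: "p \<in> R" "q \<in> R" using edge by auto
        consider "insert p (insert q \<alpha>) = R"
          | t t' where "{t, t'} = {u, w}" "insert p (insert q \<alpha>) = insert t R"
          using faces_over_R[OF o(3) edge(1)] by (metis insert_commute)
        then show ?thesis
        proof cases
          case 1
          have "insert p (insert u \<alpha>) \<in> K" "insert q (insert u \<alpha>) \<in> K"
            by (rule sub[OF uR]; use 1 in auto)+
          then have "link_adj K \<alpha> p u" "link_adj K \<alpha> q u" using 1 o uw by (auto simp: link_adj_def)
          moreover have "\<not> R \<subseteq> insert p (insert u \<alpha>)" "\<not> R \<subseteq> insert q (insert u \<alpha>)"
            using 1 o uw ne by auto
          ultimately have "link_adj L \<alpha> p u" "link_adj L \<alpha> q u" by (simp_all add: link_adj_flip_old)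
          then show ?thesis unfolding f by (rule link_adj_two_steps)
        next
          case 2
          have tt: "t \<notin> R" "t' \<notin> R" "t \<noteq> t'" using 2 uw by (auto simp: doubleton_eq_iff)
          have "t \<in> insert p (insert q \<alpha>)" by (simp add: 2(2))
          moreover have "\<alpha> \<subseteq> insert p (insert q \<alpha>)" by blast
          then have "\<alpha> \<subseteq> insert t R" by (simp only: 2(2))
          ultimately have ta: "t \<in> \<alpha>" "t' \<notin> \<alpha>" "\<alpha> - {t} \<subseteq> R" using tt pR by auto
          have "link_adj L \<alpha> p t'"
          proof (rule link_adj_flip_new)
            show "insert p (insert t' \<alpha>) - {u, w} \<subset> R" using 2(1) ta pR o ne by blast
          qed (use 2(1) ta o in \<open>auto simp: doubleton_eq_iff\<close>)
          moreover have "link_adj L \<alpha> q t'"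
          proof (rule link_adj_flip_new)
            show "insert q (insert t' \<alpha>) - {u, w} \<subset> R" using 2(1) ta pR o ne by blast
          qed (use 2(1) ta o in \<open>auto simp: doubleton_eq_iff\<close>)
          ultimately show ?thesis unfolding f by (rule link_adj_two_steps)
        qed
      qed
    qed
  next
    show "\<And>a b. link_adj K \<alpha> a a \<Longrightarrow> link_adj K \<alpha> b b \<Longrightarrow> (link_adj K \<alpha>)\<^sup>*\<^sup>* a b"
      by (rule N(5)[OF aK(1) a(2)])
  qed (use xy sym in auto)
qed

lemma normal_pm_flip: "normal_pm d L"
proof -
  have le: "card \<sigma> \<le> d" if "\<sigma> \<in> L" for \<sigma>
    using pure_flip[OF that] card_mono simplicial_complexD(3)[OF simplicial_complex_flip] by metis
  have "(link_adj L \<alpha>)\<^sup>*\<^sup>* x y"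
    if "\<alpha> \<in> L" "card \<alpha> + 2 \<le> d" "link_adj L \<alpha> x x" "link_adj L \<alpha> y y" for \<alpha> x y
    using that link_connected_flip_old link_connected_flip_new
      simplicial_complexD(3)[OF simplicial_complex_flip that(1)] by (metis r_into_rtranclp)
  then show ?thesis unfolding normal_pm_def
    using simplicial_complex_flip pure_flip le ridge_flip by blast
qed

text \<open>Both sides cone off from \<open>m\<close> the same sphere, the join of the boundary of
  \<open>R\<close> with the two points \<open>u\<close>, \<open>w\<close>, and agree outside
  it.\<close>

lemma stellar_flip:
  assumes m: "m \<notin> verts K"
  shows "stellar L {u, w} m = stellar K R m"
proof -
  have "u \<in> verts K" "w \<in> verts K"
    using sub[OF uR, of "{u}"] sub[OF wR, of "{w}"] by (auto simp: verts_def)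
  then have mu: "m \<noteq> u" "m \<noteq> w" using m by auto
  have mL: "m \<notin> verts L" using m mu by (auto simp: verts_def flip_iff)
  have mR: "m \<notin> R" using m face_subset_verts[OF N(1) RK] by auto
  note a = stellar_iff[OF simplicial_complex_flip mL] and b = stellar_iff[OF N(1) m]
  have "\<sigma> \<in> stellar L {u, w} m \<longleftrightarrow> \<sigma> \<in> stellar K R m" for \<sigma>
  proof (cases "m \<in> \<sigma>")
    case False
    then show ?thesis using no_uw by (auto simp: a b flip_iff)
  next
    case True
    define \<tau> where "\<tau> = \<sigma> - {m}"
    have "\<tau> \<union> {u, w} - {u, w} = \<tau> - {u, w}" by auto
    then have "\<sigma> \<in> stellar L {u, w} m \<longleftrightarrow> \<tau> - {u, w} \<subset> R \<and> \<not> {u, w} \<subseteq> \<tau>"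
      using True by (simp add: a flip_iff flip: \<tau>_def)
    also have "\<dots> \<longleftrightarrow> \<tau> \<union> R \<in> K \<and> \<not> R \<subseteq> \<tau>"
    proof
      assume l: "\<tau> - {u, w} \<subset> R \<and> \<not> {u, w} \<subseteq> \<tau>"
      then have "\<tau> \<union> R \<subseteq> insert u R \<or> \<tau> \<union> R \<subseteq> insert w R" by blast
      then show "\<tau> \<union> R \<in> K \<and> \<not> R \<subseteq> \<tau>" using l uw sub[OF uR] sub[OF wR] by blast
    next
      assume r: "\<tau> \<union> R \<in> K \<and> \<not> R \<subseteq> \<tau>"
      then have "\<tau> \<union> R = R \<or> \<tau> \<union> R = insert u R \<or> \<tau> \<union> R = insert w R" using faces_over_R by blast
      then have "\<tau> - {u, w} \<subseteq> R" by blast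
      moreover have "\<not> {u, w} \<subseteq> \<tau>" using r no_uw by blast
      ultimately show "\<tau> - {u, w} \<subset> R \<and> \<not> {u, w} \<subseteq> \<tau>" using r by blast
    qed
    also have "\<dots> \<longleftrightarrow> \<sigma> \<in> stellar K R m" using True by (simp add: b flip: \<tau>_def)
    finally show ?thesis .
  qed
  then show ?thesis by blast
qed

lemma realization_flip_homeomorphic:
  assumes "infinite (UNIV :: 'a set)"
  shows "realization L homeomorphic realization K"
proof -
  \<comment> \<open>The common subdivision needs a vertex outside \<open>K\<close>; hence the
    infinite type.\<close>
  obtain m where m: "m \<notin> verts K" using assms finite_verts[OF N(1)] by (metis ex_new_if_finite)
  have "u \<in> verts K" "w \<in> verts K"
    using sub[OF uR, of "{u}"] sub[OF wR, of "{w}"] by (auto simp: verts_def)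
  then have mL: "m \<notin> verts L" using m by (auto simp: verts_def flip_iff)
  have "R \<noteq> {}" using cR d2 by auto
  then have 1: "realization (stellar K R m) homeomorphic realization K"
    by (intro realization_stellar_homeomorphic N(1) RK m)
  have "{u, w} \<in> L" using \<open>R \<noteq> {}\<close> by (auto simp: flip_iff)
  then have "realization (stellar L {u, w} m) homeomorphic realization L"
    by (intro realization_stellar_homeomorphic simplicial_complex_flip mL) auto
  then show ?thesis using 1 unfolding stellar_flip[OF m]
    by (meson homeomorphic_sym homeomorphic_trans)
qed

end

section \<open>Stacked balls and cones over their boundaries\<close>

definition retriangulates :: "nat \<Rightarrow> 'a set set \<Rightarrow> 'b set set \<Rightarrow> bool" where
  "retriangulates d K K' \<longleftrightarrow> normal_pm d K' \<and> realization K' homeomorphic realization K"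

lemma retriangulates_refl: "normal_pm d K \<Longrightarrow> retriangulates d K K"
  by (simp add: retriangulates_def homeomorphic_refl)

lemma retriangulates_trans:
  "retriangulates d K K' \<Longrightarrow> retriangulates d K' K'' \<Longrightarrow> retriangulates d K K''"
  unfolding retriangulates_def using homeomorphic_trans by blast

lemma retriangulates_normal_pm: "retriangulates d K K' \<Longrightarrow> normal_pm d K'"
  by (simp add: retriangulates_def)

lemma retriangulates_stellar:
  assumes "normal_pm d K" "\<phi> \<in> K" "\<phi> \<noteq> {}" "m \<notin> verts K"
  shows "retriangulates d K (stellar K \<phi> m)"
  unfolding retriangulates_def
  using normal_pm_stellar[OF assms(1,3,4)]
    realization_stellar_homeomorphic[OF normal_pmD(1)[OF assms(1)] assms(2-4)] by simp

text \<open>Every new facet brings exactly one new vertex \<open>w\<close>. That the gluing ridge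
  \<rho> lies on the boundary of the earlier ball follows from the ambient pseudomanifold, in which
  a ridge has only two cofacets.\<close>

inductive stacked_ball :: "'a set set \<Rightarrow> nat \<Rightarrow> 'a set set \<Rightarrow> 'a set set \<Rightarrow> bool" for K d where
  facet: "F \<in> K \<Longrightarrow> card F = d \<Longrightarrow> stacked_ball K d {F} {}"
| attach: "stacked_ball K d \<F> \<G> \<Longrightarrow> F \<in> \<F> \<Longrightarrow> \<rho> \<subseteq> F \<Longrightarrow> card \<rho> + 1 = d \<Longrightarrow> w \<notin> \<Union>\<F> \<Longrightarrow>
    insert w \<rho> \<in> K \<Longrightarrow> stacked_ball K d (insert (insert w \<rho>) \<F>) (insert \<rho> \<G>)"

lemma stacked_ball_mono:
  assumes "stacked_ball K d \<F> \<G>" "\<F> \<subseteq> K'"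
  shows "stacked_ball K' d \<F> \<G>"
  using assms by (induction) (auto intro: stacked_ball.intros)

lemma stacked_ball_basic:
  assumes "stacked_ball K d \<F> \<G>" "simplicial_complex K" "0 < d"
  shows "finite \<F> \<and> \<F> \<noteq> {} \<and> \<F> \<subseteq> K \<and> (\<forall>F\<in>\<F>. card F = d) \<and> (\<forall>G\<in>\<G>. card G + 1 = d \<and>
    (\<exists>a b. a \<noteq> b \<and> a \<notin> G \<and> b \<notin> G \<and> insert a G \<in> \<F> \<and> insert b G \<in> \<F>))"
  using assms(1)
proof induction
  case (facet F)
  then show ?case by auto
next
  case (attach \<F> \<G> F \<rho> w)
  have "F \<in> K" using attach.IH attach.hyps(2) by blast
  then have fF: "finite F" "card F = d" using attach.IH attach.hyps(2) simplicial_complexD(3)[OF assms(2)] by auto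
  have fr: "finite \<rho>" using attach.hyps(3) fF(1) finite_subset by blast
  have wr: "w \<notin> \<rho>" using attach.hyps by blast
  have cw: "card (insert w \<rho>) = d" using wr fr attach.hyps(4) by simp
  obtain v where v: "v \<in> F" "v \<notin> \<rho>" using attach.hyps(3,4) fF by (metis Suc_eq_plus1 n_not_Suc_n subsetI subset_antisym)
  have "card (insert v \<rho>) = d" using v fr attach.hyps(4) by simp
  then have e: "insert v \<rho> = F"
    using card_subset_eq[OF fF(1), of "insert v \<rho>"] v attach.hyps(3) fF(2) by auto
  have "v \<noteq> w" using v attach.hyps(2,5) by blast
  then have "\<exists>a b. a \<noteq> b \<and> a \<notin> \<rho> \<and> b \<notin> \<rho> \<and>
      insert a \<rho> \<in> insert (insert w \<rho>) \<F> \<and> insert b \<rho> \<in> insert (insert w \<rho>) \<F>"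
    using e v wr attach.hyps(2) by (intro exI[of _ v] exI[of _ w]) auto
  note new = this
  show ?case
  proof (intro conjI ballI)
    fix G assume "G \<in> insert \<rho> \<G>"
    then consider "G = \<rho>" | "G \<in> \<G>" by blast
    then show "card G + 1 = d" using attach.IH attach.hyps(4) by cases auto
    show "\<exists>a b. a \<noteq> b \<and> a \<notin> G \<and> b \<notin> G \<and> insert a G \<in> insert (insert w \<rho>) \<F> \<and>
        insert b G \<in> insert (insert w \<rho>) \<F>"
    proof (cases "G = \<rho>")
      case True then show ?thesis using new by (simp only:)
    next
      case False
      then have "G \<in> \<G>" using \<open>G \<in> insert \<rho> \<G>\<close> by simp
      then obtain a b where "a \<noteq> b" "a \<notin> G" "b \<notin> G" "insert a G \<in> \<F>" "insert b G \<in> \<F>"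
        using attach.IH by meson
      then show ?thesis by (intro exI[of _ a] exI[of _ b]) simp
    qed
  qed (use attach.IH attach.hyps(6) cw in auto)
qed

lemma stacked_ball_vertices:
  assumes "stacked_ball K d \<F> \<G>" "simplicial_complex K" "0 < d"
  shows "finite (\<Union>\<F>)" "\<Union>\<F> \<subseteq> verts K"
proof -
  note b = stacked_ball_basic[OF assms]
  have "\<F> \<subseteq> K" "finite \<F>" using b by simp_all
  then show "finite (\<Union>\<F>)" "\<Union>\<F> \<subseteq> verts K"
    using simplicial_complexD(3)[OF assms(2)] face_subset_verts[OF assms(2)] by blast+
qed

text \<open>Each gluing adds one vertex, so initial segments of the stacking realize all vertex
  numbers. This later adjusts \<open>g2\<close> by single units.\<close>

lemma stacked_ball_between:
  assumes "stacked_ball K d \<F> \<G>" "simplicial_complex K" "0 < d" "d \<le> m" "m \<le> card (\<Union>\<F>)"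
  shows "\<exists>\<F>' \<G>'. stacked_ball K d \<F>' \<G>' \<and> card (\<Union>\<F>') = m \<and> \<F>' \<subseteq> \<F>"
  using assms(1,5)
proof (induction)
  case (facet F)
  then show ?case using assms(4) by (intro exI[of _ "{F}"] exI[of _ "{}"]) (auto intro: stacked_ball.facet)
next
  case (attach \<F> \<G> F \<rho> w)
  have "\<Union>(insert (insert w \<rho>) \<F>) = insert w (\<Union>\<F>)" using attach.hyps(2,3) by auto
  then have c: "card (\<Union>(insert (insert w \<rho>) \<F>)) = card (\<Union>\<F>) + 1"
    using stacked_ball_vertices(1)[OF attach.hyps(1) assms(2,3)] attach.hyps(5) by simp
  show ?case
  proof (cases "m \<le> card (\<Union>\<F>)")
    case True then show ?thesis using attach.IH by blast
  next
    case False
    then have "m = card (\<Union>(insert (insert w \<rho>) \<F>))" using c attach.prems by simp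
    then show ?thesis using stacked_ball.attach[OF attach.hyps] by blast
  qed
qed

text \<open>The cone with apex \<open>z\<close> over the boundary of the ball with facets \<open>\<F>\<close> replaces the ball. The
  interior faces of a stacked ball are its facets and the ridges \<open>\<G>\<close> along which they were attached.\<close>

definition cone_off :: "'a set set \<Rightarrow> 'a set set \<Rightarrow> 'a set set \<Rightarrow> 'a \<Rightarrow> 'a set set" where
  "cone_off K \<F> \<G> z = {\<sigma> \<in> K. \<sigma> \<notin> \<F> \<union> \<G>} \<union> insert z ` {\<tau>. (\<exists>F\<in>\<F>. \<tau> \<subseteq> F) \<and> \<tau> \<notin> \<F> \<union> \<G>}"

lemma cone_off_iff:
  assumes "simplicial_complex K" "z \<notin> verts K" "\<F> \<subseteq> K"
  shows "\<sigma> \<in> cone_off K \<F> \<G> z \<longleftrightarrow>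
    (if z \<in> \<sigma> then (\<exists>F\<in>\<F>. \<sigma> - {z} \<subseteq> F) \<and> \<sigma> - {z} \<notin> \<F> \<union> \<G> else \<sigma> \<in> K \<and> \<sigma> \<notin> \<F> \<union> \<G>)"
proof -
  have zK: "z \<notin> \<sigma>" if "\<sigma> \<in> K" for \<sigma>
    using face_subset_verts[OF assms(1) that] assms(2) by blast
  show ?thesis
  proof (cases "z \<in> \<sigma>")
    case True
    have "\<sigma> \<in> cone_off K \<F> \<G> z \<longleftrightarrow> (\<exists>\<tau>. (\<exists>F\<in>\<F>. \<tau> \<subseteq> F) \<and> \<tau> \<notin> \<F> \<union> \<G> \<and> \<sigma> = insert z \<tau>)"
      using zK True by (auto simp: cone_off_def)
    also have "\<dots> \<longleftrightarrow> (\<exists>F\<in>\<F>. \<sigma> - {z} \<subseteq> F) \<and> \<sigma> - {z} \<notin> \<F> \<union> \<G>"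
    proof
      assume "\<exists>\<tau>. (\<exists>F\<in>\<F>. \<tau> \<subseteq> F) \<and> \<tau> \<notin> \<F> \<union> \<G> \<and> \<sigma> = insert z \<tau>"
      then obtain \<tau> F where t: "F \<in> \<F>" "\<tau> \<subseteq> F" "\<tau> \<notin> \<F> \<union> \<G>" "\<sigma> = insert z \<tau>" by blast
      moreover have "z \<notin> \<tau>" using t zK assms(3) by blast
      ultimately show "(\<exists>F\<in>\<F>. \<sigma> - {z} \<subseteq> F) \<and> \<sigma> - {z} \<notin> \<F> \<union> \<G>" by auto
    next
      assume "(\<exists>F\<in>\<F>. \<sigma> - {z} \<subseteq> F) \<and> \<sigma> - {z} \<notin> \<F> \<union> \<G>"
      then show "\<exists>\<tau>. (\<exists>F\<in>\<F>. \<tau> \<subseteq> F) \<and> \<tau> \<notin> \<F> \<union> \<G> \<and> \<sigma> = insert z \<tau>"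
        using True by (intro exI[of _ "\<sigma> - {z}"]) auto
    qed
    finally show ?thesis using True by simp
  next
    case False then show ?thesis by (auto simp: cone_off_def)
  qed
qed

lemma cone_off_facet:
  assumes K: "normal_pm d K" and F: "F \<in> K" "card F = d"
  shows "cone_off K {F} {} z = stellar K F z"
proof -
  note N = normal_pmD[OF K] and s = simplicial_complexD[OF normal_pmD(1)[OF K]]
  have max: "\<sigma> = F" if "\<sigma> \<in> K" "F \<subseteq> \<sigma>" for \<sigma>
    using card_seteq[OF s(3)[OF that(1)] that(2)] N(3)[OF that(1)] F(2) by simp
  have 1: "\<tau> \<union> F \<in> K \<longleftrightarrow> \<tau> \<subseteq> F" for \<tau>
  proof
    assume "\<tau> \<union> F \<in> K" then have "\<tau> \<union> F = F" by (rule max) simp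
    then show "\<tau> \<subseteq> F" by blast
  next
    assume "\<tau> \<subseteq> F" then show "\<tau> \<union> F \<in> K" using F(1) by (simp add: Un_absorb1)
  qed
  have "{\<sigma> \<in> K. \<sigma> \<notin> {F}} = {\<sigma> \<in> K. \<not> F \<subseteq> \<sigma>}" using max by blast
  moreover have "{\<tau>. (\<exists>F\<in>{F}. \<tau> \<subseteq> F) \<and> \<tau> \<notin> {F}} = {\<tau>. \<tau> \<union> F \<in> K \<and> \<not> F \<subseteq> \<tau>}" by (auto simp: 1)
  ultimately show ?thesis by (simp add: cone_off_def stellar_def)
qed

text \<open>In the cone over the smaller ball, the ridge \<rho> has the cofacets \<rho> \<union>
  {z}, since it is on the boundary of the ball, and \<rho> \<union> {w}, which is outside the ball.
  As \<open>w\<close> is not a vertex of the ball, it is not adjacent to \<open>z\<close>, and the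
  flip of \<rho> to the edge \<open>z w\<close> yields the cone over the enlarged ball.\<close>

lemma cone_off_attach:
  assumes K: "normal_pm d K" and d: "3 \<le> d" and b: "stacked_ball K d \<F> \<G>"
    and a: "F \<in> \<F>" "\<rho> \<subseteq> F" "card \<rho> + 1 = d" "w \<notin> \<Union>\<F>" "insert w \<rho> \<in> K"
    and z: "z \<notin> verts K" and C: "normal_pm d (cone_off K \<F> \<G> z)"
  shows "flippable d (cone_off K \<F> \<G> z) \<rho> z w"
    and "cone_off K (insert (insert w \<rho>) \<F>) (insert \<rho> \<G>) z = flip (cone_off K \<F> \<G> z) \<rho> z w"
proof -
  let ?C = "cone_off K \<F> \<G> z"
  let ?D = "cone_off K (insert (insert w \<rho>) \<F>) (insert \<rho> \<G>) z"
  note N = normal_pmD[OF K]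
  note s = simplicial_complexD[OF N(1)]
  have sb: "\<F> \<subseteq> K" "\<And>F. F \<in> \<F> \<Longrightarrow> card F = d" "\<And>G. G \<in> \<G> \<Longrightarrow> card G + 1 = d"
    "\<And>G. G \<in> \<G> \<Longrightarrow> \<exists>a b. a \<noteq> b \<and> a \<notin> G \<and> b \<notin> G \<and> insert a G \<in> \<F> \<and> insert b G \<in> \<F>"
    using stacked_ball_basic[OF b N(1)] d by auto
  have zK: "z \<notin> \<sigma>" if "\<sigma> \<in> K" for \<sigma>
    using face_subset_verts[OF N(1) that] z by blast
  note ci = cone_off_iff[OF N(1) z sb(1)]
  have FK: "F \<in> K" using a sb by auto
  have rK: "\<rho> \<in> K" by (rule s(4)[OF FK a(2)])
  have fr: "finite \<rho>" using s(3)[OF rK] .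
  have wr: "w \<notin> \<rho>" using a by blast
  have zr: "z \<notin> \<rho>" "z \<noteq> w" using zK[OF a(5)] by auto
  have rF: "\<rho> \<notin> \<F>" using a(3) sb(2) by (metis n_not_Suc_n Suc_eq_plus1)
  have wG: "w \<notin> G" if "G \<in> \<G>" for G using sb(4)[OF that] a(4) by blast
  have wF: "w \<notin> G" if "G \<in> \<F>" for G using that a(4) by blast
  \<comment> \<open>A ridge used for an earlier gluing would have three cofacets in
    \<open>K\<close>: two in the ball, and \<rho> \<union> {w}.\<close>
  have rG: "\<rho> \<notin> \<G>"
  proof
    assume "\<rho> \<in> \<G>"
    then obtain p q where pq: "p \<noteq> q" "p \<notin> \<rho>" "q \<notin> \<rho>" "insert p \<rho> \<in> \<F>" "insert q \<rho> \<in> \<F>"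
      using sb(4) by blast
    have "p \<noteq> w" "q \<noteq> w" using pq(4,5) wF by blast+
    then have "card {p, q, w} = 3" using pq by simp
    moreover have "{p, q, w} \<subseteq> {v. v \<notin> \<rho> \<and> insert v \<rho> \<in> K}" using pq sb(1) a(5) wr by auto
    moreover have c2: "card {v. v \<notin> \<rho> \<and> insert v \<rho> \<in> K} = 2" using N(4)[OF rK a(3)] .
    ultimately show False using card_mono[OF finite_card_two[OF c2]] by (metis eval_nat_numeral(3) not_less_eq_eq order_refl)
  qed
  show fl: "flippable d ?C \<rho> z w"
  proof
    have "insert z \<rho> - {z} = \<rho>" using zr by simp
    then show "insert z \<rho> \<in> ?C" using a rF rG by (auto simp: ci)
    have "insert w \<rho> \<notin> \<F> \<union> \<G>" using wF wG by blast
    then show "insert w \<rho> \<in> ?C" using a(5) zr by (auto simp: ci)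
    show "{z, w} \<notin> ?C" using a(4) zr by (auto simp: ci)
  qed (use C d a zr wr in auto)
  interpret fl: flippable d ?C \<rho> z w by (rule fl)
  have over: "\<sigma> = \<rho> \<or> \<sigma> = insert z \<rho> \<or> \<sigma> = insert w \<rho>" if "\<sigma> \<in> ?C" "\<rho> \<subseteq> \<sigma>" for \<sigma>
    using fl.faces_over_R that by blast
  have wrF: "insert w \<rho> \<notin> \<F> \<union> \<G>" using wF wG by blast
  have sbD: "insert (insert w \<rho>) \<F> \<subseteq> K" using sb(1) a(5) by blast
  note di = cone_off_iff[OF N(1) z sbD]
  have "\<sigma> \<in> ?D \<longleftrightarrow> \<sigma> \<in> fl.L" for \<sigma>
  proof (cases "z \<in> \<sigma>")
    case False
    then have "\<sigma> \<in> ?D \<longleftrightarrow> \<sigma> \<in> ?C \<and> \<sigma> \<noteq> \<rho> \<and> \<sigma> \<noteq> insert w \<rho>" by (auto simp: di ci)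
    also have "\<dots> \<longleftrightarrow> \<sigma> \<in> ?C \<and> \<not> \<rho> \<subseteq> \<sigma>" using over[of \<sigma>] False by auto
    finally show ?thesis using False by (simp add: fl.flip_iff)
  next
    case True
    define \<tau> where "\<tau> = \<sigma> - {z}"
    have st: "\<sigma> = insert z \<tau>" "z \<notin> \<tau>" using True \<tau>_def by auto
    have D: "\<sigma> \<in> ?D \<longleftrightarrow> ((\<exists>F\<in>\<F>. \<tau> \<subseteq> F) \<or> \<tau> \<subseteq> insert w \<rho>) \<and> \<tau> \<notin> \<F> \<union> \<G> \<and> \<tau> \<noteq> \<rho> \<and> \<tau> \<noteq> insert w \<rho>"
      using True by (auto simp: di simp flip: \<tau>_def)
    show ?thesis
    proof (cases "w \<in> \<tau>")
      case wt: True
      then have "\<tau> \<notin> \<F> \<union> \<G>" "\<not> (\<exists>F\<in>\<F>. \<tau> \<subseteq> F)" "\<tau> \<noteq> \<rho>" using wF wG wr by blast+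
      then have "\<sigma> \<in> ?D \<longleftrightarrow> \<tau> \<subset> insert w \<rho>" using D by blast
      also have "\<dots> \<longleftrightarrow> \<tau> - {w} \<subset> \<rho>" using wt wr by blast
      also have "\<tau> - {w} = \<sigma> - {z, w}" using \<tau>_def by auto
      finally show ?thesis using wt st by (simp add: fl.flip_iff)
    next
      case wt: False
      then have "\<tau> \<subseteq> insert w \<rho> \<Longrightarrow> \<tau> \<subseteq> F" using a(2) by blast
      then have "\<sigma> \<in> ?D \<longleftrightarrow> (\<exists>F\<in>\<F>. \<tau> \<subseteq> F) \<and> \<tau> \<notin> \<F> \<union> \<G> \<and> \<tau> \<noteq> \<rho>"
        using D wt a(1) by blast
      also have "\<dots> \<longleftrightarrow> \<sigma> \<in> ?C \<and> \<tau> \<noteq> \<rho>" using True by (auto simp: ci simp flip: \<tau>_def)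
      also have "\<dots> \<longleftrightarrow> \<sigma> \<in> ?C \<and> \<not> \<rho> \<subseteq> \<sigma>"
      proof -
        have "\<rho> \<subseteq> \<sigma> \<longleftrightarrow> \<tau> = \<rho>" if "\<sigma> \<in> ?C"
        proof
          assume "\<rho> \<subseteq> \<sigma>"
          then have "\<sigma> = insert z \<rho>" using over[OF that] True zr wt st by auto
          then show "\<tau> = \<rho>" using st zr by auto
        qed (use st in auto)
        then show ?thesis by blast
      qed
      finally show ?thesis using wt st zr by (simp add: fl.flip_iff)
    qed
  qed
  then show "?D = flip ?C \<rho> z w" by blast
qed

lemma retriangulates_cone_off:
  fixes K :: "nat set set"
  assumes K: "normal_pm d K" and d: "3 \<le> d" and b: "stacked_ball K d \<F> \<G>" and z: "z \<notin> verts K"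
  shows "retriangulates d K (cone_off K \<F> \<G> z)"
  using b
proof induction
  case (facet F)
  have "F \<noteq> {}" using facet d by auto
  then show ?case unfolding cone_off_facet[OF K facet]
    using retriangulates_stellar[OF K facet(1) _ z] by blast
next
  case (attach \<F> \<G> F \<rho> w)
  note C = retriangulates_normal_pm[OF attach.IH]
  interpret fl: flippable d "cone_off K \<F> \<G> z" \<rho> z w
    by (rule cone_off_attach(1)[OF K d attach.hyps z C])
  have "retriangulates d (cone_off K \<F> \<G> z) fl.L"
    unfolding retriangulates_def using fl.normal_pm_flip fl.realization_flip_homeomorphic by simp
  then show ?case unfolding cone_off_attach(2)[OF K d attach.hyps z C]
    using attach.IH retriangulates_trans by blast
qed

text \<open>The faces interior to the ball have at least \<open>d - 1\<close> vertices; smaller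
  faces of \<open>K\<close> survive, and smaller faces of the ball are on its boundary.\<close>

lemma cone_off_small:
  assumes K: "simplicial_complex K" and d: "0 < d" and b: "stacked_ball K d \<F> \<G>"
    and z: "z \<notin> verts K"
  shows "z \<notin> \<sigma> \<Longrightarrow> card \<sigma> + 2 \<le> d \<Longrightarrow> \<sigma> \<in> cone_off K \<F> \<G> z \<longleftrightarrow> \<sigma> \<in> K"
    "z \<notin> \<tau> \<Longrightarrow> card \<tau> + 2 \<le> d \<Longrightarrow> insert z \<tau> \<in> cone_off K \<F> \<G> z \<longleftrightarrow> (\<exists>F\<in>\<F>. \<tau> \<subseteq> F)"
proof -
  note sb = stacked_ball_basic[OF b K d]
  have big: "d \<le> card \<sigma> + 1" if "\<sigma> \<in> \<F> \<union> \<G>" for \<sigma> using that sb by fastforce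
  note ci = cone_off_iff[OF K z, of \<F> _ \<G>]
  show "\<sigma> \<in> cone_off K \<F> \<G> z \<longleftrightarrow> \<sigma> \<in> K" if "z \<notin> \<sigma>" "card \<sigma> + 2 \<le> d"
    using that sb big[of \<sigma>] by (auto simp: ci)
  show "insert z \<tau> \<in> cone_off K \<F> \<G> z \<longleftrightarrow> (\<exists>F\<in>\<F>. \<tau> \<subseteq> F)" if "z \<notin> \<tau>" "card \<tau> + 2 \<le> d"
    using that sb big[of \<tau>] by (auto simp: ci)
qed

lemma verts_cone_off:
  assumes "simplicial_complex K" "3 \<le> d" "stacked_ball K d \<F> \<G>" "z \<notin> verts K"
  shows "verts (cone_off K \<F> \<G> z) = insert z (verts K)"
proof -
  have d: "0 < d" using assms by simp
  note c = cone_off_small[OF assms(1) d assms(3,4)]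
  have "\<F> \<noteq> {}" using stacked_ball_basic[OF assms(3,1) d] by blast
  then have "{z} \<in> cone_off K \<F> \<G> z" using c(2)[of "{}"] assms(2) by auto
  moreover have "{v} \<in> cone_off K \<F> \<G> z \<longleftrightarrow> {v} \<in> K" if "v \<noteq> z" for v
    using c(1)[of "{v}"] that assms(2) by auto
  ultimately have "v \<in> verts (cone_off K \<F> \<G> z) \<longleftrightarrow> v \<in> insert z (verts K)" for v
    by (cases "v = z") (auto simp: verts_def)
  then show ?thesis by blast
qed

text \<open>Here \<open>d \<ge> 4\<close> enters: an edge is smaller than a ridge, so it is never
  interior to the ball. For \<open>d = 3\<close> every gluing ridge would be a lost edge.\<close>

lemma cone_off_edges:
  assumes "simplicial_complex K" "4 \<le> d" "stacked_ball K d \<F> \<G>" "z \<notin> verts K"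
  shows "a \<noteq> z \<Longrightarrow> b \<noteq> z \<Longrightarrow> {a, b} \<in> cone_off K \<F> \<G> z \<longleftrightarrow> {a, b} \<in> K"
    "a \<noteq> z \<Longrightarrow> {z, a} \<in> cone_off K \<F> \<G> z \<longleftrightarrow> a \<in> \<Union>\<F>"
proof -
  have d: "0 < d" using assms by simp
  note c = cone_off_small[OF assms(1) d assms(3,4)]
  show "{a, b} \<in> cone_off K \<F> \<G> z \<longleftrightarrow> {a, b} \<in> K" if "a \<noteq> z" "b \<noteq> z"
    using c(1)[of "{a, b}"] that assms(2) by (cases "a = b") auto
  show "{z, a} \<in> cone_off K \<F> \<G> z \<longleftrightarrow> a \<in> \<Union>\<F>" if "a \<noteq> z"
    using c(2)[of "{a}"] that assms(2) by auto
qed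

section \<open>Extending a stacked ball to a given vertex\<close>

lemma rtranclp_distinct_path:
  assumes "R\<^sup>*\<^sup>* x y"
  shows "\<exists>ps. distinct (x # ps) \<and> last (x # ps) = y \<and> successively R (x # ps)"
  using assms
proof (induction rule: converse_rtranclp_induct)
  case base
  then show ?case by (intro exI[of _ "[]"]) simp
next
  case (step x x')
  then obtain ps where ps: "distinct (x' # ps)" "last (x' # ps) = y" "successively R (x' # ps)" by blast
  show ?case
  proof (cases "x \<in> set (x' # ps)")
    case True
    then obtain as bs where ab: "x' # ps = as @ x # bs" by (meson split_list)
    then have "distinct (x # bs)" "last (x # bs) = y" "successively R (x # bs)"
      using ps by (auto simp: successively_append_iff)
    then show ?thesis by blast
  next
    case False
    then show ?thesis using ps step(1) by (intro exI[of _ "x' # ps"]) auto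
  qed
qed

lemma ex_fresh_vertex: "simplicial_complex K \<Longrightarrow> \<exists>m::nat. m \<notin> verts K"
  using ex_new_if_finite[OF infinite_UNIV_nat finite_verts] by blast

text \<open>The ball is enlarged until some facet contains \<alpha> and \<open>w\<close>. The
  clauses serve the inductions: of the old vertices only \<open>w\<close> may be swallowed, so later
  targets stay outside the ball; created vertices lie in the ball, so the set of uncovered vertices
  does not grow; added facets contain \<alpha>; and no face of \<open>K\<close> is lost unless it
  properly contains \<alpha>, which protects paths and hubs.\<close>

definition covers ::
  "nat \<Rightarrow> 'a set \<Rightarrow> 'a \<Rightarrow> 'a set set \<Rightarrow> 'a set set \<Rightarrow> 'a set set \<Rightarrow> 'a set set \<Rightarrow> 'a set set \<Rightarrow> bool"
where
  "covers d \<alpha> w K \<F> K' \<F>' \<G>' \<longleftrightarrow>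
     retriangulates d K K' \<and> stacked_ball K' d \<F>' \<G>' \<and> (\<exists>F\<in>\<F>'. insert w \<alpha> \<subseteq> F) \<and> \<Union>\<F> \<subseteq> \<Union>\<F>' \<and>
     \<Union>\<F>' \<inter> verts K \<subseteq> insert w (\<Union>\<F>) \<and> verts K' - \<Union>\<F>' \<subseteq> verts K - \<Union>\<F> \<and>
     (\<forall>F\<in>\<F>'. F \<in> \<F> \<or> \<alpha> \<subseteq> F) \<and> (\<forall>\<sigma>\<in>K. \<not> \<alpha> \<subset> \<sigma> \<longrightarrow> \<sigma> \<in> K')"

lemma coversD:
  assumes "covers d \<alpha> w K \<F> K' \<F>' \<G>'"
  shows "retriangulates d K K'" "stacked_ball K' d \<F>' \<G>'" "\<exists>F\<in>\<F>'. insert w \<alpha> \<subseteq> F"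
    "\<Union>\<F> \<subseteq> \<Union>\<F>'" "\<Union>\<F>' \<inter> verts K \<subseteq> insert w (\<Union>\<F>)"
    "verts K' - \<Union>\<F>' \<subseteq> verts K - \<Union>\<F>" "\<And>F. F \<in> \<F>' \<Longrightarrow> F \<in> \<F> \<or> \<alpha> \<subseteq> F"
    "\<And>\<sigma>. \<sigma> \<in> K \<Longrightarrow> \<not> \<alpha> \<subset> \<sigma> \<Longrightarrow> \<sigma> \<in> K'"
  using assms unfolding covers_def by simp_all

lemma coversI:
  assumes "retriangulates d K K'" "stacked_ball K' d \<F>' \<G>'" "\<exists>F\<in>\<F>'. insert w \<alpha> \<subseteq> F"
    "\<Union>\<F> \<subseteq> \<Union>\<F>'" "\<Union>\<F>' \<inter> verts K \<subseteq> insert w (\<Union>\<F>)"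
    "verts K' - \<Union>\<F>' \<subseteq> verts K - \<Union>\<F>" "\<And>F. F \<in> \<F>' \<Longrightarrow> F \<in> \<F> \<or> \<alpha> \<subseteq> F"
    "\<And>\<sigma>. \<sigma> \<in> K \<Longrightarrow> \<not> \<alpha> \<subset> \<sigma> \<Longrightarrow> \<sigma> \<in> K'"
  shows "covers d \<alpha> w K \<F> K' \<F>' \<G>'"
  unfolding covers_def using assms by simp

lemma covers_verts:
  assumes "covers d \<alpha> w K \<F> K' \<F>' \<G>'" "\<alpha> \<noteq> {}"
  shows "verts K \<subseteq> verts K'"
proof
  fix v assume "v \<in> verts K"
  moreover have "\<not> \<alpha> \<subset> {v}" using assms(2) by blast
  ultimately show "v \<in> verts K'" using coversD(8)[OF assms(1), of "{v}"] unfolding verts_def by simp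
qed

lemma covers_weaken:
  assumes c: "covers d (insert x \<alpha>) w K \<F> K' \<F>' \<G>'"
  shows "covers d \<alpha> w K \<F> K' \<F>' \<G>'"
proof (rule coversI)
  note D = coversD[OF c]
  show "\<exists>F\<in>\<F>'. insert w \<alpha> \<subseteq> F" using D(3) by blast
  show "F \<in> \<F> \<or> \<alpha> \<subseteq> F" if "F \<in> \<F>'" for F using D(7)[OF that] by blast
  show "\<sigma> \<in> K'" if "\<sigma> \<in> K" "\<not> \<alpha> \<subset> \<sigma>" for \<sigma> by (rule D(8)) (use that in auto)
qed (use coversD[OF c] in simp_all)

text \<open>The intermediate target \<open>m\<close> is not a vertex of \<open>K\<close>, so it does
  not count among the old vertices swallowed by the ball.\<close>

lemma covers_trans:
  assumes c1: "covers d \<alpha> m K \<F> K\<^sub>1 \<F>\<^sub>1 \<G>\<^sub>1" and c2: "covers d \<alpha> w K\<^sub>1 \<F>\<^sub>1 K\<^sub>2 \<F>\<^sub>2 \<G>\<^sub>2"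
    and m: "m \<notin> verts K" and a: "\<alpha> \<noteq> {}"
  shows "covers d \<alpha> w K \<F> K\<^sub>2 \<F>\<^sub>2 \<G>\<^sub>2"
proof (rule coversI)
  note C = coversD[OF c1] and D = coversD[OF c2]
  have v: "verts K \<subseteq> verts K\<^sub>1" by (rule covers_verts[OF c1 a])
  show "retriangulates d K K\<^sub>2" by (rule retriangulates_trans[OF C(1) D(1)])
  show "\<Union>\<F> \<subseteq> \<Union>\<F>\<^sub>2" using C(4) D(4) by (rule subset_trans)
  show "\<Union>\<F>\<^sub>2 \<inter> verts K \<subseteq> insert w (\<Union>\<F>)"
  proof
    fix v assume "v \<in> \<Union>\<F>\<^sub>2 \<inter> verts K"
    then have v': "v \<in> \<Union>\<F>\<^sub>2" "v \<in> verts K" "v \<in> verts K\<^sub>1" "v \<noteq> m" using v m by auto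
    then have "v = w \<or> v \<in> \<Union>\<F>\<^sub>1" using D(5) by (metis IntI insertE subsetD)
    then show "v \<in> insert w (\<Union>\<F>)" using C(5) v' by (metis IntI insertE insertI1 insertI2 subsetD)
  qed
  show "verts K\<^sub>2 - \<Union>\<F>\<^sub>2 \<subseteq> verts K - \<Union>\<F>" using D(6) C(6) by (rule subset_trans)
  show "F \<in> \<F> \<or> \<alpha> \<subseteq> F" if "F \<in> \<F>\<^sub>2" for F using D(7)[OF that] C(7) by blast
  show "\<sigma> \<in> K\<^sub>2" if "\<sigma> \<in> K" "\<not> \<alpha> \<subset> \<sigma>" for \<sigma> using C(8)[OF that] D(8) that(2) by blast
qed (use coversD[OF c2] in simp_all)

text \<open>Subdividing \<open>\<alpha> \<union> {p}\<close> replaces \<open>p\<close> by a new vertex in the link of \<open>\<alpha>\<close>, so that a path in this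
  link can be made to avoid the vertices of the ball.\<close>

lemma rename_in_link:
  assumes K: "normal_pm d K" and b: "stacked_ball K d \<F> \<G>"
    and a: "\<alpha> \<noteq> {}" and p: "insert p \<alpha> \<in> K" "p \<notin> \<alpha>" "\<not> (\<exists>F\<in>\<F>. insert p \<alpha> \<subseteq> F)" and d: "0 < d"
    and m: "m \<notin> verts K"
  defines "K\<^sub>1 \<equiv> stellar K (insert p \<alpha>) m"
  shows "retriangulates d K K\<^sub>1" "stacked_ball K\<^sub>1 d \<F> \<G>" "verts K\<^sub>1 \<subseteq> insert m (verts K)"
    "\<And>\<sigma>. \<sigma> \<in> K \<Longrightarrow> \<not> \<alpha> \<subset> \<sigma> \<Longrightarrow> \<sigma> \<in> K\<^sub>1"
    "\<And>b. link_adj K \<alpha> p b \<Longrightarrow> b \<noteq> p \<Longrightarrow> link_adj K\<^sub>1 \<alpha> m b"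
    "\<And>b c. link_adj K \<alpha> b c \<Longrightarrow> b \<noteq> p \<Longrightarrow> c \<noteq> p \<Longrightarrow> link_adj K\<^sub>1 \<alpha> b c"
proof -
  note N = normal_pmD[OF K]
  note s = simplicial_complexD[OF N(1)]
  note st = stellar_iff[OF N(1) m]
  have mK: "m \<notin> \<sigma>" if "\<sigma> \<in> K" for \<sigma>
    using face_subset_verts[OF N(1) that] m by blast
  show "retriangulates d K K\<^sub>1" unfolding K\<^sub>1_def by (rule retriangulates_stellar[OF K p(1) _ m]) simp
  have sb: "\<F> \<subseteq> K" using stacked_ball_basic[OF b N(1) d] by simp
  have "F \<in> K\<^sub>1" if "F \<in> \<F>" for F
    unfolding K\<^sub>1_def st using that p(3) sb mK by auto
  then show "stacked_ball K\<^sub>1 d \<F> \<G>" by (intro stacked_ball_mono[OF b]) blast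
  show "verts K\<^sub>1 \<subseteq> insert m (verts K)"
    unfolding K\<^sub>1_def verts_def by (auto simp: st split: if_splits)
  show "\<sigma> \<in> K\<^sub>1" if "\<sigma> \<in> K" "\<not> \<alpha> \<subset> \<sigma>" for \<sigma>
    unfolding K\<^sub>1_def st using that mK[OF that(1)] p(2) by auto
  show "link_adj K\<^sub>1 \<alpha> m b" if "link_adj K \<alpha> p b" "b \<noteq> p" for b
  proof -
    have l: "b \<notin> \<alpha>" "insert p (insert b \<alpha>) \<in> K" using that by (auto simp: link_adj_def)
    have "m \<noteq> b" "m \<notin> \<alpha>" using mK[OF l(2)] by auto
    then have "insert m (insert b \<alpha>) - {m} = insert b \<alpha>" by auto
    moreover have "insert b \<alpha> \<union> insert p \<alpha> = insert p (insert b \<alpha>)" by auto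
    ultimately show ?thesis unfolding link_adj_def K\<^sub>1_def st using l \<open>m \<notin> \<alpha>\<close> that(2) p(2) by simp
  qed
  show "link_adj K\<^sub>1 \<alpha> b c" if "link_adj K \<alpha> b c" "b \<noteq> p" "c \<noteq> p" for b c
    using that mK[of "insert b (insert c \<alpha>)"] p(2) unfolding link_adj_def K\<^sub>1_def st by auto
qed

lemma successively_link_adj_transfer:
  assumes "successively (link_adj K \<alpha>) xs"
    and "\<And>b c. b \<in> set xs \<Longrightarrow> c \<in> set xs \<Longrightarrow> link_adj K \<alpha> b c \<Longrightarrow> link_adj K' \<alpha> b c"
  shows "successively (link_adj K' \<alpha>) xs"
  using assms by (rule successively_mono)

lemma link_path_verts:
  assumes K: "simplicial_complex K" and "successively (link_adj K \<alpha>) (x # ps)" "ps \<noteq> []"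
  shows "set (x # ps) \<subseteq> verts K"
  using assms(2,3)
proof (induction ps arbitrary: x)
  case (Cons p ps)
  then have "insert x (insert p \<alpha>) \<in> K" by (simp add: link_adj_def)
  then have "x \<in> verts K" "p \<in> verts K" using face_subset_verts[OF K] by blast+
  then show ?case using Cons by (cases "ps = []") auto
qed simp

text \<open>Walks along a path in the link of \<alpha> from \<open>x\<close>, where \<alpha>
  \<union> {x} is already in a facet of the ball. The hypothesis \<open>IH\<close> reaches the next
  vertex through facets over \<alpha> \<union> {x} if that vertex is outside the ball. A path vertex
  \<open>p\<close> may lie in the ball although no facet of the ball contains \<alpha> \<union> {p};
  therefore it is first replaced by a fresh vertex.\<close>

lemma cover_along_path:
  fixes K :: "nat set set"
  assumes IH: "\<And>K \<F> \<G> x w. normal_pm d K \<Longrightarrow> stacked_ball K d \<F> \<G> \<Longrightarrow> \<exists>F\<in>\<F>. insert x \<alpha> \<subseteq> F \<Longrightarrow>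
      x \<notin> \<alpha> \<Longrightarrow> w \<notin> \<Union>\<F> \<Longrightarrow> insert w (insert x \<alpha>) \<in> K \<Longrightarrow>
      \<exists>K' \<F>' \<G>'. covers d (insert x \<alpha>) w K \<F> K' \<F>' \<G>'"
    and a: "\<alpha> \<noteq> {}" and d: "0 < d"
    and "normal_pm d K" "stacked_ball K d \<F> \<G>" "\<exists>F\<in>\<F>. insert x \<alpha> \<subseteq> F"
      "distinct (x # ps)" "successively (link_adj K \<alpha>) (x # ps)" "ps \<noteq> []" "last ps = w" "w \<notin> \<Union>\<F>"
  shows "\<exists>K' \<F>' \<G>'. covers d \<alpha> w K \<F> K' \<F>' \<G>'"
  using assms(4-)
proof (induction "length ps" arbitrary: K \<F> \<G> x ps rule: less_induct)
  case less
  obtain p qs where ps: "ps = p # qs" using less.prems by (cases ps) auto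
  have N: "normal_pm d K" and S: "simplicial_complex K" using less.prems normal_pmD(1) by blast+
  have xp: "link_adj K \<alpha> x p" using less.prems(5) ps by simp
  then have xa: "x \<notin> \<alpha>" "p \<notin> \<alpha>" "insert x (insert p \<alpha>) \<in> K" by (auto simp: link_adj_def)
  have qs: "distinct (p # qs)" "successively (link_adj K \<alpha>) (p # qs)" "x \<notin> set (p # qs)"
    using less.prems ps by auto
  show ?case
  proof (cases "qs = []")
    case True
    then have "p = w" using less.prems ps by simp
    then have "insert w (insert x \<alpha>) \<in> K" using xa by (simp add: insert_commute)
    then obtain K' \<F>' \<G>' where "covers d (insert x \<alpha>) w K \<F> K' \<F>' \<G>'"
      using IH[OF N less.prems(2,3) xa(1) less.prems(8)] by blast
    from covers_weaken[OF this] show ?thesis by blast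
  next
    case ne: False
    have lw: "last qs = w" using less.prems ps ne by simp
    show ?thesis
    proof (cases "\<exists>F\<in>\<F>. insert p \<alpha> \<subseteq> F")
      case True
      \<comment> \<open>A facet of the ball already contains \<alpha> \<union> {p}, so the walk
        moves on to \<open>p\<close> without any change.\<close>
      show ?thesis
        by (rule less.hyps[OF _ N less.prems(2) True qs(1,2) ne lw less.prems(8)]) (simp add: ps)
    next
      case np: False
      obtain m where m: "m \<notin> verts K" using ex_fresh_vertex[OF S] by blast
      have pK: "insert p \<alpha> \<in> K" using simplicial_complexD(4)[OF S xa(3)] by blast
      define K\<^sub>1 where "K\<^sub>1 = stellar K (insert p \<alpha>) m"
      note ren = rename_in_link[OF N less.prems(2) a pK xa(2) np d m, folded K\<^sub>1_def]
      have mU: "m \<notin> \<Union>\<F>" using stacked_ball_vertices(2)[OF less.prems(2) S d] m by blast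
      have pv: "set (x # ps) \<subseteq> verts K" by (rule link_path_verts[OF S less.prems(5,6)])
      have qsv: "c \<noteq> m" if "c \<in> set (x # p # qs)" for c
        using that pv m ps by auto
      have "link_adj K\<^sub>1 \<alpha> m x" using ren(5)[of x] xp qs(3) link_adj_commute by (metis list.set_intros(1))
      then have mK: "insert m (insert x \<alpha>) \<in> K\<^sub>1" by (simp add: link_adj_def)
      obtain K\<^sub>2 \<F>\<^sub>2 \<G>\<^sub>2 where c: "covers d (insert x \<alpha>) m K\<^sub>1 \<F> K\<^sub>2 \<F>\<^sub>2 \<G>\<^sub>2"
        using IH[OF retriangulates_normal_pm[OF ren(1)] ren(2) less.prems(3) xa(1) mU mK] by blast
      note C = coversD[OF c]
      have good: "\<exists>F\<in>\<F>\<^sub>2. insert m \<alpha> \<subseteq> F" using C(3) by blast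
      \<comment> \<open>Reaching \<open>m\<close> destroys only faces that contain \<open>x\<close>,
        and \<open>x\<close> does not recur on the path because the path is distinct.\<close>
      have keep: "\<sigma> \<in> K\<^sub>2" if "\<sigma> \<in> K\<^sub>1" "x \<notin> \<sigma>" for \<sigma>
        by (rule C(8)) (use that in auto)
      have path1: "successively (link_adj K\<^sub>1 \<alpha>) (m # qs)"
      proof -
        obtain q qs' where q: "qs = q # qs'" using ne by (cases qs) auto
        have "link_adj K\<^sub>1 \<alpha> m q" using ren(5)[of q] qs q by auto
        moreover have "successively (link_adj K\<^sub>1 \<alpha>) qs"
        proof (rule successively_link_adj_transfer)
          show "successively (link_adj K \<alpha>) qs" using qs(2) q by simp
        qed (use ren(6) qs(1) in auto)
        ultimately show ?thesis using q by simp
      qed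
      have xn: "x \<notin> set (m # qs)" using qs(3) qsv[of x] by auto
      have path2: "successively (link_adj K\<^sub>2 \<alpha>) (m # qs)"
      proof (rule successively_link_adj_transfer[OF path1])
        fix b c assume "b \<in> set (m # qs)" "c \<in> set (m # qs)" "link_adj K\<^sub>1 \<alpha> b c"
        moreover from this have "x \<notin> insert b (insert c \<alpha>)" using xn xa by auto
        ultimately show "link_adj K\<^sub>2 \<alpha> b c" using keep unfolding link_adj_def by blast
      qed
      have dm: "distinct (m # qs)" using qs(1) qsv by auto
      have c1: "covers d \<alpha> m K \<F> K\<^sub>2 \<F>\<^sub>2 \<G>\<^sub>2"
      proof -
        have v1: "verts K \<subseteq> verts K\<^sub>1"
        proof
          fix v assume "v \<in> verts K"
          moreover have "\<not> \<alpha> \<subset> {v}" using a by blast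
          ultimately show "v \<in> verts K\<^sub>1" using ren(4) unfolding verts_def by blast
        qed
        show ?thesis
        proof (rule coversI)
          show "retriangulates d K K\<^sub>2" by (rule retriangulates_trans[OF ren(1) C(1)])
          show "\<Union>\<F>\<^sub>2 \<inter> verts K \<subseteq> insert m (\<Union>\<F>)" using C(5) v1 by blast
          have "m \<in> \<Union>\<F>\<^sub>2" using good by blast
          then show "verts K\<^sub>2 - \<Union>\<F>\<^sub>2 \<subseteq> verts K - \<Union>\<F>" using C(6) ren(3) by blast
          show "F \<in> \<F> \<or> \<alpha> \<subseteq> F" if "F \<in> \<F>\<^sub>2" for F using C(7)[OF that] by blast
          show "\<sigma> \<in> K\<^sub>2" if "\<sigma> \<in> K" "\<not> \<alpha> \<subset> \<sigma>" for \<sigma>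
            by (rule C(8)[OF ren(4)[OF that]]) (use that in auto)
        qed (use C(2,4) good in simp_all)
      qed
      have "w \<in> verts K" using lw ne pv ps last_in_set[of qs] by auto
      then have wU: "w \<notin> \<Union>\<F>\<^sub>2" using coversD(5)[OF c1] less.prems(8) m by blast
      have "\<exists>K\<^sub>3 \<F>\<^sub>3 \<G>\<^sub>3. covers d \<alpha> w K\<^sub>2 \<F>\<^sub>2 K\<^sub>3 \<F>\<^sub>3 \<G>\<^sub>3"
      proof (rule less.hyps[OF _ _ _ good dm path2 ne lw wU])
        show "length qs < length ps" by (simp add: ps)
        show "normal_pm d K\<^sub>2" "stacked_ball K\<^sub>2 d \<F>\<^sub>2 \<G>\<^sub>2"
          using C(1,2) retriangulates_normal_pm by blast+
      qed
      then obtain K\<^sub>3 \<F>\<^sub>3 \<G>\<^sub>3 where "covers d \<alpha> w K\<^sub>2 \<F>\<^sub>2 K\<^sub>3 \<F>\<^sub>3 \<G>\<^sub>3" by blast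
      from covers_trans[OF c1 this m a] show ?thesis by blast
    qed
  qed
qed

text \<open>Induction on \<open>d - card \<alpha>\<close>. If \<alpha> is a ridge, the facet
  \<alpha> \<union> {w} is attached at once and \<open>K\<close> is unchanged; otherwise a path in
  the connected link of \<alpha> reduces the task to faces \<alpha> \<union> {x}. The last conjunct
  is what lets full hubs have spanning balls without subdivision.\<close>

lemma ex_covers:
  fixes K :: "nat set set"
  assumes d: "2 \<le> d" and "normal_pm d K" "stacked_ball K d \<F> \<G>" "\<exists>F\<in>\<F>. \<alpha> \<subseteq> F" "\<alpha> \<noteq> {}"
    "card \<alpha> + 1 \<le> d" "w \<notin> \<Union>\<F>" "insert w \<alpha> \<in> K"
  shows "\<exists>K' \<F>' \<G>'. covers d \<alpha> w K \<F> K' \<F>' \<G>' \<and> (card \<alpha> + 1 = d \<longrightarrow> K' = K)"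
  using assms(2-)
proof (induction "d - card \<alpha>" arbitrary: K \<F> \<G> \<alpha> w rule: less_induct)
  case less
  note N = normal_pmD[OF less.prems(1)]
  have d0: "0 < d" using d by simp
  note sb = stacked_ball_basic[OF less.prems(2) N(1) d0]
  obtain F where F: "F \<in> \<F>" "\<alpha> \<subseteq> F" using less.prems by blast
  have FK: "F \<in> K" "card F = d" using sb F by auto
  have fF: "finite F" using simplicial_complexD(3)[OF N(1) FK(1)] .
  have fa: "finite \<alpha>" using F fF finite_subset by blast
  have wa: "w \<notin> \<alpha>" using less.prems(6) F by blast
  show ?case
  proof (cases "card \<alpha> + 1 = d")
    case True
    have ball: "stacked_ball K d (insert (insert w \<alpha>) \<F>) (insert \<alpha> \<G>)"
      by (rule stacked_ball.attach[OF less.prems(2) F True less.prems(6,7)])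
    have "covers d \<alpha> w K \<F> K (insert (insert w \<alpha>) \<F>) (insert \<alpha> \<G>)"
      unfolding covers_def using ball retriangulates_refl[OF less.prems(1)] F by auto
    then show ?thesis by blast
  next
    case False
    then have c2: "card \<alpha> + 2 \<le> d" using less.prems(5) by simp
    have "\<alpha> \<noteq> F" using FK c2 by auto
    then obtain x where x: "x \<in> F" "x \<notin> \<alpha>" using F by blast
    have aK: "\<alpha> \<in> K" by (rule simplicial_complexD(4)[OF N(1) FK(1) F(2)])
    have "insert x \<alpha> \<in> K" by (rule simplicial_complexD(4)[OF N(1) FK(1)]) (use F x in auto)
    then have "link_adj K \<alpha> x x" "link_adj K \<alpha> w w" using x wa less.prems(7) by (auto simp: link_adj_def)
    then have "(link_adj K \<alpha>)\<^sup>*\<^sup>* x w" using N(5)[OF aK c2] by blast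
    then obtain ps where ps: "distinct (x # ps)" "last (x # ps) = w" "successively (link_adj K \<alpha>) (x # ps)"
      using rtranclp_distinct_path by metis
    have "x \<noteq> w" using x F less.prems(6) by blast
    then have ne: "ps \<noteq> []" "last ps = w" using ps(2) by (auto split: if_splits)
    have "\<exists>K' \<F>' \<G>'. covers d \<alpha> w K \<F> K' \<F>' \<G>'"
    proof (rule cover_along_path[OF _ less.prems(4) d0 less.prems(1,2) _ ps(1,3) ne less.prems(6)])
      show "\<exists>F\<in>\<F>. insert x \<alpha> \<subseteq> F" using F x by blast
      fix K :: "nat set set" and \<F> \<G> x w
      assume h: "normal_pm d K" "stacked_ball K d \<F> \<G>" "\<exists>F\<in>\<F>. insert x \<alpha> \<subseteq> F"
        "x \<notin> \<alpha>" "w \<notin> \<Union>\<F>" "insert w (insert x \<alpha>) \<in> K"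
      have c: "card (insert x \<alpha>) = card \<alpha> + 1" using h(4) fa by simp
      have "d - card (insert x \<alpha>) < d - card \<alpha>" "card (insert x \<alpha>) + 1 \<le> d" "insert x \<alpha> \<noteq> {}"
        using c c2 by auto
      then show "\<exists>K' \<F>' \<G>'. covers d (insert x \<alpha>) w K \<F> K' \<F>' \<G>'"
        using less.hyps[of "insert x \<alpha>" K \<F> \<G> w] h by blast
    qed
    then show ?thesis using False by blast
  qed
qed

section \<open>Hubs and fans\<close>

text \<open>The size of \<zeta> is left open: the empty face is a hub of every simplicial complex,
  and full hubs, of size \<open>d - 2\<close>, are grown from it one vertex at a time.\<close>

definition hub :: "'a set set \<Rightarrow> 'a set \<Rightarrow> bool" where
  "hub K \<zeta> \<longleftrightarrow> \<zeta> \<in> K \<and> (\<forall>v\<in>verts K - \<zeta>. insert v \<zeta> \<in> K)"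

lemma rtranclp_crossing:
  assumes "R\<^sup>*\<^sup>* a b" "P a" "\<not> P b"
  shows "\<exists>x y. R x y \<and> P x \<and> \<not> P y"
  using assms by (induction) auto

text \<open>The link of \<zeta> is connected and contains all vertices outside \<zeta>. So some edge
  \<open>x y\<close> of it leads from the ball to an uncovered vertex \<open>y\<close>, which is
  taken in through facets over \<zeta> \<union> {x}; the number of uncovered vertices drops. For a
  full hub \<zeta> \<union> {x} is a ridge and nothing is subdivided.\<close>

lemma hub_extend_ball:
  fixes K :: "nat set set"
  assumes d: "2 \<le> d" and z: "card \<zeta> + 2 \<le> d"
    and "normal_pm d K" "hub K \<zeta>" "stacked_ball K d \<F> \<G>" "\<forall>F\<in>\<F>. \<zeta> \<subseteq> F"
  shows "\<exists>K' \<F>' \<G>'. retriangulates d K K' \<and> stacked_ball K' d \<F>' \<G>' \<and> \<Union>\<F>' = verts K' \<and>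
    (\<forall>F\<in>\<F>'. \<zeta> \<subseteq> F) \<and> (card \<zeta> + 2 = d \<longrightarrow> K' = K)"
  using assms(3-)
proof (induction "card (verts K - \<Union>\<F>)" arbitrary: K \<F> \<G> rule: less_induct)
  case less
  note N = normal_pmD[OF less.prems(1)]
  have d0: "0 < d" using d by simp
  note sb = stacked_ball_basic[OF less.prems(3) N(1) d0]
  show ?case
  proof (cases "verts K \<subseteq> \<Union>\<F>")
    case True
    then have "\<Union>\<F> = verts K" using stacked_ball_vertices(2)[OF less.prems(3) N(1) d0] by simp
    then show ?thesis using less.prems retriangulates_refl[OF less.prems(1)] by blast
  next
    case False
    then obtain w where w: "w \<in> verts K" "w \<notin> \<Union>\<F>" by blast
    obtain F where F: "F \<in> \<F>" using sb by blast
    have FK: "F \<in> K" "card F = d" "\<zeta> \<subseteq> F" using sb F less.prems(4) by auto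
    have fz: "finite \<zeta>" using FK simplicial_complexD(3)[OF N(1)] finite_subset by blast
    have zK: "\<zeta> \<in> K" using less.prems(2) by (simp add: hub_def)
    have "\<zeta> \<noteq> F" using FK z by auto
    then obtain x0 where x0: "x0 \<in> F" "x0 \<notin> \<zeta>" using FK by blast
    have "insert x0 \<zeta> \<in> K" by (rule simplicial_complexD(4)[OF N(1) FK(1)]) (use x0 FK in auto)
    moreover have "w \<notin> \<zeta>" using w F FK by blast
    ultimately have "link_adj K \<zeta> x0 x0" "link_adj K \<zeta> w w"
      using less.prems(2) w x0 by (auto simp: link_adj_def hub_def)
    then have "(link_adj K \<zeta>)\<^sup>*\<^sup>* x0 w" using N(5)[OF zK z] by blast
    then obtain x y where xy: "link_adj K \<zeta> x y" "x \<in> \<Union>\<F>" "y \<notin> \<Union>\<F>"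
      using rtranclp_crossing[of _ x0 w "\<lambda>v. v \<in> \<Union>\<F>"] x0 F w by blast
    have x: "x \<notin> \<zeta>" "insert y (insert x \<zeta>) \<in> K" using xy(1) by (auto simp: link_adj_def insert_commute)
    have cx: "card (insert x \<zeta>) = card \<zeta> + 1" using x fz by simp
    have "\<exists>F\<in>\<F>. insert x \<zeta> \<subseteq> F" using xy(2) less.prems(4) by blast
    then obtain K' \<F>' \<G>' where c: "covers d (insert x \<zeta>) y K \<F> K' \<F>' \<G>'"
      and eq: "card \<zeta> + 2 = d \<longrightarrow> K' = K"
      using ex_covers[OF d less.prems(1,3), of "insert x \<zeta>" y] xy(3) x(2) cx z by auto
    note C = coversD[OF c]
    have N': "normal_pm d K'" using C(1) retriangulates_normal_pm by blast
    have K'S: "simplicial_complex K'" using normal_pmD(1)[OF N'] .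
    have all: "\<forall>F\<in>\<F>'. \<zeta> \<subseteq> F" using C(7) less.prems(4) by blast
    \<comment> \<open>A covered vertex shares a facet of the new ball with \<zeta>; the face of
      \<zeta> with an uncovered vertex does not contain \<open>x\<close> and hence survives.\<close>
    have hub: "hub K' \<zeta>" unfolding hub_def
    proof (intro conjI ballI)
      show "\<zeta> \<in> K'" using C(8)[OF zK] by blast
      fix v assume v: "v \<in> verts K' - \<zeta>"
      show "insert v \<zeta> \<in> K'"
      proof (cases "v \<in> \<Union>\<F>'")
        case True
        then obtain F' where "F' \<in> \<F>'" "v \<in> F'" by blast
        moreover from this have "F' \<in> K'" using stacked_ball_basic[OF C(2) K'S d0] by blast
        ultimately show ?thesis using all simplicial_complexD(4)[OF K'S, of F' "insert v \<zeta>"] by auto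
      next
        case False
        then have "v \<in> verts K - \<Union>\<F>" using v C(6) by blast
        moreover from this have "\<not> insert x \<zeta> \<subset> insert v \<zeta>" using x xy(2) by auto
        ultimately show ?thesis using C(8) less.prems(2) v unfolding hub_def by blast
      qed
    qed
    have "verts K' - \<Union>\<F>' \<subset> verts K - \<Union>\<F>"
    proof
      have "y \<in> verts K" using face_subset_verts[OF N(1) x(2)] by blast
      moreover have "y \<in> \<Union>\<F>'" using C(3) by blast
      ultimately show "verts K' - \<Union>\<F>' \<noteq> verts K - \<Union>\<F>" using xy(3) by blast
    qed (rule C(6))
    then have "card (verts K' - \<Union>\<F>') < card (verts K - \<Union>\<F>)"
      using finite_verts[OF N(1)] by (intro psubset_card_mono) auto
    from less.hyps[OF this N' hub C(2) all] obtain K'' \<F>'' \<G>'' where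
      K'': "retriangulates d K' K''" "stacked_ball K'' d \<F>'' \<G>''" "\<Union>\<F>'' = verts K''"
        "\<forall>F\<in>\<F>''. \<zeta> \<subseteq> F" "card \<zeta> + 2 = d \<longrightarrow> K'' = K'"
      by (elim exE conjE) (erule (4) that)
    have "retriangulates d K K''" by (rule retriangulates_trans[OF C(1) K''(1)])
    moreover have "card \<zeta> + 2 = d \<longrightarrow> K'' = K" using K''(5) eq by simp
    ultimately show ?thesis using K''(2-4) by (intro exI conjI)
  qed
qed

lemma hub_spanning_ball:
  fixes K :: "nat set set"
  assumes d: "2 \<le> d" and z: "card \<zeta> + 2 \<le> d" and K: "normal_pm d K" and h: "hub K \<zeta>"
  shows "\<exists>K' \<F>' \<G>'. retriangulates d K K' \<and> stacked_ball K' d \<F>' \<G>' \<and> \<Union>\<F>' = verts K' \<and>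
    (\<forall>F\<in>\<F>'. \<zeta> \<subseteq> F) \<and> (card \<zeta> + 2 = d \<longrightarrow> K' = K)"
proof -
  obtain F where F: "F \<in> K" "\<zeta> \<subseteq> F" "card F = d" using normal_pmD(2)[OF K] h unfolding hub_def by blast
  have "stacked_ball K d {F} {}" using stacked_ball.facet F by blast
  then show ?thesis using hub_extend_ball[OF d z K h, of "{F}" "{}"] F(2) by blast
qed

text \<open>A face \<zeta> \<union> {v} lies in a facet of the spanning ball and has at most
  \<open>d - 2\<close> vertices, so it is on the boundary and is coned. A face common to all facets
  thus becomes a hub with one vertex more.\<close>

lemma hub_cone_off:
  assumes K: "normal_pm d K" and b: "stacked_ball K d \<F> \<G>" "\<Union>\<F> = verts K" "\<forall>F\<in>\<F>. \<zeta> \<subseteq> F"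
    and z: "z \<notin> verts K" and c: "card \<zeta> + 3 \<le> d"
  shows "hub (cone_off K \<F> \<G> z) (insert z \<zeta>)" "z \<notin> \<zeta>" "finite \<zeta>"
proof -
  note N = normal_pmD[OF K]
  have d: "0 < d" "3 \<le> d" using c by auto
  note small = cone_off_small(2)[OF N(1) d(1) b(1) z]
  obtain F where F: "F \<in> \<F>" using stacked_ball_basic[OF b(1) N(1) d(1)] by blast
  have FK: "F \<in> K" using stacked_ball_basic[OF b(1) N(1) d(1)] F by blast
  have zF: "\<zeta> \<subseteq> F" using b(3) F by blast
  show zz: "z \<notin> \<zeta>" using zF face_subset_verts[OF N(1) FK] z by blast
  show fz: "finite \<zeta>" using zF simplicial_complexD(3)[OF N(1) FK] finite_subset by blast
  show "hub (cone_off K \<F> \<G> z) (insert z \<zeta>)" unfolding hub_def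
  proof (intro conjI ballI)
    show "insert z \<zeta> \<in> cone_off K \<F> \<G> z" using small[OF zz] c F zF by auto
    fix v assume v: "v \<in> verts (cone_off K \<F> \<G> z) - insert z \<zeta>"
    then have "v \<in> \<Union>\<F>" using verts_cone_off[OF N(1) d(2) b(1) z] b(2) by auto
    then obtain F' where "F' \<in> \<F>" "v \<in> F'" by blast
    moreover have "card (insert v \<zeta>) + 2 \<le> d" "z \<notin> insert v \<zeta>"
      using c fz v zz by (auto simp: card_insert_if)
    ultimately have "insert z (insert v \<zeta>) \<in> cone_off K \<F> \<G> z" using small[of "insert v \<zeta>"] b(3) by auto
    then show "insert v (insert z \<zeta>) \<in> cone_off K \<F> \<G> z" by (simp add: insert_commute)
  qed
qed

lemma ex_hub:
  fixes K :: "nat set set"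
  assumes d: "3 \<le> d" and K: "normal_pm d K" and k: "k + 2 \<le> d"
  shows "\<exists>K' :: nat set set. \<exists>\<zeta>. retriangulates d K K' \<and> hub K' \<zeta> \<and> card \<zeta> = k"
  using k
proof (induction k)
  case 0
  have "{} \<in> K" using simplicial_complexD(2)[OF normal_pmD(1)[OF K]] .
  then have "hub K {}" by (auto simp: hub_def verts_def)
  then show ?case using retriangulates_refl[OF K] card.empty by blast
next
  case (Suc k)
  then obtain K' :: "nat set set" and \<zeta> where K': "retriangulates d K K'" "hub K' \<zeta>" "card \<zeta> = k" by auto
  obtain K'' \<F> \<G> where K'': "retriangulates d K' K''" "stacked_ball K'' d \<F> \<G>" "\<Union>\<F> = verts K''"
    "\<forall>F\<in>\<F>. \<zeta> \<subseteq> F"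
    using hub_spanning_ball[OF _ _ retriangulates_normal_pm[OF K'(1)] K'(2)] d K'(3) Suc.prems by auto
  have N: "normal_pm d K''" using retriangulates_normal_pm[OF K''(1)] .
  obtain z where z: "z \<notin> verts K''" using ex_fresh_vertex[OF normal_pmD(1)[OF N]] by blast
  have "card \<zeta> + 3 \<le> d" using Suc.prems K'(3) by simp
  note h = hub_cone_off[OF N K''(2-4) z this]
  have "retriangulates d K'' (cone_off K'' \<F> \<G> z)"
    by (rule retriangulates_cone_off[OF N d K''(2) z])
  then have "retriangulates d K (cone_off K'' \<F> \<G> z)"
    using K'(1) K''(1) retriangulates_trans by blast
  moreover have "card (insert z \<zeta>) = Suc k" using h K'(3) by simp
  ultimately show ?case using h(1) by blast
qed

section \<open>Fans around faces of size \<open>d - 2\<close>, and the cycles that are the links of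
  such faces\<close>

fun fan :: "'a set \<Rightarrow> 'a list \<Rightarrow> 'a set set" where
  "fan S (a # b # cs) = insert (insert a (insert b S)) (fan S (b # cs))"
| "fan S _ = {}"

lemma fan_memD: "F \<in> fan S cs \<Longrightarrow> \<exists>a b. a \<in> set cs \<and> b \<in> set cs \<and> F = insert a (insert b S)"
  by (induction S cs rule: fan.induct) auto

lemma successively_fan: "successively (\<lambda>a b. insert a (insert b S) \<in> fan S cs) cs"
proof (induction S cs rule: fan.induct)
  case (1 S a b cs)
  have "successively (\<lambda>x y. insert x (insert y S) \<in> fan S (a # b # cs)) (b # cs)"
    using 1 by (rule successively_mono) simp
  then show ?case by simp
qed simp_all

lemma successively_conj:
  "successively P xs \<Longrightarrow> successively Q xs \<Longrightarrow> successively (\<lambda>a b. P a b \<and> Q a b) xs"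
  by (induction P xs rule: successively.induct) auto

lemma Union_fan: "\<Union>(fan S (a # b # cs)) = S \<union> set (a # b # cs)"
  by (induction cs arbitrary: a b) auto

text \<open>The fan is the join of \<open>S\<close> with a path of its link. Each new path vertex is
  glued on along the ridge formed by \<open>S\<close> and its predecessor; the last vertex has no
  successor, hence \<open>butlast\<close>.\<close>

lemma stacked_ball_extend_fan:
  assumes "stacked_ball K d \<F> \<G>" "F \<in> \<F>" "insert a S \<subseteq> F" "card S + 2 = d" "finite S"
    "successively (link_adj K S) (a # cs)" "a \<notin> S" "distinct cs" "set cs \<inter> \<Union>\<F> = {}"
  shows "stacked_ball K d (\<F> \<union> fan S (a # cs)) (\<G> \<union> (\<lambda>x. insert x S) ` set (butlast (a # cs))) \<and>
    \<Union>(\<F> \<union> fan S (a # cs)) = \<Union>\<F> \<union> set cs"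
  using assms(1-3,6-)
proof (induction cs arbitrary: a \<F> \<G> F)
  case Nil
  then show ?case by simp
next
  case (Cons c cs)
  note h = Cons.prems
  let ?F = "insert (insert c (insert a S)) \<F>"
  have l: "link_adj K S a c" using h(4) by simp
  have cS: "c \<notin> \<Union>\<F>" "c \<notin> S" using h(2,3,7) by auto
  have b: "stacked_ball K d ?F (insert (insert a S) \<G>)"
  proof (rule stacked_ball.attach[OF h(1,2,3) _ cS(1)])
    show "card (insert a S) + 1 = d" using assms(4,5) h(5) by simp
    show "insert c (insert a S) \<in> K" using l by (simp add: link_adj_def insert_commute)
  qed
  have U: "\<Union>?F = insert c (\<Union>\<F>)" using h(2,3) by auto
  have dj: "set cs \<inter> \<Union>?F = {}" unfolding U using h(6,7) by auto
  have s: "successively (link_adj K S) (c # cs)" using h(4) by simp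
  have m: "insert c (insert a S) \<in> ?F" "insert c S \<subseteq> insert c (insert a S)" "distinct cs" using h by auto
  note IH = Cons.IH[OF b m(1,2) s cS(2) m(3) dj]
  have E1: "?F \<union> fan S (c # cs) = \<F> \<union> fan S (a # c # cs)" by (simp add: insert_commute)
  have E2: "insert (insert a S) \<G> \<union> (\<lambda>x. insert x S) ` set (butlast (c # cs)) =
    \<G> \<union> (\<lambda>x. insert x S) ` set (butlast (a # c # cs))" by auto
  have "\<Union>?F \<union> set cs = \<Union>\<F> \<union> set (c # cs)" unfolding U by auto
  then show ?case using IH unfolding E1 E2 by (simp only:)
qed

text \<open>The ridges of \<open>S\<close> with the two ends of the path stay on the boundary; only
  inner path vertices give gluing ridges.\<close>

lemma stacked_ball_fan:
  assumes "successively (link_adj K S) (a # b # cs)" "distinct (a # b # cs)" "card S + 2 = d" "finite S"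
  shows "stacked_ball K d (fan S (a # b # cs)) ((\<lambda>x. insert x S) ` set (butlast (b # cs)))"
proof -
  have l: "link_adj K S a b" using assms(1) by simp
  then have o: "a \<notin> S" "b \<notin> S" "insert a (insert b S) \<in> K" by (auto simp: link_adj_def)
  have "card (insert a (insert b S)) = d" using o assms(2-4) by simp
  then have f: "stacked_ball K d {insert a (insert b S)} {}" using stacked_ball.facet o(3) by blast
  have "set cs \<inter> S = {}"
  proof (cases "cs = []")
    case False
    have "successively (link_adj K S) (b # cs)" using assms(1) by simp
    then show ?thesis
    proof (induction cs arbitrary: b)
      case (Cons c cs) then show ?case by (auto simp: link_adj_def)
    qed simp
  qed simp
  then have dj: "set cs \<inter> \<Union>{insert a (insert b S)} = {}" using assms(2) by auto
  have "stacked_ball K d ({insert a (insert b S)} \<union> fan S (b # cs)) ({} \<union> (\<lambda>x. insert x S) ` set (butlast (b # cs)))"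
    by (rule stacked_ball_extend_fan[THEN conjunct1, OF f _ _ assms(3,4) _ o(2) _ dj]) (use assms in auto)
  then show ?thesis by simp
qed

text \<open>Every vertex of this connected link graph has two neighbours. A longest path starting
  with \<open>a\<close>, \<open>b\<close> cannot be prolonged, so the second neighbour of its last
  vertex is on the path; inner vertices have used up both neighbours, so it is \<open>a\<close>. The
  path is then closed under adjacency and contains the whole link. The first edge is prescribed so
  that a chosen facet belongs to the fan.\<close>

lemma link_cycle:
  assumes K: "normal_pm d K" and S: "card S + 2 = d" "finite S" and ab: "link_adj K S a b" "a \<noteq> b"
  shows "\<exists>cs. distinct (a # b # cs) \<and> successively (link_adj K S) (a # b # cs) \<and>
    set (a # b # cs) = {v. link_adj K S v v}"
proof -
  note N = normal_pmD[OF K]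
  define good where "good c \<longleftrightarrow> (\<exists>cs. c = a # b # cs) \<and> distinct c \<and> successively (link_adj K S) c" for c
  define nb where "nb v = {u. u \<noteq> v \<and> link_adj K S v u}" for v
  have good0: "good [a, b]" using ab by (simp add: good_def)
  have good_verts: "set c \<subseteq> verts K" if g: "good c" for c
  proof -
    obtain cs where cs: "c = a # b # cs" using g unfolding good_def by blast
    then have "successively (link_adj K S) (a # b # cs)" using g by (simp add: good_def)
    from link_path_verts[OF N(1) this] show ?thesis using cs by simp
  qed
  have bound: "\<forall>c. good c \<longrightarrow> length c < Suc (card (verts K))"
  proof (intro allI impI)
    fix c assume "good c"
    then have "length c = card (set c)" by (simp add: good_def distinct_card)
    also have "\<dots> \<le> card (verts K)"
      by (rule card_mono[OF finite_verts[OF N(1)] good_verts[OF \<open>good c\<close>]])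
    finally show "length c < Suc (card (verts K))" by simp
  qed
  obtain c where c: "good c" and max: "\<And>c'. good c' \<Longrightarrow> length c' \<le> length c"
    using ex_has_greatest_nat[of good "[a, b]" length, OF good0 bound] by blast
  obtain cs where cs: "c = a # b # cs" using c unfolding good_def by blast
  define n where "n = length c"
  have n2: "2 \<le> n" using cs n_def by simp
  have dc: "distinct c" using c by (simp add: good_def)
  have step: "link_adj K S (c ! i) (c ! Suc i)" if "Suc i < n" for i
    using c that unfolding good_def n_def by (simp add: successively_conv_nth)
  have ne: "c ! i = c ! j \<longleftrightarrow> i = j" if "i < n" "j < n" for i j
    using dc that n_def by (simp add: nth_eq_iff_index_eq)
  have vert: "link_adj K S (c ! i) (c ! i)" if "i < n" for i
  proof (cases "Suc i < n")
    case True then show ?thesis using link_adj_refl[OF N(1)] step by blast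
  next
    case False
    then have "link_adj K S (c ! (i - 1)) (c ! i)" using step[of "i - 1"] that n2 by (cases i) auto
    then show ?thesis using link_adj_refl[OF N(1)] link_adj_commute by metis
  qed
  have two: "card (nb v) = 2" if "link_adj K S v v" for v
  proof -
    have v: "v \<notin> S" "insert v S \<in> K" using that by (auto simp: link_adj_def)
    have "nb v = {u. u \<notin> insert v S \<and> insert u (insert v S) \<in> K}"
      using v by (auto simp: nb_def link_adj_def insert_commute)
    then show ?thesis using N(4)[OF v(2)] S v by simp
  qed
  have nb2: "nb v = {x, y}" if "link_adj K S v v" "x \<in> nb v" "y \<in> nb v" "x \<noteq> y" for v x y
    using card_subset_eq[of "nb v" "{x, y}"] two[OF that(1)] finite_card_two[OF two[OF that(1)]] that by auto
  have inner: "nb (c ! i) = {c ! (i - 1), c ! Suc i}" if i: "0 < i" "Suc i < n" for i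
  proof (rule nb2)
    show "link_adj K S (c ! i) (c ! i)" using vert i by simp
    show "c ! Suc i \<in> nb (c ! i)" using step[OF i(2)] ne[of "Suc i" i] i by (auto simp: nb_def)
    show "c ! (i - 1) \<in> nb (c ! i)"
      using step[of "i - 1"] ne[of "i - 1" i] i by (auto simp: nb_def intro: link_adj_commute[THEN iffD1])
    show "c ! (i - 1) \<noteq> c ! Suc i" using ne i by simp
  qed
  let ?l = "c ! (n - 1)"
  have pl: "c ! (n - 2) \<in> nb ?l"
  proof -
    have "Suc (n - 2) = n - 1" using n2 by simp
    then have "link_adj K S (c ! (n - 2)) ?l" using step[of "n - 2"] n2 by simp
    then show ?thesis using ne[of "n - 2" "n - 1"] n2
      by (auto simp: nb_def intro: link_adj_commute[THEN iffD1])
  qed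
  have ll: "link_adj K S ?l ?l" using vert n2 by simp
  obtain e where e: "e \<in> nb ?l" "e \<noteq> c ! (n - 2)"
    using two[OF ll] by (metis card_2_iff insertI1 insert_commute)
  have "e \<in> set c"
  proof (rule ccontr)
    assume "e \<notin> set c"
    moreover have "c \<noteq> []" using cs by simp
    then have "last c = ?l" by (simp add: last_conv_nth n_def)
    then have "link_adj K S (last c) e" using e(1) by (simp add: nb_def)
    ultimately have "successively (link_adj K S) (c @ [e])" "distinct (c @ [e])"
      using c unfolding good_def by (simp_all add: successively_append_iff)
    then have "good (c @ [e])" using cs by (simp add: good_def)
    from max[OF this] show False by simp
  qed
  then obtain j where j: "j < n" "e = c ! j" using n_def by (auto simp: in_set_conv_nth)
  have jn: "j \<noteq> n - 1" "j \<noteq> n - 2" using e j by (auto simp: nb_def)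
  have j0: "j = 0"
  proof (rule ccontr)
    assume "j \<noteq> 0"
    then have jj: "0 < j" "Suc j < n" using j jn by auto
    have "?l \<in> nb (c ! j)" using e(1) j(2) by (auto simp: nb_def intro: link_adj_commute[THEN iffD1])
    then have "?l = c ! (j - 1) \<or> ?l = c ! Suc j" using inner[OF jj] by auto
    then show False using ne[of "n - 1" "j - 1"] ne[of "n - 1" "Suc j"] jj jn j by auto
  qed
  have closed: "u \<in> set c" if v: "v \<in> set c" "link_adj K S v u" for v u
  proof -
    obtain i where i: "i < n" "v = c ! i" using v n_def by (auto simp: in_set_conv_nth)
    have mem: "c ! k \<in> set c" if "k < n" for k using that n_def by simp
    show ?thesis
    proof (cases "u = v")
      case True then show ?thesis using v by simp
    next
      case False
      then have u: "u \<in> nb (c ! i)" using v i by (simp add: nb_def)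
      consider "i = 0" | "0 < i" "Suc i < n" | "i = n - 1" using i by linarith
      then show ?thesis
      proof cases
        case 1
        have "nb (c ! 0) = {c ! 1, ?l}"
        proof (rule nb2)
          show "link_adj K S (c ! 0) (c ! 0)" using vert n2 by simp
          show "c ! 1 \<in> nb (c ! 0)" using step[of 0] ne[of 1 0] n2 by (auto simp: nb_def)
          show "?l \<in> nb (c ! 0)" using e(1) j(2) j0 by (auto simp: nb_def intro: link_adj_commute[THEN iffD1])
          show "c ! 1 \<noteq> ?l" using ne[of 1 "n - 1"] jn j0 n2 by auto
        qed
        then show ?thesis using u 1 mem n2 by auto
      next
        case 2
        then show ?thesis using u inner mem by auto
      next
        case 3
        have "nb ?l = {c ! (n - 2), e}" by (rule nb2[OF ll pl e(1)]) (use e in simp)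
        then show ?thesis using u 3 mem n2 j by auto
      qed
    qed
  qed
  have "set c = {v. link_adj K S v v}"
  proof
    show "set c \<subseteq> {v. link_adj K S v v}" using vert n_def by (auto simp: in_set_conv_nth)
    show "{v. link_adj K S v v} \<subseteq> set c"
    proof
      fix v assume "v \<in> {v. link_adj K S v v}"
      then have vv: "link_adj K S v v" by simp
      have SK: "S \<in> K" using vv simplicial_complexD(4)[OF N(1), of "insert v S" S] by (auto simp: link_adj_def)
      have "link_adj K S a a" using link_adj_refl[OF N(1) ab(1)] .
      then have "(link_adj K S)\<^sup>*\<^sup>* a v" using N(5)[OF SK] S vv by simp
      then show "v \<in> set c"
      proof (induction rule: rtranclp_induct)
        case base show ?case using cs by simp
      next
        case (step y z) then show ?case using closed by blast
      qed
    qed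
  qed
  then show ?thesis using c cs unfolding good_def by blast
qed

section \<open>Joining a pair of vertices\<close>

definition nonedges :: "'a set set \<Rightarrow> 'a set set" where
  "nonedges K = {e. card e = 2 \<and> e \<subseteq> verts K \<and> e \<notin> K}"

lemma finite_nonedges: "simplicial_complex K \<Longrightarrow> finite (nonedges K)"
  by (rule finite_subset[of _ "Pow (verts K)"]) (auto simp: nonedges_def finite_verts)

lemma cone_off_old: "\<sigma> \<in> K \<Longrightarrow> \<sigma> \<notin> \<F> \<Longrightarrow> \<sigma> \<notin> \<G> \<Longrightarrow> \<sigma> \<in> cone_off K \<F> \<G> z"
  by (simp add: cone_off_def)

lemma cone_off_new: "F \<in> \<F> \<Longrightarrow> \<tau> \<subseteq> F \<Longrightarrow> \<tau> \<notin> \<F> \<Longrightarrow> \<tau> \<notin> \<G> \<Longrightarrow> insert z \<tau> \<in> cone_off K \<F> \<G> z"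
  unfolding cone_off_def by blast

text \<open>No edge is lost and the apex is joined to all vertices, so cones over spanning balls do
  not affect the induction measure.\<close>

lemma nonedges_cone_off:
  assumes "simplicial_complex K" "4 \<le> d" "stacked_ball K d \<F> \<G>" "z \<notin> verts K" "\<Union>\<F> = verts K"
  shows "nonedges (cone_off K \<F> \<G> z) = nonedges K"
proof -
  let ?C = "cone_off K \<F> \<G> z"
  have V: "verts ?C = insert z (verts K)" by (rule verts_cone_off) (use assms in auto)
  have "e \<in> nonedges ?C \<longleftrightarrow> e \<in> nonedges K" for e
  proof (cases "card e = 2")
    case True
    then obtain a b where e: "e = {a, b}" "a \<noteq> b" by (meson card_2_iff)
    consider "a \<noteq> z" "b \<noteq> z" | "a = z" "b \<noteq> z" | "b = z" "a \<noteq> z" using e by blast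
    then show ?thesis
    proof cases
      case 1
      then have "e \<in> ?C \<longleftrightarrow> e \<in> K" using cone_off_edges(1)[OF assms(1-4)] e by simp
      moreover have "e \<subseteq> verts ?C \<longleftrightarrow> e \<subseteq> verts K" using 1 e V by auto
      ultimately show ?thesis by (simp add: nonedges_def)
    next
      case 2
      then have "e \<in> ?C \<longleftrightarrow> b \<in> verts K" using cone_off_edges(2)[OF assms(1-4), of b] e assms(5) by simp
      then show ?thesis using 2 e V assms(4) by (auto simp: nonedges_def)
    next
      case 3
      then have "e \<in> ?C \<longleftrightarrow> a \<in> verts K"
        using cone_off_edges(2)[OF assms(1-4), of a] e assms(5) by (simp add: insert_commute)
      then show ?thesis using 3 e V assms(4) by (auto simp: nonedges_def)
    qed
  qed (simp add: nonedges_def)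
  then show ?thesis by blast
qed

text \<open>No edge contains a set \<open>R\<close> of three or more vertices, so the flip gains the
  edge \<open>u w\<close> and loses none.\<close>

lemma nonedges_flip:
  assumes f: "flippable d K R u w" and R: "3 \<le> card R"
  shows "nonedges (flip K R u w) \<subseteq> nonedges K - {{u, w}}"
proof -
  interpret flippable d K R u w by (rule f)
  have fR: "\<not> R \<subseteq> e" if "card e = 2" for e
  proof
    assume "R \<subseteq> e"
    moreover have "finite e" using that card_gt_0_iff[of e] by simp
    ultimately have "card R \<le> card e" by (rule card_mono[rotated])
    then show False using R that by simp
  qed
  have V: "verts L \<subseteq> verts K"
    using uw by (auto simp: verts_def flip_iff)
  have "{u, w} \<in> L" using R by (auto simp: flip_iff)
  moreover have "e \<notin> K" if "card e = 2" "e \<notin> L" for e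
  proof
    assume e: "e \<in> K"
    then have "e \<in> L" using fR[OF that(1)] no_uw[OF e] e unfolding flip_iff by auto
    then show False using that(2) by simp
  qed
  ultimately show ?thesis using V unfolding nonedges_def by blast
qed

text \<open>Joining a pair \<open>p\<close>, \<open>q\<close>. After two cones over a fan around the hub \<open>{r, r'} \<union> Q\<close>, with apexes
  \<open>z\<close> and \<open>y\<close>, the same path \<open>c\<close> lies in the links of \<open>{z, y} \<union> Q\<close>, \<open>{z, r} \<union> Q\<close> and \<open>{y, r'} \<union> Q\<close>.
  The first fan, restricted to the part of \<open>c\<close> between \<open>q\<close> and \<open>p\<close>, and the second one, which reaches
  the other vertices, form a ball; in the cone over its boundary, with apex \<open>x\<close>, the ridge
  \<open>{x, z, y} \<union> Q\<close> can be flipped to the edge \<open>p q\<close>. The third fan is left intact and yields the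
  next hub.\<close>

locale joining =
  fixes K :: "nat set set" and d :: nat and Q :: "nat set" and r r' p q b :: nat
    and xs ys :: "nat list" and z y x w :: nat
  assumes K: "normal_pm d K" and d: "4 \<le> d" and Q: "finite Q" "card Q + 4 = d"
    and rQ: "r \<notin> Q" "r' \<notin> Q" "r \<noteq> r'"
    and hub: "hub K (insert r (insert r' Q))"
    and c: "distinct (q # b # xs @ p # ys)"
      "successively (link_adj K (insert r (insert r' Q))) (q # b # xs @ p # ys)"
      "set (q # b # xs @ p # ys) = verts K - insert r (insert r' Q)"
    and pq: "{p, q} \<notin> K"
    and new: "z \<notin> verts K" "y \<notin> verts K" "x \<notin> verts K" "w \<notin> verts K" "distinct [z, y, x, w]"
begin

abbreviation "Z \<equiv> insert r (insert r' Q)"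
abbreviation "c \<equiv> q # b # xs @ p # ys"

lemma SK: "simplicial_complex K" using normal_pmD(1)[OF K] .

lemma d3: "3 \<le> d" "0 < d" using d by auto

lemma ZV: "Z \<subseteq> verts K" using hub face_subset_verts[OF SK] unfolding hub_def by blast

lemma V: "verts K = Z \<union> set c" using c(3) ZV by blast

lemma cZ: "set c \<inter> Z = {}" using c(3) by blast

lemma fresh: "z \<notin> Z" "y \<notin> Z" "x \<notin> Z" "w \<notin> Z" "z \<notin> set c" "y \<notin> set c" "x \<notin> set c" "w \<notin> set c"
    "z \<noteq> y" "z \<noteq> x" "z \<noteq> w" "y \<noteq> x" "y \<noteq> w" "x \<noteq> w"
  using new unfolding V by auto

lemma path_vertex:
  assumes "v \<in> set c"
  shows "v \<notin> Q" "v \<noteq> r" "v \<noteq> r'" "v \<noteq> z" "v \<noteq> y" "v \<noteq> x" "v \<noteq> w"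
proof -
  have "v \<notin> Z" using assms cZ by blast
  then show "v \<notin> Q" "v \<noteq> r" "v \<noteq> r'" by blast+
  show "v \<noteq> z" "v \<noteq> y" "v \<noteq> x" "v \<noteq> w" using assms fresh(5-8) by blast+
qed

lemma path_mem: "q \<in> set c" "b \<in> set c" "p \<in> set c" by simp_all

lemmas path_vertices = path_vertex[OF path_mem(1)] path_vertex[OF path_mem(2)] path_vertex[OF path_mem(3)]

lemma apexes: "z \<notin> Q" "z \<noteq> r" "z \<noteq> r'" "y \<notin> Q" "y \<noteq> r" "y \<noteq> r'" "x \<notin> Q" "x \<noteq> r" "x \<noteq> r'"
    "w \<notin> Q" "w \<noteq> r" "w \<noteq> r'" "z \<noteq> y" "z \<noteq> x" "z \<noteq> w" "y \<noteq> x" "y \<noteq> w" "x \<noteq> w"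
  using fresh(1-4,9-) by blast+

lemma cardZ: "card Z + 2 = d" using Q rQ by simp

section \<open>First cone: apex \<open>z\<close> over the fan around \<open>Z\<close>\<close>

definition "F\<^sub>1 = fan Z c"
definition "G\<^sub>1 = (\<lambda>v. insert v Z) ` set (butlast (b # xs @ p # ys))"
definition "K\<^sub>1 = cone_off K F\<^sub>1 G\<^sub>1 z"

lemma ball1: "stacked_ball K d F\<^sub>1 G\<^sub>1"
  unfolding F\<^sub>1_def G\<^sub>1_def by (rule stacked_ball_fan[OF c(2,1) cardZ]) (use Q in simp)

lemma U1: "\<Union>F\<^sub>1 = verts K" unfolding F\<^sub>1_def Union_fan V ..

lemma FG1: "\<sigma> \<in> F\<^sub>1 \<or> \<sigma> \<in> G\<^sub>1 \<Longrightarrow> Z \<subseteq> \<sigma>"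
  unfolding F\<^sub>1_def G\<^sub>1_def by (auto dest!: fan_memD)

lemma G1: "\<sigma> \<in> G\<^sub>1 \<Longrightarrow> \<exists>v\<in>set (butlast (b # xs @ p # ys)). \<sigma> = insert v Z"
  unfolding G\<^sub>1_def by auto

lemma K1: "retriangulates d K K\<^sub>1" unfolding K\<^sub>1_def by (rule retriangulates_cone_off[OF K d3(1) ball1 new(1)])

lemma N1: "normal_pm d K\<^sub>1" using retriangulates_normal_pm[OF K1] .

lemma S1: "simplicial_complex K\<^sub>1" using normal_pmD(1)[OF N1] .

lemma V1: "verts K\<^sub>1 = insert z (verts K)" unfolding K\<^sub>1_def by (rule verts_cone_off[OF SK d3(1) ball1 new(1)])

lemma E1: "nonedges K\<^sub>1 = nonedges K"
  unfolding K\<^sub>1_def by (rule nonedges_cone_off[OF SK d ball1 new(1) U1])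

lemma card_facets1: "\<sigma> \<in> F\<^sub>1 \<Longrightarrow> card \<sigma> = d"
  using stacked_ball_basic[OF ball1 SK d3(2)] by blast

text \<open>The vertex \<open>v\<close> is one of the two ends of \<open>c\<close>, and the ridge
  \<open>Z \<union> {v}\<close> is on the boundary of the fan. In the links of
  \<open>{z, r} \<union> Q\<close> and \<open>{z, r'} \<union> Q\<close> these ridges close the path
  \<open>c\<close> to a cycle.\<close>

lemma end1:
  assumes "v \<in> set c" "v \<notin> set (butlast (b # xs @ p # ys))"
  shows "insert z (insert v Z) \<in> K\<^sub>1"
proof -
  have "v \<in> \<Union>F\<^sub>1" using assms(1) U1 V by auto
  then obtain F where F: "F \<in> F\<^sub>1" "v \<in> F" by blast
  have "insert v Z \<subseteq> F" using F FG1 by blast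
  moreover have "insert v Z \<notin> F\<^sub>1"
  proof
    assume "insert v Z \<in> F\<^sub>1"
    then have "card (insert v Z) = d" by (rule card_facets1)
    then show False using cardZ card_insert_le_m1[of 0] by (metis Q(1) add_2_eq_Suc' card_insert_if finite_insert n_not_Suc_n not_less_eq_eq le_refl nat_le_linear)
  qed
  moreover have "insert v Z \<notin> G\<^sub>1"
  proof
    assume "insert v Z \<in> G\<^sub>1"
    then obtain v' where v': "v' \<in> set (butlast (b # xs @ p # ys))" "insert v Z = insert v' Z" using G1 by blast
    have "v \<notin> Z" using assms(1) cZ by blast
    then have "v = v'" using v'(2) by (metis insert_iff insertI1 in_set_butlastD v'(1) cZ disjoint_iff list.set_intros(2))
    then show False using v' assms by simp
  qed
  ultimately show ?thesis unfolding K\<^sub>1_def using cone_off_new[OF F(1)] by blast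
qed

lemma steps1: "successively (\<lambda>e f. insert e (insert f Z) \<in> F\<^sub>1 \<and> link_adj K Z e f) c"
  unfolding F\<^sub>1_def by (rule successively_conj[OF successively_fan c(2)])

text \<open>All interior faces of the fan contain \<open>Z\<close>; a face that omits a vertex of
  \<open>Z\<close> is on the boundary.\<close>

lemma cone1:
  assumes "insert e (insert f Z) \<in> F\<^sub>1" "S \<subseteq> Z" "\<not> Z \<subseteq> S" "e \<notin> Z" "f \<notin> Z"
  shows "insert z (insert e (insert f S)) \<in> K\<^sub>1"
proof -
  have "insert e (insert f S) \<notin> F\<^sub>1" "insert e (insert f S) \<notin> G\<^sub>1" using FG1[of "insert e (insert f S)"] assms by blast+
  moreover have "insert e (insert f S) \<subseteq> insert e (insert f Z)" using assms(2) by blast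
  ultimately show ?thesis unfolding K\<^sub>1_def by (intro cone_off_new[OF assms(1)])
qed

lemma adj1:
  assumes "v \<in> {r, r'}"
  shows "successively (link_adj K\<^sub>1 (insert z (insert v Q))) c"
proof (rule successively_mono[OF steps1])
  fix e f assume "insert e (insert f Z) \<in> F\<^sub>1 \<and> link_adj K Z e f"
  then have h: "insert e (insert f Z) \<in> F\<^sub>1" "e \<notin> Z" "f \<notin> Z" "e \<in> verts K" "f \<in> verts K"
    using face_subset_verts[OF SK] by (auto simp: link_adj_def)
  have "insert z (insert e (insert f (insert v Q))) \<in> K\<^sub>1"
    by (rule cone1) (use h assms rQ in auto)
  then show "link_adj K\<^sub>1 (insert z (insert v Q)) e f"
    using h assms new(1) by (auto simp: link_adj_def insert_commute)
qed

section \<open>Second cone: apex \<open>y\<close> over a fan around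
  \<open>{z, r'} \<union> Q\<close>\<close>

abbreviation "S\<^sub>2 \<equiv> insert z (insert r' Q)"
text \<open>Of the link cycle only the edge between \<open>r\<close> and the last vertex of
  \<open>c\<close> is left out. The facet over this edge survives and is used in
  \<open>side_end2\<close>.\<close>

definition "F\<^sub>2 = fan S\<^sub>2 (r # c)"
definition "G\<^sub>2 = (\<lambda>v. insert v S\<^sub>2) ` set (butlast c)"
definition "K\<^sub>2 = cone_off K\<^sub>1 F\<^sub>2 G\<^sub>2 y"

lemma card_S2: "card S\<^sub>2 + 2 = d" "finite S\<^sub>2" using Q rQ fresh by auto

lemma ball2: "stacked_ball K\<^sub>1 d F\<^sub>2 G\<^sub>2"
  unfolding F\<^sub>2_def G\<^sub>2_def
proof (rule stacked_ball_fan[OF _ _ card_S2])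
  have "insert z (insert q Z) \<in> K\<^sub>1" by (rule end1) (use c(1) in \<open>auto dest: in_set_butlastD\<close>)
  then have "link_adj K\<^sub>1 S\<^sub>2 r q"
    using cZ fresh rQ by (auto simp: link_adj_def insert_commute)
  then show "successively (link_adj K\<^sub>1 S\<^sub>2) (r # c)" using adj1[of r'] by simp
  show "distinct (r # c)" using c(1) cZ by auto
qed

lemma U2: "\<Union>F\<^sub>2 = verts K\<^sub>1" unfolding F\<^sub>2_def Union_fan V1 V by auto

lemma FG2: "\<sigma> \<in> F\<^sub>2 \<or> \<sigma> \<in> G\<^sub>2 \<Longrightarrow> S\<^sub>2 \<subseteq> \<sigma>"
proof -
  assume "\<sigma> \<in> F\<^sub>2 \<or> \<sigma> \<in> G\<^sub>2"
  then show "S\<^sub>2 \<subseteq> \<sigma>"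
  proof
    assume "\<sigma> \<in> F\<^sub>2"
    then obtain e f where "\<sigma> = insert e (insert f S\<^sub>2)" unfolding F\<^sub>2_def using fan_memD by blast
    then show ?thesis by blast
  next
    assume "\<sigma> \<in> G\<^sub>2"
    then show ?thesis unfolding G\<^sub>2_def by blast
  qed
qed

lemma y1: "y \<notin> verts K\<^sub>1" using V1 new fresh by auto

lemma K2: "retriangulates d K\<^sub>1 K\<^sub>2" unfolding K\<^sub>2_def by (rule retriangulates_cone_off[OF N1 d3(1) ball2 y1])

lemma N2: "normal_pm d K\<^sub>2" using retriangulates_normal_pm[OF K2] .

lemma S2: "simplicial_complex K\<^sub>2" using normal_pmD(1)[OF N2] .

lemma V2: "verts K\<^sub>2 = insert y (insert z (verts K))"
  unfolding K\<^sub>2_def verts_cone_off[OF S1 d3(1) ball2 y1] V1 ..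

lemma E2: "nonedges K\<^sub>2 = nonedges K"
  unfolding K\<^sub>2_def nonedges_cone_off[OF S1 d ball2 y1 U2] by (rule E1)

text \<open>The spare hub: the face \<open>{r'} \<union> Q\<close> is common to all facets of the
  second fan. The third ball is arranged to avoid the faces over this hub.\<close>

lemma hub2: "hub K\<^sub>2 (insert y (insert r' Q))"
  unfolding K\<^sub>2_def
proof (rule hub_cone_off(1)[OF N1 ball2 U2 _ y1])
  show "\<forall>F\<in>F\<^sub>2. insert r' Q \<subseteq> F"
  proof
    fix F assume "F \<in> F\<^sub>2"
    then have "S\<^sub>2 \<subseteq> F" using FG2 by simp
    then show "insert r' Q \<subseteq> F" by simp
  qed
  show "card (insert r' Q) + 3 \<le> d" using Q rQ by simp
qed

lemma steps2: "successively (\<lambda>e f. insert e (insert f S\<^sub>2) \<in> F\<^sub>2 \<and> link_adj K\<^sub>1 S\<^sub>2 e f) c"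
proof -
  have "successively (\<lambda>e f. insert e (insert f S\<^sub>2) \<in> F\<^sub>2) (r # c)"
    unfolding F\<^sub>2_def by (rule successively_fan)
  then have "successively (\<lambda>e f. insert e (insert f S\<^sub>2) \<in> F\<^sub>2) c" by simp
  then show ?thesis by (rule successively_conj[OF _ adj1]) simp
qed

lemma cone2:
  assumes "insert e (insert f S\<^sub>2) \<in> F\<^sub>2" "S \<subseteq> S\<^sub>2" "\<not> S\<^sub>2 \<subseteq> S" "e \<notin> S\<^sub>2" "f \<notin> S\<^sub>2"
  shows "insert y (insert e (insert f S)) \<in> K\<^sub>2"
proof -
  have "insert e (insert f S) \<notin> F\<^sub>2" "insert e (insert f S) \<notin> G\<^sub>2" using FG2[of "insert e (insert f S)"] assms by blast+
  moreover have "insert e (insert f S) \<subseteq> insert e (insert f S\<^sub>2)" using assms(2) by blast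
  ultimately show ?thesis unfolding K\<^sub>2_def by (intro cone_off_new[OF assms(1)])
qed

abbreviation "M \<equiv> insert z (insert y Q)"
abbreviation "D \<equiv> insert z (insert r Q)"

lemma main2: "successively (link_adj K\<^sub>2 M) c"
proof (rule successively_mono[OF steps2])
  fix e f assume "insert e (insert f S\<^sub>2) \<in> F\<^sub>2 \<and> link_adj K\<^sub>1 S\<^sub>2 e f"
  then have h: "insert e (insert f S\<^sub>2) \<in> F\<^sub>2" "e \<notin> S\<^sub>2" "f \<notin> S\<^sub>2" "e \<in> verts K\<^sub>1" "f \<in> verts K\<^sub>1"
    using face_subset_verts[OF S1] by (auto simp: link_adj_def)
  have "insert y (insert e (insert f (insert z Q))) \<in> K\<^sub>2"
    by (rule cone2) (use h rQ fresh in auto)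
  then show "link_adj K\<^sub>2 M e f"
    using h y1 by (auto simp: link_adj_def insert_commute)
qed

text \<open>The second cone removes only faces that contain \<open>r'\<close>, so the path around
  \<open>{z, r} \<union> Q\<close> is untouched.\<close>

lemma side2: "successively (link_adj K\<^sub>2 D) c"
proof (rule successively_mono[OF adj1[of r]])
  fix e f assume ef: "e \<in> set c" "f \<in> set c" "link_adj K\<^sub>1 D e f"
  then have "r' \<notin> insert e (insert f D)" using cZ rQ fresh by auto
  then have "insert e (insert f D) \<notin> F\<^sub>2" "insert e (insert f D) \<notin> G\<^sub>2" using FG2 by blast+
  then show "link_adj K\<^sub>2 D e f" using ef(3) unfolding link_adj_def K\<^sub>2_def by (simp add: cone_off_old)
qed simp

lemma last_c: "last c \<in> set c" "last c \<noteq> q" "last c \<notin> set (butlast (b # xs @ p # ys))"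
proof -
  have l: "last c = last (b # xs @ p # ys)" by simp
  have "butlast (b # xs @ p # ys) @ [last (b # xs @ p # ys)] = b # xs @ p # ys"
    by (rule append_butlast_last_id) simp
  moreover have "distinct (b # xs @ p # ys)" using c(1) by simp
  ultimately have "distinct (butlast (b # xs @ p # ys) @ [last (b # xs @ p # ys)])" by (simp only:)
  then show "last c \<notin> set (butlast (b # xs @ p # ys))" unfolding l by simp
  show "last c \<in> set c" by (rule last_in_set) simp
  have "last (b # xs @ p # ys) \<in> set (b # xs @ p # ys)" by (rule last_in_set) simp
  then show "last c \<noteq> q" using c(1) unfolding l by auto
qed

text \<open>This is the facet over the cycle edge that the second fan leaves out; it continues the
  path around \<open>D\<close> to \<open>r'\<close>.\<close>

lemma side_end2: "link_adj K\<^sub>2 D (last c) r'"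
proof -
  obtain l where l_def: "l = last c" by blast
  note lc = last_c[folded l_def]
  let ?T = "insert z (insert l Z)"
  have l: "l \<notin> Z" "l \<noteq> z" using lc(1) cZ fresh(5) by blast+
  have T1: "?T \<in> K\<^sub>1" using end1[OF lc(1,3)] .
  have cT: "card ?T = d" using l fresh Q cardZ by simp
  have "?T \<notin> G\<^sub>2"
  proof
    assume "?T \<in> G\<^sub>2"
    then have "card ?T + 1 = d" using stacked_ball_basic[OF ball2 S1 d3(2)] by blast
    then show False using cT by simp
  qed
  moreover have "?T \<notin> F\<^sub>2"
  proof
    assume "?T \<in> F\<^sub>2"
    then consider "?T = insert r (insert q S\<^sub>2)" | "?T \<in> fan S\<^sub>2 c" unfolding F\<^sub>2_def by auto
    then show False
    proof cases
      case 1
      then have "l \<in> insert r (insert q S\<^sub>2)" by (metis insertI1 insertI2)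
      then show False using l lc(2) by auto
    next
      case 2
      then obtain e f where "e \<in> set c" "f \<in> set c" "?T = insert e (insert f S\<^sub>2)" using fan_memD by blast
      moreover have "r \<in> ?T" by simp
      ultimately show False using cZ fresh rQ by auto
    qed
  qed
  ultimately have "?T \<in> K\<^sub>2" unfolding K\<^sub>2_def using T1 by (simp add: cone_off_old)
  moreover have "insert l (insert r' D) = ?T" by auto
  ultimately show ?thesis unfolding l_def[symmetric] using l fresh rQ by (auto simp: link_adj_def)
qed

text \<open>Puts the edge \<open>q b\<close> into the link of the spare hub, where the final link
  cycle starts.\<close>

lemma spare2: "insert y (insert q (insert b (insert r' Q))) \<in> K\<^sub>2"
proof (rule cone2)
  show "insert q (insert b S\<^sub>2) \<in> F\<^sub>2" using steps2 by simp
qed (use cZ fresh rQ in auto)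

section \<open>Third ball, and its cone with apex \<open>x\<close>\<close>

definition "s = last (b # xs)"
abbreviation "\<rho> \<equiv> insert z (insert s (insert p Q))"
text \<open>The fan around \<open>M\<close> stops at \<open>p\<close>, so that
  \<open>M \<union> {q}\<close> and \<open>M \<union> {p}\<close> are boundary ridges. The facet
  \<open>{r} \<union> \<rho>\<close> passes from \<open>M\<close> to \<open>D\<close> by exchanging
  \<open>y\<close> for \<open>r\<close> over the edge \<open>s p\<close>; the fan around
  \<open>D\<close> then collects the rest of \<open>c\<close> and \<open>r'\<close>.\<close>

definition "F\<^sub>3 = insert (insert r \<rho>) (fan M (q # b # xs @ [p])) \<union> fan D (p # ys @ [r'])"
definition "G\<^sub>3 = insert \<rho> ((\<lambda>v. insert v M) ` set (b # xs)) \<union> (\<lambda>v. insert v D) ` set (p # ys)"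
definition "K\<^sub>3 = cone_off K\<^sub>2 F\<^sub>3 G\<^sub>3 x"

lemma s: "s \<in> set (b # xs)" unfolding s_def by (rule last_in_set) simp

lemma split_c: "c = (q # b # xs @ [p]) @ ys" "c = (q # b # xs) @ p # ys" by simp_all

lemma card_MD: "card M + 2 = d" "finite M" "card D + 2 = d" "finite D"
  using Q rQ fresh by auto

lemma adj_sp:
  assumes "successively P c" shows "P s p"
  using assms unfolding split_c(2) successively_append_iff s_def by simp

lemma fan_last: "insert s (insert p M) \<in> fan M (q # b # xs @ [p])"
proof -
  have "successively (\<lambda>e f. insert e (insert f M) \<in> fan M (q # b # xs @ [p])) ((q # b # xs) @ [p])"
    using successively_fan[of M "q # b # xs @ [p]"] by simp
  then show ?thesis unfolding successively_append_iff s_def by simp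
qed

lemma ball3: "stacked_ball K\<^sub>2 d F\<^sub>3 G\<^sub>3" "\<Union>F\<^sub>3 = verts K\<^sub>2"
proof -
  define A where "A = fan M (q # b # xs @ [p])"
  define B where "B = insert (insert r \<rho>) A"
  have "successively (link_adj K\<^sub>2 M) (q # b # xs @ [p])"
    using main2 unfolding split_c(1) successively_append_iff by blast
  moreover have "distinct (q # b # xs @ [p])" using c(1) by auto
  ultimately have A: "stacked_ball K\<^sub>2 d A ((\<lambda>v. insert v M) ` set (b # xs))"
    using stacked_ball_fan[of K\<^sub>2 M q b "xs @ [p]" d] card_MD(1,2)
    unfolding A_def by (simp del: fan.simps add: butlast_append)
  have UA: "\<Union>A = M \<union> set (q # b # xs @ [p])" unfolding A_def by (rule Union_fan)
  have l: "link_adj K\<^sub>2 D s p" by (rule adj_sp[OF side2])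
  have sp: "s \<noteq> p" using s c(1) by auto
  have sc: "s \<in> set c" using s by auto
  note sv = path_vertex[OF sc] path_vertices apexes
  have B: "stacked_ball K\<^sub>2 d B (insert \<rho> ((\<lambda>v. insert v M) ` set (b # xs)))"
    unfolding B_def
  proof (rule stacked_ball.attach[OF A fan_last[folded A_def]])
    show "\<rho> \<subseteq> insert s (insert p M)" by auto
    have "card \<rho> = card Q + 3" using sp sv Q(1) by simp
    then show "card \<rho> + 1 = d" using Q(2) by simp
    have "r \<notin> set c" using path_vertex(2)[of r] by blast
    then show "r \<notin> \<Union>A" unfolding UA using apexes rQ by simp
    show "insert r \<rho> \<in> K\<^sub>2" using l by (simp add: link_adj_def insert_commute)
  qed
  have UB: "\<Union>B = insert r (M \<union> set (q # b # xs @ [p]))"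
  proof -
    have "\<Union>B = insert r \<rho> \<union> (M \<union> set (q # b # xs @ [p]))" unfolding B_def UA[symmetric] by (rule Union_insert)
    then show ?thesis using s by auto
  qed
  have sd: "successively (link_adj K\<^sub>2 D) (p # ys @ [r'])"
  proof -
    have "successively (link_adj K\<^sub>2 D) (p # ys)" using side2 unfolding split_c(2) successively_append_iff by blast
    moreover have "last c = last (p # ys)" by simp
    ultimately have "successively (link_adj K\<^sub>2 D) ((p # ys) @ [r'])"
      using side_end2 unfolding successively_append_iff by simp
    then show ?thesis by simp
  qed
  have E: "stacked_ball K\<^sub>2 d (B \<union> fan D (p # ys @ [r']))
      (insert \<rho> ((\<lambda>v. insert v M) ` set (b # xs)) \<union> (\<lambda>v. insert v D) ` set (butlast (p # ys @ [r']))) \<and>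
      \<Union>(B \<union> fan D (p # ys @ [r'])) = \<Union>B \<union> set (ys @ [r'])"
  proof (rule stacked_ball_extend_fan[OF B _ _ card_MD(3,4) sd])
    show "insert r \<rho> \<in> B" unfolding B_def by simp
    show "insert p D \<subseteq> insert r \<rho>" by auto
    show "p \<notin> D" using sv by simp
    have r': "r' \<notin> set c" using path_vertex(3)[of r'] by blast
    then show "distinct (ys @ [r'])" using c(1) by simp
    have "v \<notin> \<Union>B" if "v \<in> set ys" for v
    proof -
      have "v \<in> set c" using that by simp
      moreover have "v \<notin> set (q # b # xs @ [p])" using that c(1) by auto
      ultimately show ?thesis unfolding UB using path_vertex[of v] by simp
    qed
    moreover have "r' \<notin> \<Union>B" unfolding UB using r' rQ apexes by simp
    ultimately show "set (ys @ [r']) \<inter> \<Union>B = {}" by auto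
  qed
  have "butlast (p # ys @ [r']) = p # ys" by (simp add: butlast_append)
  then show "stacked_ball K\<^sub>2 d F\<^sub>3 G\<^sub>3" using E unfolding F\<^sub>3_def G\<^sub>3_def B_def A_def by (simp only:)
  have "\<Union>F\<^sub>3 = \<Union>B \<union> set (ys @ [r'])" unfolding F\<^sub>3_def using E unfolding B_def A_def by (simp only:)
  also have "\<dots> = verts K\<^sub>2" unfolding UB V2 V by auto
  finally show "\<Union>F\<^sub>3 = verts K\<^sub>2" .
qed

text \<open>The vertex \<open>y\<close> occurs only in the part around \<open>M\<close>, and
  \<open>r'\<close> only at the end of the part around \<open>D\<close>. Hence no face removed by
  the third cone contains the spare hub.\<close>

lemma F3_cases:
  assumes "\<sigma> \<in> F\<^sub>3 \<or> \<sigma> \<in> G\<^sub>3"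
  shows "insert z Q \<subseteq> \<sigma>" "y \<in> \<sigma> \<Longrightarrow> r' \<notin> \<sigma>"
proof -
  have sc: "s \<in> set c" using s by auto
  consider (M1) e f where "e \<in> set c" "f \<in> set c" "\<sigma> = insert e (insert f M)"
    | (M2) v where "v \<in> set c" "\<sigma> = insert v M" | (R) "\<sigma> = insert r \<rho> \<or> \<sigma> = \<rho>"
    | (D1) e f where "e \<in> set c \<union> {r'}" "f \<in> set c \<union> {r'}" "\<sigma> = insert e (insert f D)"
    | (D2) v where "v \<in> set c" "\<sigma> = insert v D"
  proof -
    have 1: "\<exists>e f. e \<in> set c \<and> f \<in> set c \<and> \<sigma> = insert e (insert f M)"
      if "\<sigma> \<in> fan M (q # b # xs @ [p])"
      using fan_memD[OF that] by auto
    have 2: "\<exists>e f. e \<in> set c \<union> {r'} \<and> f \<in> set c \<union> {r'} \<and> \<sigma> = insert e (insert f D)"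
      if "\<sigma> \<in> fan D (p # ys @ [r'])"
      using fan_memD[OF that] by auto
    from assms consider "\<sigma> \<in> fan M (q # b # xs @ [p])" | "\<sigma> \<in> fan D (p # ys @ [r'])"
      | "\<sigma> = insert r \<rho> \<or> \<sigma> = \<rho>" | v where "v \<in> set (b # xs)" "\<sigma> = insert v M"
      | v where "v \<in> set (p # ys)" "\<sigma> = insert v D"
      unfolding F\<^sub>3_def G\<^sub>3_def by blast
    then show thesis
    proof cases
      case 1 then show ?thesis using \<open>\<sigma> \<in> fan M _ \<Longrightarrow> _\<close> M1 by blast
    next
      case 2 then show ?thesis using \<open>\<sigma> \<in> fan D _ \<Longrightarrow> _\<close> D1 by blast
    next
      case 3 then show ?thesis using R by blast
    next
      case (4 v) then show ?thesis using M2[of v] by auto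
    next
      case (5 v) then show ?thesis using D2[of v] by auto
    qed
  qed
  note cs = this
  show "insert z Q \<subseteq> \<sigma>" by (rule cs) auto
  show "r' \<notin> \<sigma>" if "y \<in> \<sigma>"
    by (rule cs) (use that sc cZ fresh rQ in auto)
qed

lemma x2: "x \<notin> verts K\<^sub>2" using V2 new fresh by auto

lemma K3: "retriangulates d K\<^sub>2 K\<^sub>3"
  unfolding K\<^sub>3_def by (rule retriangulates_cone_off[OF N2 d3(1) ball3(1) x2])

lemma N3: "normal_pm d K\<^sub>3" using retriangulates_normal_pm[OF K3] .

lemma V3: "verts K\<^sub>3 = insert x (insert y (insert z (verts K)))"
  unfolding K\<^sub>3_def verts_cone_off[OF S2 d3(1) ball3(1) x2] V2 ..

lemma E3: "nonedges K\<^sub>3 = nonedges K"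
  unfolding K\<^sub>3_def nonedges_cone_off[OF S2 d ball3(1) x2 ball3(2)] by (rule E2)

lemma first3: "insert q (insert b M) \<in> F\<^sub>3" unfolding F\<^sub>3_def by simp

text \<open>As ends of the path around \<open>M\<close>, \<open>p\<close> and \<open>q\<close> give
  no gluing ridges.\<close>

lemma ridge3:
  assumes "F \<in> F\<^sub>3" "insert v M \<subseteq> F" "v \<in> {p, q}"
  shows "insert x (insert v M) \<in> K\<^sub>3"
proof -
  have vM: "v \<notin> M" "v \<in> set c" using assms(3) cZ fresh by auto
  then have cv: "card (insert v M) + 1 = d" using card_MD by simp
  have "insert v M \<notin> F\<^sub>3"
  proof
    assume "insert v M \<in> F\<^sub>3"
    then have "card (insert v M) = d" using stacked_ball_basic[OF ball3(1) S2 d3(2)] by blast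
    then show False using cv by simp
  qed
  moreover have "insert v M \<notin> G\<^sub>3"
  proof
    assume "insert v M \<in> G\<^sub>3"
    moreover have "y \<in> insert v M" by simp
    moreover have "y \<notin> \<rho>" using s fresh by auto
    moreover have "y \<notin> insert u D" if "u \<in> set (p # ys)" for u using that fresh by auto
    ultimately obtain u where u: "u \<in> set (b # xs)" "insert v M = insert u M" unfolding G\<^sub>3_def by blast
    have "u \<noteq> v" using u(1) assms(3) c(1) by auto
    have "v \<in> insert u M" unfolding u(2)[symmetric] by simp
    then show False using vM \<open>u \<noteq> v\<close> by blast
  qed
  ultimately show ?thesis unfolding K\<^sub>3_def using cone_off_new[OF assms(1,2)] by blast
qed

abbreviation "R \<equiv> insert x M"

text \<open>The three cones are taken over spanning balls, so \<open>p\<close> and \<open>q\<close>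
  are still not adjacent.\<close>

lemma flippable3: "flippable d K\<^sub>3 R q p"
proof
  show "normal_pm d K\<^sub>3" by (rule N3)
  show "2 \<le> d" using d by simp
  show "card R + 1 = d" using card_MD fresh by simp
  show "q \<noteq> p" using c(1) by auto
  show "q \<notin> R" "p \<notin> R" using cZ fresh by auto
  have "insert x (insert q M) \<in> K\<^sub>3" by (rule ridge3[OF first3]) auto
  then show "insert q R \<in> K\<^sub>3" by (simp add: insert_commute)
  have "insert s (insert p M) \<in> F\<^sub>3" unfolding F\<^sub>3_def using fan_last by blast
  then have "insert x (insert p M) \<in> K\<^sub>3" by (rule ridge3) auto
  then show "insert p R \<in> K\<^sub>3" by (simp add: insert_commute)
  have e: "{q, p} = {p, q}" by auto
  have "q \<in> verts K" "p \<in> verts K" using V by auto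
  then have "{p, q} \<in> nonedges K" using pq c(1) by (auto simp: nonedges_def)
  then show "{q, p} \<notin> K\<^sub>3" unfolding e using E3 by (auto simp: nonedges_def)
qed

section \<open>The flip to the edge \<open>q p\<close>, and the new hub\<close>

definition "K\<^sub>4 = flip K\<^sub>3 R q p"
abbreviation "S \<equiv> insert y (insert r' Q)"

lemma K4: "retriangulates d K\<^sub>3 K\<^sub>4"
  unfolding K\<^sub>4_def retriangulates_def
  using flippable.normal_pm_flip[OF flippable3]
    flippable.realization_flip_homeomorphic[OF flippable3 infinite_UNIV_nat] by (rule conjI)

lemma N4: "normal_pm d K\<^sub>4" using retriangulates_normal_pm[OF K4] .

lemma S4: "simplicial_complex K\<^sub>4" using normal_pmD(1)[OF N4] .

lemma E4: "nonedges K\<^sub>4 \<subseteq> nonedges K - {{q, p}}"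
  unfolding K\<^sub>4_def using nonedges_flip[OF flippable3] card_MD d fresh E3 by auto

lemma keep4: "\<sigma> \<in> K\<^sub>3 \<Longrightarrow> \<not> R \<subseteq> \<sigma> \<Longrightarrow> \<sigma> \<in> K\<^sub>4"
  unfolding K\<^sub>4_def flip_def by simp

text \<open>A face over the spare hub contains \<open>y\<close> and \<open>r'\<close>, so the third
  cone keeps it; without \<open>x\<close> it does not contain the flipped ridge.\<close>

lemma keep_spare:
  assumes "\<sigma> \<in> K\<^sub>2" "S \<subseteq> \<sigma>" shows "\<sigma> \<in> K\<^sub>4"
proof (rule keep4)
  have "y \<in> \<sigma>" "r' \<in> \<sigma>" using assms(2) by auto
  then have "\<sigma> \<notin> F\<^sub>3" "\<sigma> \<notin> G\<^sub>3" using F3_cases(2)[of \<sigma>] by blast+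
  then show "\<sigma> \<in> K\<^sub>3" unfolding K\<^sub>3_def using assms(1) by (simp add: cone_off_old)
  show "\<not> R \<subseteq> \<sigma>" using face_subset_verts[OF S2 assms(1)] x2 by blast
qed

lemma V4: "verts K\<^sub>4 = insert x (insert y (insert z (verts K)))"
proof -
  have "{v} \<in> K\<^sub>4 \<longleftrightarrow> {v} \<in> K\<^sub>3" for v
  proof -
    have "q \<noteq> p" using c(1) by auto
    then have "{v} \<notin> (\<lambda>\<tau>. insert q (insert p \<tau>)) ` X" for X by auto
    moreover have "\<not> R \<subseteq> {v}" using apexes by auto
    ultimately show ?thesis unfolding K\<^sub>4_def flip_def by (simp only: Un_iff mem_Collect_eq simp_thms)
  qed
  then have "verts K\<^sub>4 = verts K\<^sub>3" unfolding verts_def by (simp only:)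
  then show ?thesis using V3 by (rule trans)
qed

text \<open>No facet of the third ball contains \<open>S\<close>. So \<open>S\<close> is no longer a
  hub: \<open>x\<close> is missing from its link and must be covered separately.\<close>

lemma spare4: "insert x S \<notin> K\<^sub>4"
proof
  assume "insert x S \<in> K\<^sub>4"
  moreover have "insert x S \<noteq> insert q (insert p \<tau>)" for \<tau>
  proof
    assume "insert x S = insert q (insert p \<tau>)"
    then have "q \<in> insert x S" by blast
    then show False using path_vertices by simp
  qed
  ultimately have "insert x S \<in> K\<^sub>3" unfolding K\<^sub>4_def flip_def by blast
  then obtain F where "F \<in> F\<^sub>3" "insert x S - {x} \<subseteq> F"
    using cone_off_iff[OF S2 x2, of F\<^sub>3 "insert x S" G\<^sub>3] stacked_ball_basic[OF ball3(1) S2 d3(2)]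
    unfolding K\<^sub>3_def by auto
  moreover have "insert x S - {x} = S" using fresh by auto
  ultimately show False using F3_cases(2)[of F] by auto
qed

lemma link4: "{v. link_adj K\<^sub>4 S v v} = insert z (verts K) - S"
proof -
  have "link_adj K\<^sub>4 S v v" if v: "v \<in> insert z (verts K)" "v \<notin> S" for v
  proof -
    have "insert v S \<in> K\<^sub>2" using hub2 v V2 unfolding hub_def by auto
    then show ?thesis using keep_spare[of "insert v S"] v by (auto simp: link_adj_def)
  qed
  moreover have "v \<in> insert z (verts K) - S" if "link_adj K\<^sub>4 S v v" for v
  proof -
    have v: "v \<notin> S" "insert v S \<in> K\<^sub>4" using that by (auto simp: link_adj_def)
    then have "v \<in> verts K\<^sub>4" using face_subset_verts[OF S4] by blast
    then show ?thesis using v spare4 V4 by auto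
  qed
  ultimately show ?thesis by blast
qed

text \<open>The fan around \<open>S\<close> covers all vertices except \<open>x\<close>, which is
  attached along the ridge \<open>T\<close> of the facet \<open>S \<union> {q, b}\<close>. The face
  \<open>T\<close> also lies in the first facet of the third ball; lacking \<open>z\<close>, it is
  on the boundary of that ball and was coned with \<open>x\<close>. All facets of the final ball
  contain \<open>{y} \<union> Q\<close>, so the cone with apex \<open>w\<close> has the full hub
  \<open>{w, y} \<union> Q\<close>.\<close>

lemma join:
  "\<exists>K' Z'. retriangulates d K K' \<and> hub K' Z' \<and> card Z' + 2 = d \<and> nonedges K' \<subseteq> nonedges K - {{q, p}}"
proof -
  have cS: "card S + 2 = d" "finite S" using Q rQ fresh by auto
  have qS: "q \<notin> S" "b \<notin> S" "q \<noteq> b" using cZ fresh c(1) by auto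
  have qb: "insert q (insert b S) \<in> K\<^sub>4"
    by (rule keep_spare) (use spare2 in \<open>auto simp: insert_commute\<close>)
  then have "link_adj K\<^sub>4 S q b" using qS by (simp add: link_adj_def)
  from link_cycle[OF N4 cS this qS(3)] obtain ds where
    ds: "distinct (q # b # ds)" "successively (link_adj K\<^sub>4 S) (q # b # ds)"
      "set (q # b # ds) = {v. link_adj K\<^sub>4 S v v}" by blast
  define A where "A = fan S (q # b # ds)"
  define G where "G = (\<lambda>v. insert v S) ` set (butlast (b # ds))"
  have A: "stacked_ball K\<^sub>4 d A G" unfolding A_def G_def by (rule stacked_ball_fan[OF ds(2,1) cS])
  have UA: "\<Union>A = S \<union> (insert z (verts K) - S)" unfolding A_def Union_fan ds(3) link4 ..
  define T where "T = insert q (insert b (insert y Q))"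
  have TF: "insert q (insert b S) \<in> A" unfolding A_def by simp
  have xT: "insert x T \<in> K\<^sub>4"
  proof (rule keep4)
    have zT: "z \<notin> T" using fresh unfolding T_def by auto
    then have "T \<notin> F\<^sub>3" "T \<notin> G\<^sub>3" using F3_cases(1) by blast+
    moreover have "T \<subseteq> insert q (insert b M)" unfolding T_def by auto
    ultimately show "insert x T \<in> K\<^sub>3" unfolding K\<^sub>3_def using cone_off_new[OF first3] by blast
    show "\<not> R \<subseteq> insert x T" using zT fresh by auto
  qed
  have B: "stacked_ball K\<^sub>4 d (insert (insert x T) A) (insert T G)"
  proof (rule stacked_ball.attach[OF A TF])
    show "T \<subseteq> insert q (insert b S)" unfolding T_def by auto
    have "card T = card Q + 3" unfolding T_def using qS fresh Q by simp
    then show "card T + 1 = d" using Q by simp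
    show "x \<notin> \<Union>A" unfolding UA using new fresh by auto
    show "insert x T \<in> K\<^sub>4" by (rule xT)
  qed
  have "\<Union>(insert (insert x T) A) = insert x (\<Union>A)" using TF unfolding T_def by auto
  also have "\<dots> = verts K\<^sub>4" unfolding UA V4 using ZV by auto
  finally have UB: "\<Union>(insert (insert x T) A) = verts K\<^sub>4" .
  have w4: "w \<notin> verts K\<^sub>4" using V4 new fresh by auto
  have over: "\<forall>F\<in>insert (insert x T) A. insert y Q \<subseteq> F"
    unfolding A_def T_def by (auto dest!: fan_memD)
  define K\<^sub>5 where "K\<^sub>5 = cone_off K\<^sub>4 (insert (insert x T) A) (insert T G) w"
  have cy: "card (insert y Q) + 3 \<le> d" using Q fresh by simp
  note h = hub_cone_off[OF N4 B UB over w4 cy, folded K\<^sub>5_def]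
  have "retriangulates d K\<^sub>4 K\<^sub>5" unfolding K\<^sub>5_def by (rule retriangulates_cone_off[OF N4 d3(1) B w4])
  then have "retriangulates d K K\<^sub>5" using K1 K2 K3 K4 retriangulates_trans by blast
  moreover have "nonedges K\<^sub>5 \<subseteq> nonedges K - {{q, p}}"
    unfolding K\<^sub>5_def nonedges_cone_off[OF S4 d B w4 UB] by (rule E4)
  moreover have "card (insert w (insert y Q)) + 2 = d" using h(2,3) Q fresh by simp
  ultimately show ?thesis using h(1) by blast
qed

end

section \<open>Complete triangulations and face numbers\<close>

text \<open>Hub vertices are adjacent to everything, so \<open>p\<close> and \<open>q\<close> lie on
  the link cycle. It is opened so as to start with \<open>q\<close> and a neighbour
  \<open>b\<close>, which is not \<open>p\<close> because \<open>p\<close> and \<open>q\<close> are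
  not adjacent; \<open>d \<ge> 4\<close> gives the hub two vertices to serve as \<open>r\<close>,
  \<open>r'\<close>.\<close>

lemma join_nonedge:
  fixes K :: "nat set set"
  assumes K: "normal_pm d K" and d: "4 \<le> d" and h: "hub K Z" "card Z + 2 = d" and e: "e \<in> nonedges K"
  shows "\<exists>K' Z'. retriangulates d K K' \<and> hub K' Z' \<and> card Z' + 2 = d \<and> nonedges K' \<subseteq> nonedges K - {e}"
proof -
  note N = normal_pmD[OF K] and s = simplicial_complexD[OF normal_pmD(1)[OF K]]
  obtain p q where pq: "e = {q, p}" "p \<noteq> q" using e unfolding nonedges_def by (auto simp: card_2_iff)
  have pqV: "p \<in> verts K" "q \<in> verts K" "{p, q} \<notin> K"
    using e unfolding nonedges_def pq(1) by (auto simp: insert_commute)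
  have ZK: "Z \<in> K" using h(1) unfolding hub_def by blast
  have fZ: "finite Z" using s(3)[OF ZK] .
  have out: "v \<notin> Z" if "v' \<in> verts K" "{v, v'} \<notin> K" for v v'
  proof
    assume "v \<in> Z"
    have "insert v' Z \<in> K" using h(1) that(1) ZK unfolding hub_def by (cases "v' \<in> Z") (auto simp: insert_absorb)
    from s(4)[OF this, of "{v, v'}"] show False using \<open>v \<in> Z\<close> that(2) by auto
  qed
  have pZ: "p \<notin> Z" using out[of q p] pqV by blast
  have qZ: "q \<notin> Z" using out[of p q] pqV by (simp add: insert_commute)
  have adj: "link_adj K Z v v" if "v \<in> verts K" "v \<notin> Z" for v
    using h(1) that unfolding hub_def link_adj_def by auto
  have qK: "insert q Z \<in> K" using adj[OF pqV(2) qZ] by (simp add: link_adj_def)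
  have "card {v. v \<notin> insert q Z \<and> insert v (insert q Z) \<in> K} = 2"
    using N(4)[OF qK] qZ fZ h(2) by simp
  then have "{v. v \<notin> insert q Z \<and> insert v (insert q Z) \<in> K} \<noteq> {}"
    by (metis card.empty zero_neq_numeral)
  then obtain b where b: "b \<notin> insert q Z" "insert b (insert q Z) \<in> K" by blast
  have qb: "link_adj K Z q b" using b qZ by (simp add: link_adj_def insert_commute)
  have "q \<noteq> b" using b by blast
  from link_cycle[OF K h(2) fZ qb this] obtain cs where
    cs: "distinct (q # b # cs)" "successively (link_adj K Z) (q # b # cs)"
      "set (q # b # cs) = {v. link_adj K Z v v}" by blast
  have "{b, q} \<in> K" using s(4)[OF b(2)] by auto
  then have "p \<noteq> b" using pqV by blast
  moreover have "p \<in> set (q # b # cs)" unfolding cs(3) using adj[OF pqV(1) pZ] by simp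
  ultimately have "p \<in> set cs" using pq(2) by simp
  then obtain xs ys where xy: "cs = xs @ p # ys" by (meson split_list)
  have "card Z \<noteq> 0" using h(2) d by linarith
  then obtain r where r: "r \<in> Z" by fastforce
  have c1: "card (Z - {r}) + 3 = d" using r fZ h(2) card_Suc_Diff1[OF fZ r] by simp
  then have "card (Z - {r}) \<noteq> 0" using d by linarith
  then have "Z - {r} \<noteq> {}" by (metis card.empty)
  then obtain r' where r': "r' \<in> Z" "r' \<noteq> r" by blast
  define Q where "Q = Z - {r, r'}"
  have ZQ: "Z = insert r (insert r' Q)" using r r' Q_def by auto
  have Q: "finite Q" "r \<notin> Q" "r' \<notin> Q" "r \<noteq> r'" using fZ r' Q_def by auto
  then have cQ: "card Q + 4 = d" using h(2) ZQ by simp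
  have fV: "finite (verts K)" using finite_verts[OF N(1)] .
  obtain z where z: "z \<notin> verts K" using ex_new_if_finite[OF infinite_UNIV_nat fV] by blast
  obtain y where y: "y \<notin> insert z (verts K)"
    using ex_new_if_finite[OF infinite_UNIV_nat, of "insert z (verts K)"] fV by blast
  obtain x where x: "x \<notin> insert y (insert z (verts K))"
    using ex_new_if_finite[OF infinite_UNIV_nat, of "insert y (insert z (verts K))"] fV by blast
  obtain w where w: "w \<notin> insert x (insert y (insert z (verts K)))"
    using ex_new_if_finite[OF infinite_UNIV_nat, of "insert x (insert y (insert z (verts K)))"] fV by blast
  have lk: "{v. link_adj K Z v v} = verts K - Z"
  proof -
    have "v \<in> verts K - Z" if "link_adj K Z v v" for v
      using that face_subset_verts[OF N(1)] unfolding link_adj_def by blast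
    then show ?thesis using adj by blast
  qed
  note e_eq = pq(1)
  interpret joining K d Q r r' p q b xs ys z y x w
  proof
    show "hub K (insert r (insert r' Q))" using h(1) ZQ by simp
    show "distinct (q # b # xs @ p # ys)" using cs(1) xy by simp
    show "successively (link_adj K (insert r (insert r' Q))) (q # b # xs @ p # ys)" using cs(2) xy ZQ by simp
    show "set (q # b # xs @ p # ys) = verts K - insert r (insert r' Q)"
      using cs(3) lk xy ZQ by simp
    show "{p, q} \<notin> K" by (rule pqV(3))
  qed (use K d Q cQ x y z w in auto)
  show ?thesis using join unfolding e_eq .
qed

lemma ex_complete_hub:
  fixes K :: "nat set set"
  assumes d: "4 \<le> d"
  shows "normal_pm d K \<Longrightarrow> hub K Z \<Longrightarrow> card Z + 2 = d \<Longrightarrow>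
    \<exists>K' :: nat set set. \<exists>Z'. retriangulates d K K' \<and> hub K' Z' \<and> card Z' + 2 = d \<and> nonedges K' = {}"
proof (induction "card (nonedges K)" arbitrary: K Z rule: less_induct)
  case less
  show ?case
  proof (cases "nonedges K = {}")
    case True then show ?thesis using less.prems retriangulates_refl by blast
  next
    case False
    then obtain e where e: "e \<in> nonedges K" by blast
    obtain K' Z' where K': "retriangulates d K K'" "hub K' Z'" "card Z' + 2 = d"
      "nonedges K' \<subseteq> nonedges K - {e}" using join_nonedge[OF less.prems(1) d less.prems(2,3) e] by blast
    have "nonedges K' \<subset> nonedges K" using K'(4) e by blast
    then have "card (nonedges K') < card (nonedges K)"
      using finite_nonedges[OF normal_pmD(1)[OF less.prems(1)]] psubset_card_mono by blast
    from less.hyps[OF this retriangulates_normal_pm[OF K'(1)] K'(2,3)]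
    obtain K'' :: "nat set set" and Z'' where "retriangulates d K' K''" "hub K'' Z''" "card Z'' + 2 = d" "nonedges K'' = {}"
      by blast
    then show ?thesis using K'(1) retriangulates_trans by blast
  qed
qed

text \<open>A vertex of the hub is dropped, which leaves a face common to all facets of the spanning
  ball; the apex of the cone restores the size.\<close>

lemma complete_hub_step:
  fixes K :: "nat set set"
  assumes K: "normal_pm d K" and d: "4 \<le> d" and h: "hub K Z" "card Z + 2 = d" "nonedges K = {}"
  shows "\<exists>K' :: nat set set. \<exists>Z'. retriangulates d K K' \<and> hub K' Z' \<and> card Z' + 2 = d \<and> nonedges K' = {} \<and>
    card (verts K') = card (verts K) + 1"
proof -
  have S: "simplicial_complex K" using normal_pmD(1)[OF K] .
  obtain \<F> \<G> where b: "stacked_ball K d \<F> \<G>" "\<Union>\<F> = verts K" "\<forall>F\<in>\<F>. Z \<subseteq> F"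
    using hub_spanning_ball[OF _ _ K h(1)] d h(2) by auto
  obtain z where z: "z \<notin> verts K" using ex_fresh_vertex[OF S] by blast
  have fZ: "finite Z" using h(1) simplicial_complexD(3)[OF S] unfolding hub_def by blast
  have "card Z \<noteq> 0" using h(2) d by linarith
  then obtain r where r: "r \<in> Z" by fastforce
  have c: "card (Z - {r}) + 3 = d" using card_Suc_Diff1[OF fZ r] h(2) by simp
  have over: "\<forall>F\<in>\<F>. Z - {r} \<subseteq> F" using b(3) by blast
  have d3: "3 \<le> d" using d by simp
  note hc = hub_cone_off[OF K b(1,2) over z eq_refl[OF c]]
  have "card (insert z (Z - {r})) + 2 = d" using hc(2,3) c by simp
  moreover have "card (verts (cone_off K \<F> \<G> z)) = card (verts K) + 1"
    unfolding verts_cone_off[OF S d3 b(1) z] using z finite_verts[OF S] by simp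
  moreover have "nonedges (cone_off K \<F> \<G> z) = {}"
    using nonedges_cone_off[OF S d b(1) z b(2)] h(3) by simp
  ultimately show ?thesis using hc(1) retriangulates_cone_off[OF K d3 b(1) z] by blast
qed

lemma ex_complete_hub_card:
  fixes K :: "nat set set"
  assumes K: "normal_pm d K" and d: "4 \<le> d"
  shows "\<exists>n. \<forall>m\<ge>n. \<exists>K' :: nat set set. \<exists>Z. retriangulates d K K' \<and> hub K' Z \<and> card Z + 2 = d \<and>
    nonedges K' = {} \<and> card (verts K') = m"
proof -
  have "3 \<le> d" "d - 2 + 2 \<le> d" using d by simp_all
  from ex_hub[OF this(1) K this(2)] obtain K1 :: "nat set set" and Z1 where
    1: "retriangulates d K K1" "hub K1 Z1" "card Z1 = d - 2" by blast
  have "card Z1 + 2 = d" using 1(3) d by simp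
  then obtain K0 :: "nat set set" and Z0 where 0: "retriangulates d K1 K0" "hub K0 Z0" "card Z0 + 2 = d" "nonedges K0 = {}"
    using ex_complete_hub[OF d retriangulates_normal_pm[OF 1(1)] 1(2)] by blast
  have "\<exists>K' :: nat set set. \<exists>Z. retriangulates d K K' \<and> hub K' Z \<and> card Z + 2 = d \<and>
    nonedges K' = {} \<and> card (verts K') = card (verts K0) + k" for k
  proof (induction k)
    case 0
    have "retriangulates d K K0" using \<open>retriangulates d K1 K0\<close> 1(1) retriangulates_trans by blast
    then show ?case using \<open>hub K0 Z0\<close> \<open>card Z0 + 2 = d\<close> \<open>nonedges K0 = {}\<close> by auto
  next
    case (Suc k)
    then obtain K' :: "nat set set" and Z where K': "retriangulates d K K'" "hub K' Z" "card Z + 2 = d"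
      "nonedges K' = {}" "card (verts K') = card (verts K0) + k" by blast
    obtain K'' :: "nat set set" and Z'' where K'': "retriangulates d K' K''" "hub K'' Z''" "card Z'' + 2 = d"
      "nonedges K'' = {}" "card (verts K'') = card (verts K') + 1"
      using complete_hub_step[OF retriangulates_normal_pm[OF K'(1)] d K'(2-4)] by blast
    have "retriangulates d K K''" using K'(1) K''(1) retriangulates_trans by blast
    moreover have "card (verts K'') = card (verts K0) + Suc k" using K''(5) K'(5) by simp
    ultimately show ?case using K''(2-4) by blast
  qed
  then show ?thesis by (metis le_Suc_ex)
qed

section \<open>Face numbers, \<open>g1\<close> and \<open>g2\<close>\<close>

lemma complex_rank_normal_pm:
  assumes "normal_pm d K"
  shows "complex_rank K = d"
proof -
  note N = normal_pmD[OF assms] and s = simplicial_complexD[OF normal_pmD(1)[OF assms]]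
  obtain \<tau> where "\<tau> \<in> K" "card \<tau> = d" using N(2)[OF s(2)] by blast
  then show ?thesis unfolding complex_rank_def using N(3) s(1) by (intro Max_eqI) auto
qed

lemma face_count_0: "simplicial_complex K \<Longrightarrow> face_count K 0 = 1"
proof -
  assume K: "simplicial_complex K"
  have "{\<sigma> \<in> K. card \<sigma> = 0} = {{}}" using simplicial_complexD(2,3)[OF K] by auto
  then show ?thesis by (simp add: face_count_def)
qed

lemma face_count_1: "face_count K 1 = card (verts K)"
proof -
  have "{\<sigma> \<in> K. card \<sigma> = 1} = (\<lambda>v. {v}) ` verts K" by (auto simp: verts_def card_1_singleton_iff)
  then show ?thesis by (simp add: face_count_def card_image)
qed

lemma g1_eq:
  assumes "normal_pm d K" "2 \<le> d"
  shows "g1 K = int (card (verts K)) - int d - 1"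
proof -
  have "h_number K 1 = - int d + int (card (verts K))"
    using face_count_0[OF normal_pmD(1)[OF assms(1)]] face_count_1[of K] assms(2)
      binomial_symmetric[of "d - 1" d]
    by (simp add: h_number_def complex_rank_normal_pm[OF assms(1)] Let_def)
  then show ?thesis by (simp add: g1_def)
qed

text \<open>The usual formula with constant \<open>(d + 1) choose 2\<close>, here split as
  \<open>(d choose 2) + d\<close>.\<close>

lemma g2_eq:
  assumes "normal_pm d K" "2 \<le> d"
  shows "g2 K = int (face_count K 2) - int d * int (card (verts K)) + int (d choose 2) + int d"
proof -
  note f = face_count_0[OF normal_pmD(1)[OF assms(1)]] face_count_1[of K]
  have h1: "h_number K 1 = - int d + int (card (verts K))"
    using f assms(2) binomial_symmetric[of "d - 1" d]
    by (simp add: h_number_def complex_rank_normal_pm[OF assms(1)] Let_def)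
  have "(d - 1) choose (d - 2) = d - 1"
    using binomial_symmetric[of "d - 2" "d - 1"] assms(2) by (simp add: numeral_2_eq_2 Suc_diff_le)
  moreover have "d choose (d - 2) = d choose 2" using binomial_symmetric[of 2 d] assms(2) by simp
  moreover have "{0..2::nat} = {0, 1, 2}" by auto
  ultimately have "h_number K 2 = int (d choose 2) - int (d - 1) * int (card (verts K)) + int (face_count K 2)"
    using f by (simp add: h_number_def complex_rank_normal_pm[OF assms(1)] Let_def)
  moreover have "int (d - 1) = int d - 1" using assms(2) by simp
  ultimately show ?thesis using h1 by (simp add: g2_def algebra_simps)
qed

lemma face_count_2_complete:
  assumes "simplicial_complex K" "nonedges K = {}"
  shows "face_count K 2 = card (verts K) choose 2"
proof -
  have "\<sigma> \<subseteq> verts K" if "\<sigma> \<in> K" for \<sigma> using face_subset_verts[OF assms(1) that] .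
  then have "{\<sigma> \<in> K. card \<sigma> = 2} = {e. e \<subseteq> verts K \<and> card e = 2}"
    using assms(2) unfolding nonedges_def by blast
  then show ?thesis unfolding face_count_def using n_subsets[OF finite_verts[OF assms(1)]] by simp
qed

lemma face_count_2_cone_off:
  assumes "simplicial_complex K" "4 \<le> d" "stacked_ball K d \<F> \<G>" "z \<notin> verts K"
  shows "face_count (cone_off K \<F> \<G> z) 2 = face_count K 2 + card (\<Union>\<F>)"
proof -
  let ?C = "cone_off K \<F> \<G> z"
  note e = cone_off_edges[OF assms]
  have U: "finite (\<Union>\<F>)" "\<Union>\<F> \<subseteq> verts K" using stacked_ball_vertices[OF assms(3,1)] assms(2) by auto
  then have zU: "z \<notin> \<Union>\<F>" using assms(4) by blast
  have zK: "z \<notin> \<sigma>" if "\<sigma> \<in> K" for \<sigma>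
    using face_subset_verts[OF assms(1) that] assms(4) by blast
  have "\<sigma> \<in> ?C \<and> card \<sigma> = 2 \<longleftrightarrow> \<sigma> \<in> K \<and> card \<sigma> = 2 \<or> \<sigma> \<in> (\<lambda>v. {z, v}) ` \<Union>\<F>" for \<sigma>
  proof (cases "z \<in> \<sigma>")
    case True
    have "\<sigma> \<in> ?C \<and> card \<sigma> = 2 \<longleftrightarrow> (\<exists>v. v \<noteq> z \<and> \<sigma> = {z, v} \<and> {z, v} \<in> ?C)"
    proof
      assume "\<sigma> \<in> ?C \<and> card \<sigma> = 2"
      moreover from this obtain p q where pq: "\<sigma> = {p, q}" "p \<noteq> q" by (meson card_2_iff)
      then have "\<exists>v. v \<noteq> z \<and> \<sigma> = {z, v}" using True by (cases "p = z") (auto simp: insert_commute)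
      ultimately show "\<exists>v. v \<noteq> z \<and> \<sigma> = {z, v} \<and> {z, v} \<in> ?C" by blast
    qed auto
    also have "\<dots> \<longleftrightarrow> (\<exists>v. v \<noteq> z \<and> \<sigma> = {z, v} \<and> v \<in> \<Union>\<F>)" using e(2) by metis
    also have "\<dots> \<longleftrightarrow> \<sigma> \<in> (\<lambda>v. {z, v}) ` \<Union>\<F>" using zU by auto
    finally show ?thesis using zK True by blast
  next
    case False
    then have "\<sigma> \<in> ?C \<longleftrightarrow> \<sigma> \<in> K" if "card \<sigma> = 2" using that e(1) by (auto simp: card_2_iff)
    moreover have "\<sigma> \<notin> (\<lambda>v. {z, v}) ` \<Union>\<F>" using False by blast
    ultimately show ?thesis by blast
  qed
  then have eq: "{\<sigma> \<in> ?C. card \<sigma> = 2} = {\<sigma> \<in> K. card \<sigma> = 2} \<union> (\<lambda>v. {z, v}) ` \<Union>\<F>"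
    unfolding set_eq_iff Un_iff mem_Collect_eq by (rule allI)
  have "card ((\<lambda>v. {z, v}) ` \<Union>\<F>) = card (\<Union>\<F>)"
    by (rule card_image) (auto simp: inj_on_def doubleton_eq_iff)
  moreover have "{\<sigma> \<in> K. card \<sigma> = 2} \<inter> (\<lambda>v. {z, v}) ` \<Union>\<F> = {}" using zK by blast
  ultimately show ?thesis unfolding face_count_def eq
    using card_Un_disjoint[of "{\<sigma> \<in> K. card \<sigma> = 2}" "(\<lambda>v. {z, v}) ` \<Union>\<F>"]
      simplicial_complexD(1)[OF assms(1)] U(1) by simp
qed

text \<open>The apex adds one vertex and one edge to each vertex of the ball, and no edge is lost; a
  ball with \<open>d + k\<close> vertices raises \<open>g2\<close> by \<open>k\<close>.\<close>

lemma g_cone_off: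
  fixes K :: "nat set set"
  assumes K: "normal_pm d K" and d: "4 \<le> d" and b: "stacked_ball K d \<F> \<G>" and z: "z \<notin> verts K"
  shows "g1 (cone_off K \<F> \<G> z) = g1 K + 1"
    "g2 (cone_off K \<F> \<G> z) = g2 K + int (card (\<Union>\<F>)) - int d"
proof -
  have S: "simplicial_complex K" using normal_pmD(1)[OF K] .
  have d3: "3 \<le> d" "2 \<le> d" using d by auto
  have C: "normal_pm d (cone_off K \<F> \<G> z)"
    using retriangulates_normal_pm[OF retriangulates_cone_off[OF K d3(1) b z]] .
  have "card (verts (cone_off K \<F> \<G> z)) = card (verts K) + 1"
    unfolding verts_cone_off[OF S d3(1) b z] using z finite_verts[OF S] by simp
  then show "g1 (cone_off K \<F> \<G> z) = g1 K + 1"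
    "g2 (cone_off K \<F> \<G> z) = g2 K + int (card (\<Union>\<F>)) - int d"
    using face_count_2_cone_off[OF S d b z]
    by (simp_all add: g1_eq[OF C d3(2)] g1_eq[OF K d3(2)] g2_eq[OF C d3(2)] g2_eq[OF K d3(2)] algebra_simps)
qed

lemma add_vertices:
  fixes K :: "nat set set"
  assumes d: "4 \<le> d" and K: "normal_pm d K"
  shows "\<exists>K' :: nat set set. retriangulates d K K' \<and> g1 K' = g1 K + int k \<and> g2 K' = g2 K"
proof (induction k)
  case 0
  show ?case using retriangulates_refl[OF K] by (intro exI[of _ K]) simp
next
  case (Suc k)
  then obtain K' :: "nat set set" where K': "retriangulates d K K'" "g1 K' = g1 K + int k" "g2 K' = g2 K" by blast
  note N = normal_pmD[OF retriangulates_normal_pm[OF K'(1)]]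
  obtain F where F: "F \<in> K'" "card F = d" using N(2)[OF simplicial_complexD(2)[OF N(1)]] by blast
  have b: "stacked_ball K' d {F} {}" by (rule stacked_ball.facet[OF F])
  obtain z where z: "z \<notin> verts K'" using ex_fresh_vertex[OF N(1)] by blast
  have "retriangulates d K' (cone_off K' {F} {} z)"
    by (rule retriangulates_cone_off[OF retriangulates_normal_pm[OF K'(1)] _ b z]) (use d in simp)
  then have "retriangulates d K (cone_off K' {F} {} z)" using K'(1) retriangulates_trans by blast
  then show ?case using g_cone_off[OF retriangulates_normal_pm[OF K'(1)] d b z] K'(2,3) F(2)
    by (intro exI[of _ "cone_off K' {F} {} z"]) simp
qed

lemma g2_complete:
  assumes "normal_pm d K" "2 \<le> d" "nonedges K = {}" "card (verts K) = a + d + 1"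
  shows "g1 K = int a" "g2 K = int (Suc a choose 2)"
proof -
  show "g1 K = int a" using g1_eq[OF assms(1,2)] assms(4) by simp
  \<comment> \<open>Doubled binomial coefficients are polynomials, so the identity can be checked by
    expansion over the integers.\<close>
  have two: "2 * int (n choose 2) = int n * (int n - 1)" for n
  proof (cases n)
    case (Suc m)
    have "even (n * (n - 1))" by (cases "even n") auto
    then have "2 * (n choose 2) = n * (n - 1)" by (simp add: choose_two)
    then have "2 * int (n choose 2) = int (n * (n - 1))" by linarith
    then show ?thesis using Suc by (simp add: algebra_simps)
  qed (simp add: binomial_eq_0)
  have "face_count K 2 = (a + d + 1) choose 2"
    using face_count_2_complete[OF normal_pmD(1)[OF assms(1)] assms(3)] assms(4) by simp
  then have "2 * g2 K = 2 * int ((a + d + 1) choose 2) - 2 * int d * int (a + d + 1) + 2 * int (d choose 2) + 2 * int d"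
    using g2_eq[OF assms(1,2)] assms(4) by simp
  also have "\<dots> = 2 * int (Suc a choose 2)" unfolding two by (simp add: algebra_simps)
  finally show "g2 K = int (Suc a choose 2)" by simp
qed

lemma g_pairs:
  fixes K :: "nat set set"
  assumes K: "normal_pm d K" and d: "4 \<le> d"
  shows "\<exists>\<gamma>::int. \<forall>a b::int. \<gamma> \<le> b \<and> b \<le> int (nat (a + 1) choose 2) \<longrightarrow>
    (\<exists>\<Delta> :: nat set set. retriangulates d K \<Delta> \<and> g1 \<Delta> = a \<and> g2 \<Delta> = b)"
proof -
  obtain n where n: "\<And>m. n \<le> m \<Longrightarrow> \<exists>K' :: nat set set. \<exists>Z. retriangulates d K K' \<and> hub K' Z \<and>
      card Z + 2 = d \<and> nonedges K' = {} \<and> card (verts K') = m"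
    using ex_complete_hub_card[OF K d] by blast
  show ?thesis
  \<comment> \<open>From \<open>n\<close> vertices on there are complete triangulations. The bound
    makes the index \<open>m\<close> below exceed \<open>n\<close>, and its summand 1 makes
    \<open>b\<close> positive.\<close>
  proof (intro exI[of _ "int (Suc n choose 2) + 1"] allI impI)
    fix a b :: int
    assume ab: "int (Suc n choose 2) + 1 \<le> b \<and> b \<le> int (nat (a + 1) choose 2)"
    then have b0: "0 < b" by linarith
    \<comment> \<open>For negative \<open>a\<close>, \<open>nat\<close> truncates and the upper
      bound on \<open>b\<close> is 0.\<close>
    have a0: "0 \<le> a"
    proof (rule ccontr)
      assume "\<not> 0 \<le> a"
      then have "nat (a + 1) = 0" by simp
      moreover have "(0::nat) choose 2 = 0" by (simp add: binomial_eq_0)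
      ultimately have "b \<le> 0" using ab by (simp only: of_nat_0)
      then show False using b0 by simp
    qed
    \<comment> \<open>With \<open>m = Suc l\<close>, minimality puts \<open>b\<close> above
      \<open>Suc l choose 2\<close>. The complete triangulation with \<open>g1 = l\<close> is the
      starting point; one cone leads to \<open>g1 = m\<close> and \<open>g2 = b\<close>.\<close>
    define m where "m = (LEAST m. b \<le> int (Suc m choose 2))"
    have bA: "b \<le> int (Suc (nat a) choose 2)" using ab a0 by (simp add: nat_add_distrib)
    have bm: "b \<le> int (Suc m choose 2)" unfolding m_def by (rule LeastI[where P = "\<lambda>m. b \<le> int (Suc m choose 2)", OF bA])
    have mA: "m \<le> nat a" unfolding m_def by (rule Least_le[where P = "\<lambda>m. b \<le> int (Suc m choose 2)", OF bA])
    have nm: "n < m"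
    proof (rule ccontr)
      assume "\<not> n < m"
      then have "Suc m * (Suc m - 1) div 2 \<le> Suc n * (Suc n - 1) div 2"
        by (intro div_le_mono mult_le_mono) auto
      then have "Suc m choose 2 \<le> Suc n choose 2" by (simp only: choose_two)
      then show False using bm ab by linarith
    qed
    then obtain l where l: "m = Suc l" by (cases m) auto
    have lb: "int (Suc l choose 2) < b"
    proof (rule ccontr)
      assume "\<not> int (Suc l choose 2) < b"
      then have "m \<le> l" unfolding m_def by (intro Least_le) simp
      then show False using l by simp
    qed
    have diff: "Suc m choose 2 = (Suc l choose 2) + Suc l" using l by (simp add: numeral_2_eq_2)
    define k where "k = nat (b - int (Suc l choose 2))"
    have k: "int k = b - int (Suc l choose 2)" "k \<le> Suc l" using lb bm diff k_def by auto
    obtain K0 :: "nat set set" and Z where K0: "retriangulates d K K0" "hub K0 Z" "card Z + 2 = d"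
      "nonedges K0 = {}" "card (verts K0) = l + d + 1"
      using n[of "l + d + 1"] nm l by auto
    have N0: "normal_pm d K0" using retriangulates_normal_pm[OF K0(1)] .
    have d2: "2 \<le> d" using d by simp
    note g0 = g2_complete[OF N0 d2 K0(4,5)]
    obtain \<F> \<G> where B: "stacked_ball K0 d \<F> \<G>" "\<Union>\<F> = verts K0"
      using hub_spanning_ball[OF d2 _ N0 K0(2)] K0(3) by auto
    \<comment> \<open>The spanning ball has \<open>l + d + 1\<close> vertices, just enough for the
      largest possible \<open>k\<close>, which is \<open>Suc l\<close>.\<close>
    have "d + k \<le> card (\<Union>\<F>)" using B(2) K0(5) k(2) by simp
    then obtain \<F>' \<G>' where B': "stacked_ball K0 d \<F>' \<G>'" "card (\<Union>\<F>') = d + k"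
      using stacked_ball_between[OF B(1) normal_pmD(1)[OF N0], of "d + k"] d by auto
    obtain z where z: "z \<notin> verts K0" using ex_fresh_vertex[OF normal_pmD(1)[OF N0]] by blast
    define K1 where "K1 = cone_off K0 \<F>' \<G>' z"
    have K1: "retriangulates d K0 K1" unfolding K1_def
      by (rule retriangulates_cone_off[OF N0 _ B'(1) z]) (use d in simp)
    have g: "g1 K1 = int m" "g2 K1 = b"
      using g_cone_off[OF N0 d B'(1) z] g0 B'(2) k(1) l unfolding K1_def by simp_all
    obtain \<Delta> :: "nat set set" where D: "retriangulates d K1 \<Delta>" "g1 \<Delta> = g1 K1 + int (nat a - m)" "g2 \<Delta> = g2 K1"
      using add_vertices[OF d retriangulates_normal_pm[OF K1]] by blast
    have "retriangulates d K \<Delta>" using K0(1) K1 D(1) retriangulates_trans by blast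
    moreover have "g1 \<Delta> = a" using D(2) g(1) mA a0 by simp
    ultimately show "\<exists>\<Delta> :: nat set set. retriangulates d K \<Delta> \<and> g1 \<Delta> = a \<and> g2 \<Delta> = b"
      using D(3) g(2) by blast
  qed
qed

section \<open>Homology manifolds\<close>

lemma normal_pm_transfer:
  fixes M :: "'a set set" and f :: "'a \<Rightarrow> 'b"
  assumes M: "normal_pm d M" and f: "inj_on f (verts M)"
  shows "normal_pm d ((`) f ` M)"
proof -
  note N = normal_pmD[OF M] and s = simplicial_complexD[OF normal_pmD(1)[OF M]]
  define g where "g = inv_into (verts M) f"
  let ?K = "(`) f ` M"
  have V: "\<sigma> \<subseteq> verts M" if "\<sigma> \<in> M" for \<sigma> using face_subset_verts[OF N(1) that] .
  have inj: "inj_on f \<sigma>" if "\<sigma> \<in> M" for \<sigma> using inj_on_subset[OF f V[OF that]] .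
  have mem: "f ` \<sigma> \<in> ?K \<longleftrightarrow> \<sigma> \<in> M" if "\<sigma> \<subseteq> verts M" for \<sigma>
    using inj_on_image_eq_iff[OF f that V] by blast
  have card: "card (f ` \<sigma>) = card \<sigma>" if "\<sigma> \<in> M" for \<sigma> using card_image[OF inj[OF that]] .
  have notin: "f v \<notin> f ` \<sigma> \<longleftrightarrow> v \<notin> \<sigma>" if "\<sigma> \<in> M" "v \<in> verts M" for \<sigma> v
    using inj_on_image_mem_iff[OF f that(2) V[OF that(1)]] by simp
  have pre: "\<exists>v\<in>verts M. x = f v" if xT: "insert x T \<in> ?K" for x T
  proof -
    obtain \<sigma> where "\<sigma> \<in> M" "insert x T = f ` \<sigma>" using xT by blast
    then show ?thesis using V by blast
  qed
  have S: "simplicial_complex ?K" unfolding simplicial_complex_def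
  proof (intro conjI ballI allI impI)
    show "{} \<in> ?K" using s(2) by (intro image_eqI[of _ _ "{}"]) auto
    fix \<sigma> \<tau> assume "\<sigma> \<in> ?K" "\<tau> \<subseteq> \<sigma>"
    then obtain \<sigma>' where s': "\<sigma>' \<in> M" "\<tau> \<subseteq> f ` \<sigma>'" by blast
    then obtain \<tau>' where t': "\<tau>' \<subseteq> \<sigma>'" "\<tau> = f ` \<tau>'" by (meson subset_imageE)
    then show "\<tau> \<in> ?K" using s(4)[OF s'(1) t'(1)] by blast
  qed (use s in auto)
  have ridge: "card {v. v \<notin> \<rho> \<and> insert v \<rho> \<in> ?K} = 2" if r: "\<rho> \<in> ?K" "card \<rho> + 1 = d" for \<rho>
  proof -
    obtain \<rho>' where r': "\<rho>' \<in> M" "\<rho> = f ` \<rho>'" using r by blast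
    let ?N = "{v. v \<notin> \<rho>' \<and> insert v \<rho>' \<in> M}"
    have NV: "?N \<subseteq> verts M" using V by blast
    have "{v. v \<notin> \<rho> \<and> insert v \<rho> \<in> ?K} = f ` ?N"
    proof
      show "f ` ?N \<subseteq> {v. v \<notin> \<rho> \<and> insert v \<rho> \<in> ?K}"
      proof
        fix x assume "x \<in> f ` ?N"
        then obtain v where v: "x = f v" "v \<notin> \<rho>'" "insert v \<rho>' \<in> M" by blast
        have "v \<in> verts M" using V[OF v(3)] by blast
        then have "x \<notin> \<rho>" using notin[OF r'(1)] v r' by simp
        moreover have "insert x \<rho> = f ` insert v \<rho>'" using v r' by simp
        ultimately show "x \<in> {v. v \<notin> \<rho> \<and> insert v \<rho> \<in> ?K}" using v(3) by blast
      qed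
      show "{v. v \<notin> \<rho> \<and> insert v \<rho> \<in> ?K} \<subseteq> f ` ?N"
      proof
        fix x assume "x \<in> {v. v \<notin> \<rho> \<and> insert v \<rho> \<in> ?K}"
        then have x: "x \<notin> \<rho>" "insert x \<rho> \<in> ?K" by auto
        then obtain v where v: "v \<in> verts M" "x = f v" using pre by blast
        have "insert x \<rho> = f ` insert v \<rho>'" using v r' by simp
        then have "insert v \<rho>' \<in> M" using x(2) mem[of "insert v \<rho>'"] v(1) V[OF r'(1)] by simp
        moreover have "v \<notin> \<rho>'" using x(1) v r' by blast
        ultimately show "x \<in> f ` ?N" using v by blast
      qed
    qed
    moreover have "card (f ` ?N) = card ?N" by (rule card_image[OF inj_on_subset[OF f NV]])
    ultimately show ?thesis using N(4)[OF r'(1)] r r' card by simp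
  qed
  have conn: "(link_adj ?K \<alpha>)\<^sup>*\<^sup>* x y"
    if a: "\<alpha> \<in> ?K" "card \<alpha> + 2 \<le> d" "link_adj ?K \<alpha> x x" "link_adj ?K \<alpha> y y" for \<alpha> x y
  proof -
    obtain \<alpha>' where a': "\<alpha>' \<in> M" "\<alpha> = f ` \<alpha>'" using a by blast
    have ex: "\<exists>v. x = f v \<and> link_adj M \<alpha>' v v" if "link_adj ?K \<alpha> x x" for x
    proof -
      have x: "x \<notin> \<alpha>" "insert x \<alpha> \<in> ?K" using that by (auto simp: link_adj_def)
      then obtain v where v: "v \<in> verts M" "x = f v" using pre by blast
      have "insert x \<alpha> = f ` insert v \<alpha>'" using v a' by simp
      then have "insert v \<alpha>' \<in> M" using x(2) mem[of "insert v \<alpha>'"] v(1) V[OF a'(1)] by simp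
      moreover have "v \<notin> \<alpha>'" using x(1) v a' by blast
      ultimately show ?thesis using v by (auto simp: link_adj_def)
    qed
    have step: "link_adj ?K \<alpha> (f u) (f v)" if "link_adj M \<alpha>' u v" for u v
    proof -
      have uv: "u \<notin> \<alpha>'" "v \<notin> \<alpha>'" "insert u (insert v \<alpha>') \<in> M" using that by (auto simp: link_adj_def)
      then have "u \<in> verts M" "v \<in> verts M" using V by blast+
      then have "f u \<notin> \<alpha>" "f v \<notin> \<alpha>" using notin[OF a'(1)] uv a' by simp_all
      moreover have "insert (f u) (insert (f v) \<alpha>) = f ` insert u (insert v \<alpha>')" using a' by simp
      ultimately show ?thesis unfolding link_adj_def using uv(3) by blast
    qed
    obtain u v where uv: "x = f u" "link_adj M \<alpha>' u u" "y = f v" "link_adj M \<alpha>' v v"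
      using ex[OF a(3)] ex[OF a(4)] by blast
    have "card \<alpha>' + 2 \<le> d" using a(2) card[OF a'(1)] a' by simp
    then have "(link_adj M \<alpha>')\<^sup>*\<^sup>* u v" using N(5)[OF a'(1)] uv by blast
    then have "(link_adj ?K \<alpha>)\<^sup>*\<^sup>* (f u) (f v)"
      by (induction rule: rtranclp_induct) (auto intro: step rtranclp.rtrancl_into_rtrancl)
    then show ?thesis using uv by simp
  qed
  have pure: "\<exists>\<tau>\<in>?K. \<sigma> \<subseteq> \<tau> \<and> card \<tau> = d" if sK: "\<sigma> \<in> ?K" for \<sigma>
  proof -
    obtain \<sigma>' where s': "\<sigma>' \<in> M" "\<sigma> = f ` \<sigma>'" using sK by blast
    obtain \<tau> where t: "\<tau> \<in> M" "\<sigma>' \<subseteq> \<tau>" "card \<tau> = d" using N(2)[OF s'(1)] by blast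
    then have "f ` \<tau> \<in> ?K" "\<sigma> \<subseteq> f ` \<tau>" "card (f ` \<tau>) = d" using card s' by auto
    then show ?thesis by blast
  qed
  have le: "card \<sigma> \<le> d" if "\<sigma> \<in> ?K" for \<sigma>
    using that N(3) card by auto
  show ?thesis unfolding normal_pm_def
    by (intro conjI ballI allI impI; (rule S | erule pure | erule le | erule (1) ridge | erule (3) conn))
qed

text \<open>The maps \<open>h\<close> and \<open>k\<close> transport barycentric coordinates along
  the bijection of the vertex sets, with value 0 at all other points of the types.\<close>

lemma realization_image_homeomorphic:
  fixes M :: "'a set set" and f :: "'a \<Rightarrow> 'b"
  assumes M: "simplicial_complex M" and f: "inj_on f (verts M)"
  shows "realization ((`) f ` M) homeomorphic realization M"
proof -
  define V where "V = verts M"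
  define g where "g = inv_into V f"
  have gf: "g (f v) = v" if "v \<in> V" for v using f that unfolding g_def V_def by simp
  have finV: "finite V" using finite_verts[OF M] V_def by simp
  have MV: "\<sigma> \<subseteq> V" if "\<sigma> \<in> M" for \<sigma> using face_subset_verts[OF M that] V_def by simp
  let ?K = "(`) f ` M"
  define h :: "('b \<Rightarrow> real) \<Rightarrow> 'a \<Rightarrow> real" where "h y = (\<lambda>v. if v \<in> V then y (f v) else 0)" for y
  define k :: "('a \<Rightarrow> real) \<Rightarrow> 'b \<Rightarrow> real" where "k x = (\<lambda>n. if n \<in> f ` V then x (g n) else 0)" for x
  have supp_h: "f ` {v. h y v \<noteq> 0} = {n. y n \<noteq> 0}" and sum_h: "(\<Sum>v | h y v \<noteq> 0. h y v) = (\<Sum>n | y n \<noteq> 0. y n)"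
    if "{n. y n \<noteq> 0} \<subseteq> f ` V" for y
  proof -
    show im: "f ` {v. h y v \<noteq> 0} = {n. y n \<noteq> 0}" using that by (auto simp: h_def)
    have "{v. h y v \<noteq> 0} \<subseteq> V" by (auto simp: h_def)
    then have "inj_on f {v. h y v \<noteq> 0}" using inj_on_subset f V_def by blast
    then have "(\<Sum>n\<in>f ` {v. h y v \<noteq> 0}. y n) = (\<Sum>v | h y v \<noteq> 0. y (f v))" by (simp add: sum.reindex)
    also have "\<dots> = (\<Sum>v | h y v \<noteq> 0. h y v)" by (intro sum.cong) (auto simp: h_def)
    finally show "(\<Sum>v | h y v \<noteq> 0. h y v) = (\<Sum>n | y n \<noteq> 0. y n)" unfolding im by simp
  qed
  have hM: "h y \<in> realization M" if y: "y \<in> realization ?K" for y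
  proof -
    obtain \<sigma> where s: "\<sigma> \<in> M" "{n. y n \<noteq> 0} = f ` \<sigma>" using y unfolding realization_def by auto
    have sub: "{n. y n \<noteq> 0} \<subseteq> f ` V" using s MV by blast
    have "f ` {v. h y v \<noteq> 0} = f ` \<sigma>" using supp_h[OF sub] s by simp
    moreover have "{v. h y v \<noteq> 0} \<subseteq> V" by (auto simp: h_def)
    ultimately have "{v. h y v \<noteq> 0} = \<sigma>" using inj_on_image_eq_iff[of f V] f MV[OF s(1)] V_def by blast
    then show ?thesis using y s(1) sum_h[OF sub] unfolding realization_def by (auto simp: h_def)
  qed
  have hk: "h (k x) = x" if x: "x \<in> realization M" for x
  proof
    fix v show "h (k x) v = x v"
    proof (cases "v \<in> V")
      case True then show ?thesis by (simp add: h_def k_def gf)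
    next
      case False
      have "{v. x v \<noteq> 0} \<in> M" using x by (simp add: realization_def)
      then have "x v = 0" using MV False by blast
      then show ?thesis using False by (simp add: h_def)
    qed
  qed
  have kK: "k x \<in> realization ?K" if x: "x \<in> realization M" for x
  proof -
    have sub: "{n. k x n \<noteq> 0} \<subseteq> f ` V" by (auto simp: k_def)
    have "{n. k x n \<noteq> 0} = f ` {v. x v \<noteq> 0}" using supp_h[OF sub] hk[OF x] by simp
    moreover have "{v. x v \<noteq> 0} \<in> M" using x by (simp add: realization_def)
    moreover have "0 \<le> k x n" for n using x by (simp add: realization_def k_def)
    moreover have "(\<Sum>n | k x n \<noteq> 0. k x n) = 1"
      using sum_h[OF sub] hk[OF x] x by (simp add: realization_def)
    ultimately show ?thesis unfolding realization_def by auto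
  qed
  have kh: "k (h y) = y" if y: "y \<in> realization ?K" for y
  proof
    fix n show "k (h y) n = y n"
    proof (cases "n \<in> f ` V")
      case True then show ?thesis by (auto simp: h_def k_def gf)
    next
      case False
      have "{n. y n \<noteq> 0} \<in> ?K" using y by (simp add: realization_def)
      then have "y n = 0" using MV False by blast
      then show ?thesis using False by (simp add: k_def)
    qed
  qed
  have ch: "continuous_on S h" for S
  proof (intro continuous_on_coordinatewise_then_product)
    fix v show "continuous_on S (\<lambda>y. h y v)" by (cases "v \<in> V") (simp_all add: h_def continuous_on_eval)
  qed
  have ck: "continuous_on S k" for S
  proof (intro continuous_on_coordinatewise_then_product)
    fix n show "continuous_on S (\<lambda>y. k y n)" by (cases "n \<in> f ` V") (simp_all add: k_def continuous_on_eval)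
  qed
  have "h ` realization ?K = realization M" using hM kK hk by (metis image_subsetI subsetI subset_antisym image_eqI)
  moreover have "k ` realization M = realization ?K" using hM kK kh by (metis image_subsetI subsetI subset_antisym image_eqI)
  ultimately have "homeomorphism (realization ?K) (realization M) h k"
    unfolding homeomorphism_def using hk kh ch ck by blast
  then show ?thesis unfolding homeomorphic_def by blast
qed

section \<open>Reduced homology in degree zero\<close>

lemma mem_link: "\<tau> \<in> link K \<rho> \<longleftrightarrow> \<tau> \<inter> \<rho> = {} \<and> \<tau> \<union> \<rho> \<in> K"
  by (simp add: link_def)

text \<open>A 0-chain given by its coefficients; its index in the shifted grading is 1.\<close>

definition vertex_chain :: "('a \<Rightarrow> 'k::field) \<Rightarrow> 'a set \<Rightarrow> 'k" where
  "vertex_chain e \<sigma> = (if \<exists>v. \<sigma> = {v} then e (the_elem \<sigma>) else 0)"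

lemma vertex_chain_singleton [simp]: "vertex_chain e {v} = e v"
  by (simp add: vertex_chain_def)

text \<open>The boundary at the empty face is the augmentation, that is, the sum of the
  coefficients.\<close>

lemma vertex_chain_cycle:
  fixes e :: "'a::linorder \<Rightarrow> 'k::field"
  assumes "finite {v. {v} \<in> L}" "\<And>v. e v \<noteq> 0 \<Longrightarrow> {v} \<in> L" "(\<Sum>v | {v} \<in> L. e v) = 0"
  shows "vertex_chain e \<in> cycles L 1"
proof -
  have "vertex_chain e \<in> chains L 1"
    using assms(2) unfolding chains_def vertex_chain_def by auto
  moreover have "boundary_map L (vertex_chain e) \<sigma> = 0" for \<sigma>
  proof (cases "\<sigma> = {}")
    case True
    then show ?thesis using assms(3) by (simp add: boundary_map_def)
  next
    case False
    have "vertex_chain e (insert v \<sigma>) = 0" if "v \<notin> \<sigma>" for v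
      using that False unfolding vertex_chain_def by auto
    then show ?thesis unfolding boundary_map_def by (intro sum.neutral) auto
  qed
  ultimately show ?thesis unfolding cycles_def by auto
qed

lemma boundary_map_vertex:
  fixes c :: "'a::linorder set \<Rightarrow> 'k::field"
  shows "boundary_map L c {u} = (\<Sum>v | v \<noteq> u \<and> {v, u} \<in> L. (if u < v then - 1 else 1) * c {v, u})"
proof -
  have "card {t \<in> {u}. t < v} = (if u < v then 1 else 0)" for v
  proof -
    have "{t \<in> {u}. t < v} = (if u < v then {u} else {})" by auto
    then have "card {t \<in> {u}. t < v} = card (if u < v then {u} else {})" by (rule arg_cong)
    also have "\<dots> = (if u < v then 1 else 0)" by simp
    finally show ?thesis .
  qed
  then have "(- 1) ^ card {t \<in> {u}. t < v} = (if u < v then - 1 else (1::'k))" for v by (simp only:) simp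
  then show ?thesis unfolding boundary_map_def by (intro sum.cong) auto
qed

text \<open>An edge enters the boundary with opposite signs at its two ends, and a set closed under
  adjacency contains both ends or none.\<close>

lemma sum_boundary_component:
  fixes c :: "'a::linorder set \<Rightarrow> 'k::field"
  assumes fin: "finite C" and finV: "finite {v. {v} \<in> L}"
    and sub: "\<And>u v. {u, v} \<in> L \<Longrightarrow> {v} \<in> L"
    and closed: "\<And>u v. u \<in> C \<Longrightarrow> {v, u} \<in> L \<Longrightarrow> v \<in> C"
  shows "(\<Sum>u\<in>C. boundary_map L c {u}) = 0"
proof -
  \<comment> \<open>Lists each edge inside \<open>C\<close> once, by its ends in increasing order;
    the swapped pairs account for the other end.\<close>
  define P where "P = {(u, v). u \<in> C \<and> v \<in> C \<and> u < v \<and> {u, v} \<in> L}"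
  define w where "w u v = (if u < v then - 1 else (1::'k)) * c {v, u}" for u v
  have finP: "finite P" by (rule finite_subset[of _ "C \<times> C"]) (auto simp: P_def fin)
  have fN: "finite {v. v \<noteq> u \<and> {v, u} \<in> L}" for u
    by (rule finite_subset[OF _ finV]) (use sub in \<open>auto simp: insert_commute\<close>)
  have "(\<Sum>u\<in>C. boundary_map L c {u}) = (\<Sum>u\<in>C. \<Sum>v | v \<noteq> u \<and> {v, u} \<in> L. w u v)"
    by (simp add: boundary_map_vertex w_def)
  also have "\<dots> = (\<Sum>(u, v)\<in>(SIGMA u:C. {v. v \<noteq> u \<and> {v, u} \<in> L}). w u v)"
    by (rule sum.Sigma) (use fin fN in auto)
  also have "(SIGMA u:C. {v. v \<noteq> u \<and> {v, u} \<in> L}) = P \<union> (\<lambda>(u, v). (v, u)) ` P"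
  proof -
    have iff: "(u, v) \<in> (SIGMA u:C. {v. v \<noteq> u \<and> {v, u} \<in> L}) \<longleftrightarrow> (u, v) \<in> P \<union> (\<lambda>(u, v). (v, u)) ` P" for u v
      using closed[of u v] neq_iff[of u v] by (auto simp: P_def insert_commute image_iff)
    show ?thesis
    proof (rule set_eqI)
      fix p :: "'a \<times> 'a"
      obtain u v where p: "p = (u, v)" by (cases p)
      show "p \<in> (SIGMA u:C. {v. v \<noteq> u \<and> {v, u} \<in> L}) \<longleftrightarrow> p \<in> P \<union> (\<lambda>(u, v). (v, u)) ` P"
        unfolding p by (rule iff)
    qed
  qed
  also have "(\<Sum>(u, v)\<in>P \<union> (\<lambda>(u, v). (v, u)) ` P. w u v)
      = (\<Sum>(u, v)\<in>P. w u v) + (\<Sum>(u, v)\<in>(\<lambda>(u, v). (v, u)) ` P. w u v)"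
    by (rule sum.union_disjoint) (use finP in \<open>auto simp: P_def\<close>)
  also have "(\<Sum>(u, v)\<in>(\<lambda>(u, v). (v, u)) ` P. w u v) = (\<Sum>(u, v)\<in>P. w v u)"
  proof -
    have "inj_on (\<lambda>(u, v). (v, u)) P" by (auto simp: inj_on_def)
    from sum.reindex[OF this, of "\<lambda>(u, v). w u v"] show ?thesis by (simp add: case_prod_unfold)
  qed
  also have "(\<Sum>(u, v)\<in>P. w u v) + (\<Sum>(u, v)\<in>P. w v u) = (\<Sum>(u, v)\<in>P. w u v + w v u)"
    by (simp add: sum.distrib case_prod_unfold)
  also have "\<dots> = 0"
    by (intro sum.neutral) (auto simp: w_def P_def insert_commute)
  finally show ?thesis .
qed

lemma zero_homology_class:
  fixes z :: "'a::linorder set \<Rightarrow> 'k::field"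
  assumes "homology_class L n z = homology_class L n 0"
  shows "z \<in> boundaries L n"
proof -
  have "(\<lambda>_. 0) \<in> chains L (Suc n)" by (simp add: chains_def)
  moreover have "boundary_map L (\<lambda>_. 0) = (0 :: 'a set \<Rightarrow> 'k)" by (auto simp: boundary_map_def)
  ultimately have "(0 :: 'a set \<Rightarrow> 'k) \<in> boundaries L n" unfolding boundaries_def by (metis image_eqI)
  then have "z + 0 \<in> z +o boundaries L n" by (rule set_plus_intro2)
  then have "z \<in> (0 :: 'a set \<Rightarrow> 'k) +o boundaries L n" using assms by (simp add: homology_class_def)
  then show ?thesis by (simp add: set_zero_plus)
qed

text \<open>If \<open>x\<close> and \<open>y\<close> were in different components, the cycle
  \<open>x - y\<close> would be a boundary, as index 1 carries no homology. But a boundary has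
  coefficient sum 0 on each component, and the sum on that of \<open>x\<close> is 1.\<close>

lemma link_edges_connected:
  fixes L :: "'a::linorder set set"
  assumes S: "simplicial_complex L" and h: "has_sphere_homology TYPE('k::field) L m" and m: "m \<noteq> 1"
    and xy: "{x} \<in> L" "{y} \<in> L"
  shows "(\<lambda>u v. {u, v} \<in> L)\<^sup>*\<^sup>* x y"
proof (rule ccontr)
  let ?R = "\<lambda>u v. {u, v} \<in> L"
  assume n: "\<not> ?R\<^sup>*\<^sup>* x y"
  then have ne: "x \<noteq> y" by auto
  define e :: "'a \<Rightarrow> 'k" where "e v = (if v = x then 1 else if v = y then - 1 else 0)" for v
  have finV: "finite {v. {v} \<in> L}" using finite_verts[OF S] by (simp add: verts_def)
  have "(\<Sum>v | {v} \<in> L. e v) = (\<Sum>v\<in>{x, y}. e v)"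
    using finV xy by (intro sum.mono_neutral_right) (auto simp: e_def)
  also have "\<dots> = 0" using ne by (simp add: e_def)
  finally have z: "vertex_chain e \<in> cycles L 1"
    by (intro vertex_chain_cycle finV) (use xy in \<open>auto simp: e_def split: if_splits\<close>)
  have "(reduced_homology L 1 :: ('a set \<Rightarrow> 'k) set set) = {homology_class L 1 0}"
    using h m unfolding has_sphere_homology_def by auto
  then have "homology_class L 1 (vertex_chain e) = homology_class L 1 0"
    using z unfolding reduced_homology_def by blast
  then have "vertex_chain e \<in> boundaries L 1" by (rule zero_homology_class)
  then obtain c where c: "vertex_chain e = boundary_map L c" unfolding boundaries_def by blast
  define C where "C = {v. {v} \<in> L \<and> ?R\<^sup>*\<^sup>* x v}"
  have finC: "finite C" using finV unfolding C_def by simp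
  have sub: "{v} \<in> L" if "{u, v} \<in> L" for u v using simplicial_complexD(4)[OF S that] by auto
  have "(\<Sum>u\<in>C. boundary_map L c {u}) = 0"
  proof (rule sum_boundary_component[OF finC finV sub])
    show "v \<in> C" if "u \<in> C" "{v, u} \<in> L" for u v
      using that sub[of u v] unfolding C_def by (auto simp: insert_commute intro: rtranclp.rtrancl_into_rtrancl)
  qed
  moreover have "(\<Sum>u\<in>C. boundary_map L c {u}) = (\<Sum>u\<in>C. e u)" unfolding c[symmetric] by simp
  moreover have "(\<Sum>u\<in>C. e u) = (\<Sum>u\<in>{x}. e u)"
    using finC xy n by (intro sum.mono_neutral_right) (auto simp: C_def e_def)
  ultimately show False by (simp add: e_def)
qed

text \<open>Without edges all boundaries at index 1 vanish, so the reduced homology consists of the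
  coefficient functions with sum 0. Its dimension is one less than the number of vertices if there
  are any.\<close>

lemma card_vertices_sphere_0:
  fixes L :: "'a::linorder set set"
  assumes S: "simplicial_complex L" and h: "has_sphere_homology TYPE('k::field) L 1"
    and one: "\<And>\<sigma>. \<sigma> \<in> L \<Longrightarrow> card \<sigma> \<le> 1"
  shows "card {v. {v} \<in> L} = 2"
proof -
  let ?W = "{v. {v} \<in> L}"
  have fin: "finite ?W" using finite_verts[OF S] by (simp add: verts_def)
  obtain \<phi> :: "('a set \<Rightarrow> 'k) set \<Rightarrow> 'k" where bij: "bij_betw \<phi> (reduced_homology L 1) UNIV"
    and \<phi>: "\<forall>y\<in>cycles L 1. \<forall>z\<in>cycles L 1.
        \<phi> (homology_class L 1 (y + z)) = \<phi> (homology_class L 1 y) + \<phi> (homology_class L 1 z)"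
      "\<forall>a. \<forall>z\<in>cycles L 1. \<phi> (homology_class L 1 (\<lambda>\<sigma>. a * z \<sigma>)) = a * \<phi> (homology_class L 1 z)"
    using h unfolding has_sphere_homology_def by (elim conjE exE) (rule that; assumption)
  have add: "\<phi> (homology_class L 1 (y + z)) = \<phi> (homology_class L 1 y) + \<phi> (homology_class L 1 z)"
    if "y \<in> cycles L 1" "z \<in> cycles L 1" for y z using \<phi>(1) that by simp
  have scale: "\<phi> (homology_class L 1 (\<lambda>\<sigma>. a * z \<sigma>)) = a * \<phi> (homology_class L 1 z)"
    if "z \<in> cycles L 1" for a z using \<phi>(2) that by simp
  have bd: "z = 0" if zb: "z \<in> boundaries L 1" for z :: "'a set \<Rightarrow> 'k"
  proof -
    obtain c where c: "c \<in> chains L 2" "z = boundary_map L c"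
      using zb unfolding boundaries_def by (auto simp: numeral_2_eq_2)
    have "c \<sigma> = 0" for \<sigma> using c(1) one[of \<sigma>] unfolding chains_def by force
    then show ?thesis using c(2) by (auto simp: boundary_map_def)
  qed
  have z0: "(0 :: 'a set \<Rightarrow> 'k) \<in> cycles L 1"
    by (auto simp: cycles_def chains_def boundary_map_def)
  have inj: "z = 0" if "z \<in> cycles L 1" "\<phi> (homology_class L 1 z) = 0" for z
  proof -
    have "\<phi> (homology_class L 1 0) = 0" using scale[OF z0, of 0] by (simp add: zero_fun_def)
    moreover have "homology_class L 1 u \<in> reduced_homology L 1" if "u \<in> cycles L 1" for u :: "'a set \<Rightarrow> 'k"
      unfolding reduced_homology_def using that by (rule imageI)
    ultimately have "homology_class L 1 z = homology_class L 1 0"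
      using inj_onD[OF bij_betw_imp_inj_on[OF bij], of "homology_class L 1 z" "homology_class L 1 0"] that z0
      by simp
    then show ?thesis by (intro bd zero_homology_class)
  qed
  define e :: "'a \<Rightarrow> 'a \<Rightarrow> 'a \<Rightarrow> 'k" where "e x y v = (if v = x then 1 else if v = y then - 1 else 0)" for x y v
  have cyc: "vertex_chain (e x y) \<in> cycles L 1" if "{x} \<in> L" "{y} \<in> L" "x \<noteq> y" for x y
  proof -
    have "(\<Sum>v | {v} \<in> L. e x y v) = (\<Sum>v\<in>{x, y}. e x y v)"
      using fin that by (intro sum.mono_neutral_right) (auto simp: e_def)
    also have "\<dots> = 0" using that by (simp add: e_def)
    finally show ?thesis
      by (intro vertex_chain_cycle fin) (use that in \<open>auto simp: e_def split: if_splits\<close>)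
  qed
  have le: "card ?W \<le> 2"
  proof (rule ccontr)
    assume "\<not> card ?W \<le> 2"
    then have "3 \<le> card ?W" by simp
    then obtain T where T: "T \<subseteq> ?W" "card T = 3" by (meson obtain_subset_with_card_n)
    then obtain p q r where pqr: "p \<noteq> q" "p \<noteq> r" "q \<noteq> r" "{p} \<in> L" "{q} \<in> L" "{r} \<in> L"
      unfolding card_3_iff by auto
    \<comment> \<open>The cycles \<open>p - q\<close> and \<open>p - r\<close> are independent.
      Weighted crosswise with their values under \<phi>, they combine to a cycle of value 0, which
      must vanish.\<close>
    let ?y = "vertex_chain (e p q)" and ?z = "vertex_chain (e p r)"
    have y: "?y \<in> cycles L 1" and z: "?z \<in> cycles L 1" using cyc pqr by auto
    define a where "a = \<phi> (homology_class L 1 ?y)"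
    define b where "b = \<phi> (homology_class L 1 ?z)"
    have scaled: "(\<lambda>\<sigma>. t * u \<sigma>) \<in> cycles L 1" if "u \<in> cycles L 1" for t and u :: "'a set \<Rightarrow> 'k"
    proof -
      have "boundary_map L (\<lambda>\<sigma>. t * u \<sigma>) \<sigma> = t * boundary_map L u \<sigma>" for \<sigma>
        unfolding boundary_map_def sum_distrib_left by (intro sum.cong) (auto simp: mult_ac)
      then show ?thesis using that unfolding cycles_def chains_def by auto
    qed
    have sum: "u + v \<in> cycles L 1" if "u \<in> cycles L 1" "v \<in> cycles L 1" for u v :: "'a set \<Rightarrow> 'k"
    proof -
      have "boundary_map L (u + v) \<sigma> = boundary_map L u \<sigma> + boundary_map L v \<sigma>" for \<sigma>
        unfolding boundary_map_def by (simp add: algebra_simps sum.distrib)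
      moreover have "u \<sigma> \<noteq> 0 \<or> v \<sigma> \<noteq> 0" if "(u + v) \<sigma> \<noteq> 0" for \<sigma> using that by auto
      then have "u + v \<in> chains L 1" using that unfolding cycles_def chains_def by blast
      ultimately show ?thesis using that unfolding cycles_def by auto
    qed
    let ?s = "(\<lambda>\<sigma>. b * ?y \<sigma>) + (\<lambda>\<sigma>. (- a) * ?z \<sigma>)"
    have "\<phi> (homology_class L 1 ?s) = b * a + (- a) * b"
      unfolding add[OF scaled[OF y] scaled[OF z]] scale[OF y] scale[OF z] a_def b_def ..
    then have "\<phi> (homology_class L 1 ?s) = 0" by (simp add: mult.commute)
    then have "?s = 0" by (rule inj[OF sum[OF scaled[OF y] scaled[OF z]]])
    then have "?s {q} = 0" by (simp only: zero_fun_def)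
    then have "b = 0" using pqr by (simp add: e_def)
    then have "?z = 0" using inj[OF z] b_def by simp
    then have "?z {p} = 0" by (simp only: zero_fun_def)
    then show False by (simp add: e_def)
  qed
  have ge: "2 \<le> card ?W"
  proof (rule ccontr)
    assume "\<not> 2 \<le> card ?W"
    then have small: "card ?W \<le> 1" by simp
    \<comment> \<open>With at most one vertex a coefficient sum of 0 leaves only the zero cycle, and
      \<phi> is not onto.\<close>
    have zero: "z = 0" if z: "z \<in> cycles L 1" for z :: "'a set \<Rightarrow> 'k"
    proof -
      have ch: "\<sigma> \<in> L \<and> card \<sigma> = 1" if "z \<sigma> \<noteq> 0" for \<sigma> using z that unfolding cycles_def chains_def by auto
      have "z {v} = 0" for v
      proof (cases "{v} \<in> L")
        case True
        then have "?W = {v}" using small fin card_le_Suc0_iff_eq[OF fin] by auto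
        moreover have "boundary_map L z {} = (\<Sum>v\<in>?W. z {v})" by (simp add: boundary_map_def)
        moreover have "boundary_map L z = 0" using z unfolding cycles_def by simp
        ultimately show ?thesis by simp
      next
        case False then show ?thesis using ch by blast
      qed
      then have "z \<sigma> = 0" for \<sigma> using ch[of \<sigma>] by (auto simp: card_1_singleton_iff)
      then show ?thesis by auto
    qed
    then have "reduced_homology L 1 \<subseteq> {homology_class L 1 (0 :: 'a set \<Rightarrow> 'k)}"
      unfolding reduced_homology_def by blast
    then have "UNIV \<subseteq> {\<phi> (homology_class L 1 0)}" using bij unfolding bij_betw_def by blast
    then show False by (metis UNIV_I singletonD subsetD zero_neq_one)
  qed
  show ?thesis using le ge by simp
qed

lemma simplicial_complex_link:
  assumes "simplicial_complex K" "\<rho> \<in> K"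
  shows "simplicial_complex (link K \<rho>)"
proof -
  note s = simplicial_complexD[OF assms(1)]
  have sub: "\<tau> \<in> K" if "\<tau> \<in> link K \<rho>" for \<tau> using s(4)[of "\<tau> \<union> \<rho>" \<tau>] that by (auto simp: mem_link)
  then have "link K \<rho> \<subseteq> K" by blast
  moreover have "\<tau>' \<in> link K \<rho>" if "\<tau> \<in> link K \<rho>" "\<tau>' \<subseteq> \<tau>" for \<tau> \<tau>'
  proof -
    have "\<tau> \<union> \<rho> \<in> K" using that by (simp add: mem_link)
    then have "\<tau>' \<union> \<rho> \<in> K" by (rule s(4)) (use that in auto)
    then show ?thesis using that by (auto simp: mem_link)
  qed
  moreover have "{} \<in> link K \<rho>" using assms(2) by (simp add: mem_link)
  ultimately show ?thesis unfolding simplicial_complex_def using s(1,3) finite_subset by blast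
qed

text \<open>The sum \<open>t\<close> of the coordinates over the edge component of \<open>x\<close>
  is continuous and takes only the values 0 and 1 on the realization. It takes both if
  \<open>y\<close> lies in another component, so connectedness would force the value 1/2.\<close>

lemma connected_realization_edges:
  assumes S: "simplicial_complex M" and c: "connected (realization M)" and xy: "{x} \<in> M" "{y} \<in> M"
  shows "(\<lambda>u v. {u, v} \<in> M)\<^sup>*\<^sup>* x y"
proof (rule ccontr)
  let ?R = "\<lambda>u v. {u, v} \<in> M"
  assume n: "\<not> ?R\<^sup>*\<^sup>* x y"
  define V where "V = verts M"
  define C where "C = {v \<in> V. ?R\<^sup>*\<^sup>* x v}"
  have finV: "finite V" using finite_verts[OF S] V_def by simp
  have CV: "C \<subseteq> V" by (auto simp: C_def)
  note real = in_realization_iff[OF S finV, unfolded V_def[symmetric], OF subset_refl]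
  have face: "\<sigma> \<subseteq> C \<or> \<sigma> \<inter> C = {}" if "\<sigma> \<in> M" for \<sigma>
  proof -
    have "v \<in> C" if "u \<in> \<sigma>" "v \<in> \<sigma>" "u \<in> C" for u v
    proof -
      have "{u, v} \<in> M" by (rule simplicial_complexD(4)[OF S \<open>\<sigma> \<in> M\<close>]) (use that in auto)
      then show ?thesis using that(2,3) face_subset_verts[OF S \<open>\<sigma> \<in> M\<close>] V_def
        unfolding C_def by (auto intro: rtranclp.rtrancl_into_rtrancl)
    qed
    then show ?thesis by blast
  qed
  define t where "t z = sum z C" for z :: "'a \<Rightarrow> real"
  have vals: "t z = 0 \<or> t z = 1" if z: "z \<in> realization M" for z
  proof -
    have z': "{v. z v \<noteq> 0} \<in> M" "sum z V = 1" using z real by auto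
    from face[OF z'(1)] show ?thesis
    proof
      assume "{v. z v \<noteq> 0} \<subseteq> C"
      then have "sum z V = sum z C" by (intro sum.mono_neutral_right finV CV) auto
      then show ?thesis using z' by (simp add: t_def)
    next
      assume "{v. z v \<noteq> 0} \<inter> C = {}"
      then have "sum z C = 0" by (intro sum.neutral) auto
      then show ?thesis by (simp add: t_def)
    qed
  qed
  have "continuous_on (realization M) t"
    unfolding t_def by (intro continuous_on_sum continuous_on_eval)
  then have conn: "connected (t ` realization M)" using c connected_continuous_image by blast
  have point: "(\<lambda>v. if v = u then 1 else 0) \<in> realization M" if "{u} \<in> M" for u
  proof -
    have "u \<in> V" using that by (simp add: V_def verts_def)
    then show ?thesis unfolding real using that finV by auto
  qed
  have xC: "x \<in> C" using xy by (simp add: C_def V_def verts_def)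
  have yC: "y \<notin> C" using n by (simp add: C_def)
  have finC: "finite C" using CV finV finite_subset by blast
  have "t (\<lambda>v. if v = x then 1 else 0) = 1" using xC finC by (simp add: t_def)
  moreover have "t (\<lambda>v. if v = y then 1 else 0) = 0" unfolding t_def by (intro sum.neutral) (use yC in auto)
  ultimately have "1 \<in> t ` realization M" "0 \<in> t ` realization M" using point xy by (metis image_eqI)+
  then have "1 / 2 \<in> t ` realization M" using connectedD_interval[OF conn, of 0 1 "1/2"] by simp
  then obtain z where "z \<in> realization M" "t z = 1 / 2" by auto
  then show False using vals[of z] by auto
qed

text \<open>The link of a ridge has no edges and the homology of the 0-sphere, so it is two points.
  The links of smaller nonempty faces have no reduced homology in degree 0, so they are connected.
  The manifold condition says nothing about \<alpha> = {}; there the connectedness of the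
  realization is used.\<close>

lemma homology_manifold_normal_pm:
  fixes M :: "'a::linorder set set"
  assumes M: "homology_manifold TYPE('k::field) M" and c: "connected (realization M)"
    and d: "complex_rank M = d" "2 \<le> d"
  shows "normal_pm d M"
proof -
  have S: "simplicial_complex M" and P: "pure_complex M"
    and H: "\<And>\<rho>. \<rho> \<in> M \<Longrightarrow> \<rho> \<noteq> {} \<Longrightarrow> has_sphere_homology TYPE('k) (link M \<rho>) (d - card \<rho>)"
    using M d(1) unfolding homology_manifold_def by auto
  note s = simplicial_complexD[OF S]
  have le: "card \<sigma> \<le> d" if "\<sigma> \<in> M" for \<sigma>
    unfolding d(1)[symmetric] complex_rank_def using that s(1) by simp
  have pure: "\<exists>\<tau>\<in>M. \<sigma> \<subseteq> \<tau> \<and> card \<tau> = d" if sg: "\<sigma> \<in> M" for \<sigma>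
  proof -
    obtain \<tau> where t: "\<tau> \<in> M" "\<sigma> \<subseteq> \<tau>" "\<And>\<tau>'. \<tau>' \<in> M \<Longrightarrow> \<tau> \<subseteq> \<tau>' \<Longrightarrow> \<tau>' = \<tau>"
      using finite_has_maximal2[OF s(1) sg] by metis
    then have "card \<tau> = d" using P d(1) unfolding pure_complex_def by blast
    then show ?thesis using t by blast
  qed
  have ridge: "card {v. v \<notin> \<rho> \<and> insert v \<rho> \<in> M} = 2" if r: "\<rho> \<in> M" "card \<rho> + 1 = d" for \<rho>
  proof -
    have "\<rho> \<noteq> {}" using r d(2) by auto
    moreover have "d - card \<rho> = 1" using r by simp
    ultimately have h: "has_sphere_homology TYPE('k) (link M \<rho>) 1" using H[OF r(1)] by metis
    have "card \<sigma> \<le> 1" if "\<sigma> \<in> link M \<rho>" for \<sigma>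
    proof -
      have k: "\<sigma> \<union> \<rho> \<in> M" "\<sigma> \<inter> \<rho> = {}" using that by (auto simp: mem_link)
      have "finite \<sigma>" "finite \<rho>" using s(3)[OF k(1)] by auto
      then have "card (\<sigma> \<union> \<rho>) = card \<sigma> + card \<rho>" using k(2) card_Un_disjoint by blast
      then show ?thesis using le[OF k(1)] r(2) by simp
    qed
    from card_vertices_sphere_0[OF simplicial_complex_link[OF S r(1)] h this]
    show ?thesis by (simp add: mem_link)
  qed
  have conn: "(link_adj M \<alpha>)\<^sup>*\<^sup>* x y"
    if a: "\<alpha> \<in> M" "card \<alpha> + 2 \<le> d" "link_adj M \<alpha> x x" "link_adj M \<alpha> y y" for \<alpha> x y
  proof -
    have edge: "{u, v} \<in> link M \<alpha> \<longleftrightarrow> link_adj M \<alpha> u v" for u v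
      by (auto simp: mem_link link_adj_def)
    have xy: "{x} \<in> link M \<alpha>" "{y} \<in> link M \<alpha>" using a edge[of x x] edge[of y y] by auto
    have "(\<lambda>u v. {u, v} \<in> link M \<alpha>)\<^sup>*\<^sup>* x y"
    proof (cases "\<alpha> = {}")
      case True
      then have "link M \<alpha> = M" by (auto simp: mem_link)
      then show ?thesis using connected_realization_edges[OF S c] xy by simp
    next
      case False
      have "d - card \<alpha> \<noteq> 1" using a(2) by simp
      then show ?thesis using link_edges_connected[OF simplicial_complex_link[OF S a(1)] H[OF a(1) False]] xy by blast
    qed
    then show ?thesis by (simp add: edge)
  qed
  show ?thesis unfolding normal_pm_def
    by (intro conjI ballI allI impI; (rule S | erule pure | erule le | erule (1) ridge | erule (3) conn))
qed

theorem theorem5p14: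
  fixes M :: "'a::linorder set set" and d :: nat
  assumes "homology_manifold TYPE('k::field) M"
    and "connected (realization M)"
    and "complex_rank M = d" and "d \<ge> 4"
  shows "\<exists>\<gamma>::int. \<forall>a b::int. \<gamma> \<le> b \<and> b \<le> int (nat (a + 1) choose 2) \<longrightarrow>
    (\<exists>\<Delta> :: nat set set. triangulation_of \<Delta> M \<and> g1 \<Delta> = a \<and> g2 \<Delta> = b)"
proof -
  have N: "normal_pm d M" by (rule homology_manifold_normal_pm[OF assms(1-3)]) (use assms(4) in simp)
  have S: "simplicial_complex M" using normal_pmD(1)[OF N] .
  \<comment> \<open>Natural numbers as vertices supply fresh vertices for all later moves, even if
    the type of the vertices of \<open>M\<close> is finite.\<close>
  obtain f :: "'a \<Rightarrow> nat" where f: "inj_on f (verts M)"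
    using finite_imp_inj_to_nat_seg[OF finite_verts[OF S]] by blast
  define K where "K = (`) f ` M"
  have K: "normal_pm d K" unfolding K_def by (rule normal_pm_transfer[OF N f])
  have KM: "realization K homeomorphic realization M"
    unfolding K_def by (rule realization_image_homeomorphic[OF S f])
  have "triangulation_of \<Delta> M" if "retriangulates d K \<Delta>" for \<Delta> :: "nat set set"
    using that KM homeomorphic_trans normal_pmD(1) unfolding retriangulates_def triangulation_of_def by blast
  then show ?thesis using g_pairs[OF K assms(4)] by meson
qed

end
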